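(* There exist absolute constants $c_1,c_2>0$ such that for every $n\ge2$ both of the following hold. (A) For every $j\in\{1,\dots,n\}$ and for all sufficiently large $N$, $c_1\,j\,V_j(D_n)\le N^{\frac{2}{n-1}}\Delta_j(D_n,\mathscr{C}_N)\le c_2\,j\,V_j(D_n)$ for $\mathscr{C}_N\in\{\mathscr{P}_N^i,\mathscr{P}_{(N)}^o\}$. (B) With these same constants, for all sufficiently large $N$ there exists a polytope $P_N\in\mathscr{P}_N^i$, and likewise there exists a polytope $P_N\in\mathscr{P}_{(N)}^o$, such that $$c_1\,n\,N^{-\frac{2}{n-1}}\le\max_{j=1,\dots,n}\frac{\Delta_j(D_n,P_N)}{V_j(D_n)}\le c_2\,n\,N^{-\frac{2}{n-1}}.$$
   Context: $D_n$ is the closed Euclidean unit ball in $\mathbb{R}^n$ and $|\cdot|$ is volume. The intrinsic volumes $V_0,\dots,V_n$ of a compact convex set $K\subset\mathbb{R}^n$ are defined by Steiner's formula $|K+rD_n|=\sum_{j=0}^n r^j|D_j|V_{n-j}(K)$ for all $r\ge0$. The $j$th intrinsic volume deviation is $\Delta_j(K,L)=V_j(K)+V_j(L)-2V_j(K\cap L)$, and $\Delta_j(D_n,\mathscr{C}_N)=\min_{P\in\mathscr{C}_N}\Delta_j(D_n,P)$. $\mathscr{P}_N^i$ is the class of convex polytopes $P\subset D_n$ with at most $N$ vertices; $\mathscr{P}_{(N)}^o$ is the class of convex polytopes $P\supset D_n$ in $\mathbb{R}^n$ with at most $N$ facets. "Absolute constant" means independent of $n,j,N$; the threshold for "sufficiently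 large $N$" may depend on $n$ (and $j$). *)

theory Defs
  imports "HOL-Analysis.Analysis" "HOL-Analysis.Finite_Function_Topology"
begin

text \<open>
  The constants in the theorem are uniform in the dimension \<open>n\<close>, so \<open>n\<close> has to be quantified inside a
  formula and cannot be a type. All the spaces \<open>\<real>\<^sup>n\<close> are therefore realised inside one real vector
  space, the finitely supported real sequences, as the sequences supported in \<open>{..<n}\<close>. The
  library norm on this type is the \<open>l\<^sup>1\<close> norm; it is not used below, and the topology it induces on
  each \<open>\<real>\<^sup>n\<close> is the usual one.
\<close>

type_synonym point = "nat \<Rightarrow>\<^sub>0 real"

definition Rn :: "nat \<Rightarrow> point set" where
  "Rn n = {x. Poly_Mapping.keys x \<subseteq> {..<n}}"

definition unit_ball :: "nat \<Rightarrow> point set" where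
  "unit_ball n = {x \<in> Rn n. sqrt (\<Sum>i<n. (Poly_Mapping.lookup x i)\<^sup>2) \<le> 1}"

text \<open>Lebesgue measure, transported along the coordinate bijection from \<open>Rn n\<close> to \<open>{..<n} \<rightarrow>\<^sub>E UNIV\<close>.\<close>

definition vol :: "nat \<Rightarrow> point set \<Rightarrow> real" where
  "vol n A = measure (Pi\<^sub>M {..<n} (\<lambda>_. lborel))
     ((\<lambda>x. restrict (Poly_Mapping.lookup x) {..<n}) ` A)"

definition parallel_body :: "nat \<Rightarrow> point set \<Rightarrow> real \<Rightarrow> point set" where
  "parallel_body n K r = {x + r *\<^sub>R y | x y. x \<in> K \<and> y \<in> unit_ball n}"

text \<open>
  For compact convex \<open>K \<subseteq> Rn n\<close> there is exactly one family \<open>V\<close> as below: Steiner's formula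
  determines \<open>V 0, \<dots>, V n\<close>, and the remaining values are fixed to be \<open>0\<close>.
\<close>

definition intrinsic_volume :: "nat \<Rightarrow> nat \<Rightarrow> point set \<Rightarrow> real" where
  "intrinsic_volume n j K =
     (THE V :: nat \<Rightarrow> real. (\<forall>i>n. V i = 0) \<and>
        (\<forall>r\<ge>0. vol n (parallel_body n K r)
                  = (\<Sum>i\<le>n. r ^ i * vol i (unit_ball i) * V (n - i)))) j"

definition intrinsic_deviation :: "nat \<Rightarrow> nat \<Rightarrow> point set \<Rightarrow> point set \<Rightarrow> real" where
  "intrinsic_deviation n j K L =
     intrinsic_volume n j K + intrinsic_volume n j L - 2 * intrinsic_volume n j (K \<inter> L)"

text \<open>A genuine minimum: the value is meaningful only if the least deviation is attained in \<open>C\<close>.\<close>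

definition min_deviation :: "nat \<Rightarrow> nat \<Rightarrow> point set set \<Rightarrow> real" where
  "min_deviation n j C = (LEAST d. d \<in> intrinsic_deviation n j (unit_ball n) ` C)"

text \<open>
  The library's \<^const>\<open>facet_of\<close> and \<^const>\<open>aff_dim\<close> are restricted to Euclidean spaces; for a
  nonempty set the affine dimension is the linear dimension of its difference set.
\<close>

definition affine_dim :: "point set \<Rightarrow> nat" where
  "affine_dim S = dim {x - y | x y. x \<in> S \<and> y \<in> S}"

definition is_facet :: "point set \<Rightarrow> point set \<Rightarrow> bool" where
  "is_facet F P \<longleftrightarrow> F face_of P \<and> F \<noteq> {} \<and> affine_dim F + 1 = affine_dim P"

definition inner_polytopes :: "nat \<Rightarrow> nat \<Rightarrow> point set set" where
  "inner_polytopes n N =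
     {P. polytope P \<and> P \<noteq> {} \<and> P \<subseteq> unit_ball n \<and> card {v. v extreme_point_of P} \<le> N}"

definition outer_polytopes :: "nat \<Rightarrow> nat \<Rightarrow> point set set" where
  "outer_polytopes n N =
     {P. polytope P \<and> P \<subseteq> Rn n \<and> unit_ball n \<subseteq> P \<and> card {F. is_facet F P} \<le> N}"

end

theory Submission
  imports Defs
begin

text \<open>
  Let \<open>D\<close> be the unit ball. For a convex body \<open>K\<close> and a segment \<open>[0,u]\<close> the volume of
  \<open>K + Q + t[0,u]\<close> is affine in \<open>t \<ge> 0\<close>, so \<open>r \<mapsto> |K + rZ|\<close> is a polynomial for every zonotope \<open>Z\<close>.
  The ball is a limit of zonotopes, which yields Steiner's formula. The same argument shows that a linear
  inequality \<open>\<Sum>\<^sub>k c\<^sub>k |K\<^sub>k + Q| \<ge> 0\<close> that holds for all convex bodies \<open>Q\<close> implies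
  \<open>\<Sum>\<^sub>k c\<^sub>k V\<^sub>j(K\<^sub>k) \<ge> 0\<close> for every \<open>j\<close>.

  If \<open>K \<subseteq> D\<close> has \<open>N\<close> vertices, then \<open>K + Q\<close> is covered by \<open>aD + Q\<close> and \<open>N\<close> sets \<open>M + Q\<close>, where
  \<open>M\<close> is a cap of \<open>D\<close> together with \<open>aD\<close>; if \<open>1 - a\<close> is a small multiple of
  \<open>N\<close> to the power \<open>-2/(n-1)\<close>, at least \<open>2N\<close> congruent copies of such sets fit into \<open>D + Q\<close> without
  overlapping outside \<open>aD + Q\<close>. Hence \<open>V\<^sub>j(K) - V\<^sub>j(aD) \<le> (V\<^sub>j(D) - V\<^sub>j(aD)) / 2\<close>, which is
  the lower bound; circumscribed polytopes are treated dually. The upper bounds come from a maximal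
  separated subset of the sphere, used as the set of vertices or as the set of facet normals.
\<close>

section \<open>Translation invariant measures\<close>

text \<open>Since the dimension is quantified, no type of dimension \<open>n\<close> is available:
  the geometry lives in a subspace \<open>E\<close> of an arbitrary inner product space with an
  abstract measure, and \<open>n\<close> enters its axioms only as a scaling exponent until facets
  need a linear dimension. Rotation invariance is derived, and only for reflections; a reflection
  exchanges any two vectors of equal norm, so this suffices.

  Testing with every summand \<open>Q\<close> lets union bounds and disjointness, which are
  arguments about volume, serve all \<open>j\<close> at once. The factor j comes from homogeneity
  alone: V_j(sD) = s^j V_j(D), and 1 - (1 - s)^j is of order j s while j s is small.

  Volume estimates near the sphere lose factors of the form C^(n-1). They are harmless, because
  distances are (n-1)-th roots of cardinalities; this is why the constants are absolute.

  Circumscribed polytopes can be arbitrarily large, so compactness alone gives no minimum in that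
  class. The problem is truncated at radius 2, and for large N the truncated minimiser is shown not
  to reach that radius.\<close>

definition refl_along :: "'a::real_inner \<Rightarrow> 'a \<Rightarrow> 'a" where
  "refl_along d x = x - (2 * (x \<bullet> d) / (d \<bullet> d)) *\<^sub>R d"

lemma linear_refl_along: "linear (refl_along d)"
proof (rule linearI)
  show "refl_along d (x + y) = refl_along d x + refl_along d y" for x y
    by (simp add: refl_along_def inner_add_left distrib_left add_divide_distrib scaleR_add_left)
  show "refl_along d (c *\<^sub>R x) = c *\<^sub>R refl_along d x" for c x
    by (simp add: refl_along_def scaleR_diff_right ac_simps)
qed

lemma refl_along_refl_along [simp]: "refl_along d (refl_along d x) = x"
  by (cases "d = 0") (simp_all add: refl_along_def inner_diff_left algebra_simps)

lemma norm_refl_along [simp]: "norm (refl_along d x) = norm x"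
proof (cases "d = 0")
  case False
  then have "refl_along d x \<bullet> refl_along d x = x \<bullet> x"
    by (simp add: refl_along_def inner_diff_left inner_diff_right field_simps inner_commute)
  then show ?thesis by (simp add: norm_eq_sqrt_inner)
qed (simp add: refl_along_def)

lemma inner_refl_along: "refl_along d x \<bullet> y = x \<bullet> refl_along d y"
  by (simp add: refl_along_def inner_diff_left inner_diff_right inner_commute)

lemma continuous_refl_along [continuous_intros]: "continuous_on S (refl_along d)"
  unfolding refl_along_def divide_inverse by (intro continuous_intros)

lemma measurable_refl_along [measurable]: 
  "refl_along d \<in> borel_measurable (borel :: 'a::{real_inner,second_countable_topology} measure)"
  by (intro borel_measurable_continuous_onI continuous_intros)

text \<open>Equal norms give \<open>(x - y) \<bullet> (x - y) = 2 * (x \<bullet> (x - y))\<close>,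
  so exactly one copy of \<open>x - y\<close> is subtracted. Every use of symmetry below moves a
  vector to another one of the same norm by this reflection; for \<open>x = y\<close> division by
  zero turns it into the identity.\<close>

lemma refl_along_diff:
  assumes "norm x = norm y" shows "refl_along (x - y) x = y"
proof (cases "x = y")
  case False
  have e: "x \<bullet> x = y \<bullet> y" using assms by (simp add: norm_eq_sqrt_inner)
  then have "(x - y) \<bullet> (x - y) = 2 * (x \<bullet> (x - y))"
    by (simp add: inner_diff_left inner_diff_right inner_commute)
  moreover have "(x - y) \<bullet> (x - y) \<noteq> 0" using False by simp
  ultimately have "2 * (x \<bullet> (x - y)) / ((x - y) \<bullet> (x - y)) = 1"
    by (metis divide_self)
  then show ?thesis unfolding refl_along_def by (simp only: scaleR_one) simp
qed (simp add: refl_along_def)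

lemma refl_along_image_eq_vimage: "refl_along d ` A = refl_along d -` A"
  by (force intro: rev_image_eqI)

text \<open>Lebesgue measure on an \<open>n\<close>-dimensional subspace, seen as a measure on the
  ambient space that charges only \<open>E\<close>. Compactness of the unit ball of \<open>E\<close>
  is an axiom because the ambient space may be infinite-dimensional; the behaviour under translation
  and dilation is what a product measure yields directly.\<close>

locale euclid_volume =
  fixes E :: "'a::{real_inner,second_countable_topology} set" and L :: "'a measure" and n :: nat
  assumes subspace_E: "subspace E"
    and compact_unit: "compact (E \<inter> cball 0 1)"
    and sets_L [measurable_cong]: "sets L = sets borel"
    and AE_E: "AE x in L. x \<in> E"
    and distr_plus: "a \<in> E \<Longrightarrow> distr L borel ((+) a) = L"
    and emeasure_scaleR: "r > 0 \<Longrightarrow> A \<in> sets borel \<Longrightarrow>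
      emeasure L ((*\<^sub>R) r ` A) = ennreal (r ^ n) * emeasure L A"
    and emeasure_unit_pos: "0 < emeasure L (cball 0 1)"
    and emeasure_unit_finite: "emeasure L (cball 0 1) < \<infinity>"
begin

lemma space_L [simp]: "space L = UNIV"
  using sets_eq_imp_space_eq[OF sets_L] by simp

lemma refl_along_E: "d \<in> E \<Longrightarrow> x \<in> E \<Longrightarrow> refl_along d x \<in> E"
  unfolding refl_along_def using subspace_E by (simp add: subspace_diff subspace_scale)

definition D :: "real \<Rightarrow> 'a set" where "D r = E \<inter> cball 0 r"

lemma in_D: "x \<in> D r \<longleftrightarrow> x \<in> E \<and> norm x \<le> r"
  by (auto simp: D_def)

lemma D_scale:
  assumes "r > 0" shows "(*\<^sub>R) r ` D s = D (r * s)"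
proof -
  have "x \<in> (*\<^sub>R) r ` D s" if "x \<in> D (r * s)" for x
    using that assms subspace_E
    by (intro image_eqI[of _ _ "inverse r *\<^sub>R x"])
       (auto simp: in_D subspace_scale field_simps)
  then show ?thesis using assms subspace_E by (auto simp: in_D subspace_scale)
qed

lemma cball_scale:
  assumes "r > 0" shows "(*\<^sub>R) r ` cball 0 s = cball (0::'a) (r * s)"
  using assms by (subst cball_scale) auto

lemma compact_D: "compact (D r)"
proof (cases "r > 0")
  case True
  then show ?thesis
    using D_scale[of r 1] compact_scaling[OF compact_unit, of r] by (simp add: D_def)
next
  case False
  then have "norm x \<le> r \<Longrightarrow> x = 0" for x :: 'a
    using norm_ge_zero[of x] by (metis norm_le_zero_iff not_less order_trans)
  then have "D r \<subseteq> {0}" by (auto simp: in_D)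
  then show ?thesis by (metis compact_empty compact_sing subset_singletonD)
qed

lemma convex_D: "convex (D r)"
  unfolding D_def by (intro convex_Int subspace_imp_convex subspace_E convex_cball)

lemma emeasure_cball_finite: "emeasure L (cball 0 r) < \<infinity>"
proof -
  have "cball (0::'a) r \<subseteq> cball 0 (max r 1)" by auto
  then have "emeasure L (cball 0 r) \<le> emeasure L (cball 0 (max r 1))"
    by (intro emeasure_mono) (auto simp: sets_L)
  also have "\<dots> = ennreal (max r 1 ^ n) * emeasure L (cball 0 1)"
    using emeasure_scaleR[of "max r 1" "cball 0 1"] cball_scale[of "max r 1" 1] by simp
  also have "\<dots> < \<infinity>"
    using emeasure_unit_finite by (simp add: ennreal_mult_less_top)
  finally show ?thesis .
qed

lemma sigma_finite_L: "sigma_finite_measure L"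
proof
  have "(\<Union>k::nat. cball (0::'a) (real k)) = UNIV"
    by (auto simp: real_arch_simple)
  then show "\<exists>A. countable A \<and> A \<subseteq> sets L \<and> \<Union>A = space L \<and> (\<forall>a\<in>A. emeasure L a \<noteq> \<infinity>)"
    using emeasure_cball_finite
    by (intro exI[of _ "range (\<lambda>k::nat. cball 0 (real k))"]) (force simp: sets_L less_top)
qed

lemma nn_integral_plus:
  assumes "a \<in> E" and [measurable]: "f \<in> borel_measurable borel"
  shows "(\<integral>\<^sup>+x. f (a + x) \<partial>L) = (\<integral>\<^sup>+x. f x \<partial>L)"
proof -
  have "(\<integral>\<^sup>+x. f x \<partial>L) = (\<integral>\<^sup>+x. f x \<partial>distr L borel ((+) a))"
    using distr_plus[OF assms(1)] by simp
  also have "\<dots> = (\<integral>\<^sup>+x. f (a + x) \<partial>L)"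
    by (rule nn_integral_distr) simp_all
  finally show ?thesis by simp
qed

text \<open>A reflection turns \<open>L\<close> into another translation invariant measure \<open>M\<close>; integrating
  \<open>1\<^sub>C(y) 1\<^sub>A(x + y)\<close> for the reflection invariant ball \<open>C\<close> in both orders gives
  \<open>M(A) L(C) = L(A) M(C)\<close>.\<close>

lemma distr_refl_along:
  assumes d: "d \<in> E"
  shows "distr L borel (refl_along d) = L"
proof -
  define g where "g = refl_along d"
  define M where "M = distr L borel g"
  define C where "C = cball (0::'a) 1"
  have [measurable]: "g \<in> borel_measurable borel" "C \<in> sets borel"
    unfolding g_def C_def by measurable
  have gE: "x \<in> E \<Longrightarrow> g x \<in> E" for x using refl_along_E[OF d] by (simp add: g_def)
  have gg: "g (g x) = x" for x by (simp add: g_def)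
  have ng: "norm (g x) = norm x" for x by (simp add: g_def)
  have gadd: "g (x + y) = g x + g y" for x y
    using linear_add[OF linear_refl_along[of d]] by (simp add: g_def)
  have [measurable_cong]: "sets M = sets borel" by (simp add: M_def)
  have ME: "AE x in M. x \<in> E"
  proof -
    have E: "E = (\<Union>k::nat. D (real k))" by (auto simp: in_D real_arch_simple)
    have "E \<in> sets borel"
      by (subst E, intro sets.countable_UN) (auto intro: borel_compact compact_D)
    then show ?thesis unfolding M_def
      using AE_E by (subst AE_distr_iff) (auto simp: gE elim!: eventually_mono)
  qed
  have MC: "emeasure M C = emeasure L C"
    unfolding M_def by (subst emeasure_distr) (auto simp: C_def ng intro!: arg_cong[of _ _ "emeasure L"])
  have Mplus: "(\<integral>\<^sup>+x. f (a + x) \<partial>M) = (\<integral>\<^sup>+x. f x \<partial>M)"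
    if "a \<in> E" and [measurable]: "f \<in> borel_measurable borel" for a f
  proof -
    have "(\<integral>\<^sup>+x. f (a + x) \<partial>M) = (\<integral>\<^sup>+x. f (a + g x) \<partial>L)"
      unfolding M_def by (rule nn_integral_distr) measurable
    also have "\<dots> = (\<integral>\<^sup>+x. f (g (g a + x)) \<partial>L)" by (simp add: gadd gg)
    also have "\<dots> = (\<integral>\<^sup>+x. f (g x) \<partial>L)"
      using nn_integral_plus[OF gE[OF that(1)], of "\<lambda>x. f (g x)"] by simp
    also have "\<dots> = (\<integral>\<^sup>+x. f x \<partial>M)"
      unfolding M_def by (rule nn_integral_distr[symmetric]) measurable
    finally show ?thesis .
  qed
  interpret L: sigma_finite_measure L by (rule sigma_finite_L)
  interpret M: sigma_finite_measure M
  proof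
    have "(\<Union>k::nat. cball (0::'a) (real k)) = UNIV"
      by (auto simp: real_arch_simple)
    moreover have "emeasure M (cball 0 r) = emeasure L (cball 0 r)" for r
      unfolding M_def by (subst emeasure_distr) (auto simp: ng intro!: arg_cong[of _ _ "emeasure L"])
    ultimately show "\<exists>A. countable A \<and> A \<subseteq> sets M \<and> \<Union>A = space M \<and> (\<forall>a\<in>A. emeasure M a \<noteq> \<infinity>)"
      using emeasure_cball_finite
      by (intro exI[of _ "range (\<lambda>k::nat. cball 0 (real k))"]) (force simp: M_def less_top)
  qed
  interpret pair_sigma_finite L M ..
  have main: "emeasure M A = emeasure L A" if [measurable]: "A \<in> sets borel" for A
  proof -
    have "emeasure L C * emeasure M A = (\<integral>\<^sup>+y. indicator C y * emeasure M A \<partial>L)"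
      by (subst nn_integral_multc) (auto simp: sets_L)
    also have "\<dots> = (\<integral>\<^sup>+y. (\<integral>\<^sup>+x. indicator C y * indicator A (y + x) \<partial>M) \<partial>L)"
    proof (rule nn_integral_cong_AE, use AE_E in eventually_elim)
      case (elim y)
      have "(\<integral>\<^sup>+x. indicator A (y + x) \<partial>M) = emeasure M A"
        using Mplus[OF elim, of "indicator A"] by simp
      then show ?case by (subst nn_integral_cmult) auto
    qed
    also have "\<dots> = (\<integral>\<^sup>+x. (\<integral>\<^sup>+y. indicator C y * indicator A (y + x) \<partial>L) \<partial>M)"
      by (rule Fubini'[symmetric]) measurable
    also have "\<dots> = (\<integral>\<^sup>+x. (\<integral>\<^sup>+y. indicator C (y - x) * indicator A y \<partial>L) \<partial>M)"
    proof (rule nn_integral_cong_AE, use ME in eventually_elim)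
      case (elim x)
      show ?case
        using nn_integral_plus[OF elim, of "\<lambda>y. indicator C (y - x) * indicator A y"]
        by (simp add: add.commute)
    qed
    also have "\<dots> = (\<integral>\<^sup>+y. (\<integral>\<^sup>+x. indicator C (y - x) * indicator A y \<partial>M) \<partial>L)"
      by (rule Fubini') measurable
    also have "\<dots> = (\<integral>\<^sup>+y. emeasure M C * indicator A y \<partial>L)"
    proof (rule nn_integral_cong_AE, use AE_E in eventually_elim)
      case (elim y)
      have "(indicator C (y - x) :: ennreal) = indicator C (- y + x)" for x
        by (simp add: C_def indicator_def norm_minus_commute)
      then have "(\<integral>\<^sup>+x. indicator C (y - x) \<partial>M) = (\<integral>\<^sup>+x. indicator C (- y + x) \<partial>M)"
        by simp
      also have "\<dots> = emeasure M C"
        using Mplus[of "- y" "indicator C"] elim subspace_E by (simp add: subspace_neg)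
      finally show ?case by (subst nn_integral_multc) auto
    qed
    also have "\<dots> = emeasure M C * emeasure L A"
      by (subst nn_integral_cmult) (auto simp: sets_L)
    finally have "emeasure L C * emeasure M A = emeasure L C * emeasure L A" using MC by simp
    then show ?thesis
      using emeasure_unit_pos emeasure_unit_finite
      by (subst (asm) ennreal_mult_cancel_left) (auto simp: C_def)
  qed
  have "M = L"
    by (rule measure_eqI) (auto simp: main sets_L M_def[symmetric] \<open>sets M = sets borel\<close>)
  then show ?thesis by (simp add: M_def g_def)
qed

end

section \<open>Volume of a body plus a zonotope\<close>

lemma poly_coeffs_unique:
  fixes a b :: "nat \<Rightarrow> real"
  assumes "\<And>r. r > 0 \<Longrightarrow> (\<Sum>i\<le>m. a i * r ^ i) = (\<Sum>i\<le>m. b i * r ^ i)" and "i \<le> m"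
  shows "a i = b i"
proof (rule ccontr)
  assume "a i \<noteq> b i"
  then have "finite {z. (\<Sum>i\<le>m. (a i - b i) * z ^ i) = 0}"
    using Transcendental.polyfun_rootbound[of "\<lambda>i. a i - b i" i m] \<open>i \<le> m\<close> by auto
  moreover have "{0<..} \<subseteq> {z. (\<Sum>i\<le>m. (a i - b i) * z ^ i) = 0}"
    using assms(1) by (auto simp: left_diff_distrib sum_subtractf)
  ultimately show False
    using infinite_Ioi finite_subset by blast
qed

text \<open>Passing from r to 2r and subtracting \<open>2 ^ Suc n\<close> times the original value
  cancels the top term and multiplies the coefficient of index k by
  \<open>2 ^ k - 2 ^ Suc n\<close>, which is nonzero. Induction settles the lower coefficients, and
  the top one is a difference at r = 1.\<close>

lemma poly_coeffs_convergent:
  fixes a :: "nat \<Rightarrow> nat \<Rightarrow> real"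
  assumes "\<And>r. r > 0 \<Longrightarrow> convergent (\<lambda>m. \<Sum>i\<le>n. a m i * r ^ i)" and "i \<le> n"
  shows "convergent (\<lambda>m. a m i)"
  using assms
proof (induction n arbitrary: a i)
  case 0
  then show ?case using 0(1)[of 1] by simp
next
  case (Suc n)
  have low: "convergent (\<lambda>m. a m k)" if "k \<le> n" for k
  proof -
    have "convergent (\<lambda>m. a m k * (2 ^ k - 2 ^ Suc n))"
    proof (rule Suc.IH[OF _ that])
      fix r :: real assume "r > 0"
      have "(\<Sum>i\<le>n. a m i * (2 ^ i - 2 ^ Suc n) * r ^ i)
          = (\<Sum>i\<le>Suc n. a m i * (2 * r) ^ i) - 2 ^ Suc n * (\<Sum>i\<le>Suc n. a m i * r ^ i)" for m
        by (simp add: sum_distrib_left sum_subtractf algebra_simps power_mult_distrib)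
      moreover have "convergent (\<lambda>m. (\<Sum>i\<le>Suc n. a m i * (2 * r) ^ i) - 2 ^ Suc n * (\<Sum>i\<le>Suc n. a m i * r ^ i))"
        using Suc.prems(1)[of r] Suc.prems(1)[of "2 * r"] \<open>r > 0\<close>
        by (intro convergent_diff convergent_mult convergent_const) auto
      ultimately show "convergent (\<lambda>m. \<Sum>i\<le>n. a m i * (2 ^ i - 2 ^ Suc n) * r ^ i)" by simp
    qed
    moreover have "(2::real) ^ k - 2 ^ Suc n \<noteq> 0"
      using power_strict_increasing[of k "Suc n" "2::real"] that by simp
    ultimately show ?thesis using convergent_mult_const_right_iff by blast
  qed
  show ?case
  proof (cases "i \<le> n")
    case False
    then have i: "i = Suc n" using Suc.prems by simp
    have "convergent (\<lambda>m. (\<Sum>i\<le>Suc n. a m i * 1 ^ i) - (\<Sum>i\<le>n. a m i))"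
      using low by (intro convergent_diff[OF Suc.prems(1)[of 1] convergent_sum]) simp_all
    moreover have "(\<Sum>i\<le>Suc n. a m i * 1 ^ i) - (\<Sum>i\<le>n. a m i) = a m i" for m
      by (simp add: i)
    ultimately show ?thesis by (simp only:)
  qed (rule low)
qed

text \<open>The volume of a body plus a scaled zonotope is first seen to be a polynomial whose
  degree is bounded by the number of segments; the growth bound then removes the terms above
  \<open>n\<close>. Nonnegativity excludes cancellation, so a single term can be compared with the
  whole sum.\<close>

lemma poly_growth_coeffs:
  fixes e :: "nat \<Rightarrow> real"
  assumes nonneg: "\<And>i. e i \<ge> 0"
    and le: "\<And>r. r \<ge> 1 \<Longrightarrow> (\<Sum>i\<le>m. e i * r ^ i) \<le> C * r ^ n"
    and i: "i > n" "i \<le> m"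
  shows "e i = 0"
proof (rule ccontr)
  assume "e i \<noteq> 0"
  then have pos: "e i > 0" using nonneg[of i] by linarith
  define r where "r = max 1 (C / e i + 1)"
  have r: "r \<ge> 1" by (simp add: r_def)
  have "e i * (r * r ^ n) \<le> e i * r ^ i"
    using r i(1) pos power_increasing[of "Suc n" i r] by simp
  also have "\<dots> \<le> (\<Sum>i\<le>m. e i * r ^ i)"
    using r i nonneg by (intro member_le_sum) auto
  also have "\<dots> \<le> C * r ^ n" by (rule le[OF r])
  finally have "e i * r \<le> C" using r by (simp add: mult.assoc[symmetric])
  moreover have "e i * r \<ge> C + e i"
    using pos mult_left_mono[of "C / e i + 1" r "e i"] by (simp add: r_def distrib_left)
  ultimately show False using pos by linarith
qed

text \<open>Nonnegativity makes \<open>h\<close> monotone, which replaces continuity in Cauchy's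
  functional equation: \<open>t\<close> is squeezed between neighbouring multiples of 1/N, and the
  error \<open>h 1 / real N\<close> vanishes.\<close>

lemma additive_nonneg_imp_linear:
  fixes h :: "real \<Rightarrow> real"
  assumes add: "\<And>s t. s \<ge> 0 \<Longrightarrow> t \<ge> 0 \<Longrightarrow> h (s + t) = h s + h t"
    and nonneg: "\<And>t. t \<ge> 0 \<Longrightarrow> h t \<ge> 0" and t: "t \<ge> 0"
  shows "h t = t * h 1"
proof -
  have mono: "h s \<le> h t" if "0 \<le> s" "s \<le> t" for s t
    using add[of s "t - s"] nonneg[of "t - s"] that by simp
  have h0: "h 0 = 0" using add[of 0 0] by simp
  have mult: "h (real k * s) = real k * h s" if "s \<ge> 0" for k s
    by (induction k) (use that h0 add in \<open>simp_all add: distrib_right\<close>)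
  have "\<bar>h t - t * h 1\<bar> \<le> h 1 / real N" if N: "N > 0" for N :: nat
  proof -
    define k where "k = nat \<lfloor>t * N\<rfloor>"
    have k: "real k \<le> t * N" "t * N \<le> real (Suc k)"
      using t unfolding k_def by (auto simp: of_nat_nat) linarith
    have hN: "h (real j / real N) = real j * (h 1 / real N)" for j
      using mult[of "1 / real N" j] mult[of "1 / real N" N] N by simp
    have "h (real k / real N) \<le> h t" "h t \<le> h (real (Suc k) / real N)"
      using k N t by (auto intro!: mono simp: field_simps)
    then have h: "real k * (h 1 / real N) \<le> h t" "h t \<le> real (Suc k) * (h 1 / real N)"
      unfolding hN by auto
    have "h 1 / real N \<ge> 0" using nonneg[of 1] by simp
    then have "real k * (h 1 / real N) \<le> (t * N) * (h 1 / real N)"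
      "(t * N) * (h 1 / real N) \<le> real (Suc k) * (h 1 / real N)"
      using k by (blast intro: mult_right_mono)+
    moreover have "(t * N) * (h 1 / real N) = t * h 1" using N by simp
    moreover have "real (Suc k) * (h 1 / real N) = real k * (h 1 / real N) + h 1 / real N"
      by (simp add: add_divide_distrib distrib_right)
    ultimately show ?thesis using h by linarith
  qed
  then have "\<bar>h t - t * h 1\<bar> \<le> h 1 / real (Suc N)" for N by blast
  then have "\<bar>h t - t * h 1\<bar> \<le> 0"
    using lim_const_over_n[of "h 1"] by (intro LIMSEQ_le_const[OF LIMSEQ_Suc]) auto
  then show ?thesis by simp
qed

section \<open>Segments and zonotopes\<close>

definition seg :: "'a::real_vector \<Rightarrow> 'a set" where "seg u = closed_segment 0 u"

lemma in_seg_scaleR: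
  assumes "t \<ge> 0" shows "x \<in> seg (t *\<^sub>R u) \<longleftrightarrow> (\<exists>s. 0 \<le> s \<and> s \<le> t \<and> x = s *\<^sub>R u)"
proof
  assume "x \<in> seg (t *\<^sub>R u)"
  then obtain v where "0 \<le> v" "v \<le> 1" "x = (v * t) *\<^sub>R u"
    by (auto simp: seg_def in_segment)
  then show "\<exists>s. 0 \<le> s \<and> s \<le> t \<and> x = s *\<^sub>R u"
    using assms by (intro exI[of _ "v * t"]) (auto simp: mult_left_le_one_le)
next
  assume "\<exists>s. 0 \<le> s \<and> s \<le> t \<and> x = s *\<^sub>R u"
  then obtain s where s: "0 \<le> s" "s \<le> t" "x = s *\<^sub>R u" by blast
  then show "x \<in> seg (t *\<^sub>R u)"
    unfolding seg_def in_segment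
    by (cases "t = 0") (auto intro!: exI[of _ "s / t"])
qed

lemma in_seg_scaleRI: "0 \<le> s \<Longrightarrow> s \<le> t \<Longrightarrow> s *\<^sub>R u \<in> seg (t *\<^sub>R u)"
  using in_seg_scaleR[of t] by auto

lemma in_seg: "x \<in> seg u \<longleftrightarrow> (\<exists>s. 0 \<le> s \<and> s \<le> 1 \<and> x = s *\<^sub>R u)"
  using in_seg_scaleR[of 1 x u] by simp

lemma scaleR_image_set_plus: "(*\<^sub>R) r ` (A + B) = (*\<^sub>R) r ` A + (*\<^sub>R) r ` (B :: 'a::real_vector set)"
proof (intro equalityI subsetI)
  fix x assume "x \<in> (*\<^sub>R) r ` A + (*\<^sub>R) r ` B"
  then obtain a b where "a \<in> A" "b \<in> B" "x = r *\<^sub>R (a + b)"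
    by (auto simp: set_plus_def scaleR_add_right)
  then show "x \<in> (*\<^sub>R) r ` (A + B)" by blast
next
  fix x assume "x \<in> (*\<^sub>R) r ` (A + B)"
  then obtain a b where "a \<in> A" "b \<in> B" "x = r *\<^sub>R a + r *\<^sub>R b"
    by (auto simp: set_plus_def scaleR_add_right)
  then show "x \<in> (*\<^sub>R) r ` A + (*\<^sub>R) r ` B" by blast
qed

definition zonotope :: "'a::real_vector list \<Rightarrow> 'a set" where
  "zonotope us = sum_list (map seg us)"

lemma zonotope_simps [simp]:
  "zonotope [] = {0}" "zonotope (u # us) = seg u + zonotope us"
  by (simp_all add: zonotope_def set_zero)

lemma zonotope_scaleR: "r \<ge> 0 \<Longrightarrow> zonotope (map ((*\<^sub>R) r) us) = (*\<^sub>R) r ` zonotope us"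
proof (induction us)
  case (Cons u us)
  have "seg (r *\<^sub>R u) = (*\<^sub>R) r ` seg u"
    unfolding seg_def using closed_segment_linear_image[of "(*\<^sub>R) r" 0 u] by simp
  then show ?case using Cons by (simp add: scaleR_image_set_plus)
qed simp

lemma subset_plus_seg: "Q \<subseteq> Q + seg u"
proof
  fix x assume "x \<in> Q"
  then have "x + 0 \<in> Q + seg u" by (intro set_plus_intro) (auto simp: seg_def)
  then show "x \<in> Q + seg u" by simp
qed

section \<open>Convex bodies and the effect of adding a segment\<close>

context euclid_volume
begin

definition body :: "'a set \<Rightarrow> bool" where
  "body K \<longleftrightarrow> compact K \<and> convex K \<and> K \<noteq> {} \<and> K \<subseteq> E"

definition vol :: "'a set \<Rightarrow> real" where "vol A = measure L A"

lemma body_add: "body K \<Longrightarrow> body Q \<Longrightarrow> body (K + Q)"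
  unfolding body_def
proof (intro conjI; elim conjE)
  assume cpt: "compact K" "compact Q"
  have eq: "K + Q = (\<Union>x\<in>K. \<Union>y\<in>Q. {x + y})"
    unfolding set_plus_def by blast
  show "compact (K + Q)" unfolding eq by (rule compact_sums'[OF cpt])
next
  assume "K \<subseteq> E" "Q \<subseteq> E"
  then show "K + Q \<subseteq> E" by (auto simp: set_plus_def intro!: subspace_add[OF subspace_E])
next
  assume "K \<noteq> {}" "Q \<noteq> {}"
  then show "K + Q \<noteq> {}" by (auto simp: set_plus_def)
qed (rule convex_set_plus)

lemma body_D: "r \<ge> 0 \<Longrightarrow> body (D r)"
  unfolding body_def using compact_D convex_D subspace_0[OF subspace_E]
  by (auto simp: D_def)

lemma body_seg: "u \<in> E \<Longrightarrow> body (seg u)"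
  unfolding body_def seg_def using subspace_E
  by (auto simp: in_segment subspace_scale)

lemma body_singleton: "a \<in> E \<Longrightarrow> body {a}"
  by (simp add: body_def)

lemma body_zonotope: "set us \<subseteq> E \<Longrightarrow> body (zonotope us)"
  by (induction us) (auto intro!: body_add body_seg body_singleton simp: subspace_0[OF subspace_E])

lemma body_scaleR: "body K \<Longrightarrow> body ((*\<^sub>R) r ` K)"
  unfolding body_def using subspace_E
  by (auto simp: compact_scaling convex_scaling subspace_scale)

lemma body_plus: "body K \<Longrightarrow> a \<in> E \<Longrightarrow> body ((+) a ` K)"
  unfolding body_def using subspace_E
  by (auto simp: compact_translation subspace_add convex_translation_eq)

lemma body_borel: "body K \<Longrightarrow> K \<in> sets borel"
  by (auto simp: body_def intro: borel_compact)

lemma body_subset_D: "body K \<Longrightarrow> \<exists>R>0. K \<subseteq> D R"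
  using compact_imp_bounded[of K] unfolding body_def bounded_pos by (auto simp: in_D subset_iff)

lemma emeasure_D_finite: "emeasure L (D r) < \<infinity>"
proof -
  have "emeasure L (D r) \<le> emeasure L (cball 0 r)"
    by (intro emeasure_mono) (auto simp: D_def sets_L)
  then show ?thesis using emeasure_cball_finite[of r] by (rule le_less_trans)
qed

lemma fmeasurable_D: "A \<in> sets borel \<Longrightarrow> A \<subseteq> D r \<Longrightarrow> A \<in> fmeasurable L"
  by (rule fmeasurableI2[OF fmeasurableI[OF _ emeasure_D_finite]])
     (simp_all add: sets_L borel_compact compact_D)

lemma body_fmeasurable: "body K \<Longrightarrow> K \<in> fmeasurable L"
  using body_subset_D body_borel fmeasurable_D by blast

lemma vol_nonneg [simp]: "vol K \<ge> 0" by (simp add: vol_def)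

lemma vol_mono: "body K \<Longrightarrow> body Q \<Longrightarrow> K \<subseteq> Q \<Longrightarrow> vol K \<le> vol Q"
  unfolding vol_def by (intro measure_mono_fmeasurable body_fmeasurable fmeasurableD)

lemma vol_scaleR: "A \<in> sets borel \<Longrightarrow> r > 0 \<Longrightarrow> vol ((*\<^sub>R) r ` A) = r ^ n * vol A"
  by (simp add: vol_def measure_def emeasure_scaleR enn2real_mult)

lemma vol_plus:
  assumes "A \<in> sets borel" "a \<in> E" shows "vol ((+) a ` A) = vol A"
proof -
  have "(+) a ` A = (+) (- a) -` A"
    by (force simp: image_iff)
  then have "measure L ((+) a ` A) = measure (distr L borel ((+) (- a))) A"
    using assms(1) by (subst measure_distr) auto
  then show ?thesis
    using distr_plus[of "- a"] assms(2) subspace_E by (simp add: vol_def subspace_neg)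
qed

lemma vol_refl_along:
  assumes "A \<in> sets borel" "d \<in> E" shows "vol (refl_along d ` A) = vol A"
proof -
  have "measure L (refl_along d ` A) = measure (distr L borel (refl_along d)) A"
    using assms(1) by (subst measure_distr) (auto simp: refl_along_image_eq_vimage)
  then show ?thesis
    using distr_refl_along[of d] assms(2) by (simp add: vol_def)
qed

lemma vol_D: "r > 0 \<Longrightarrow> vol (D r) = r ^ n * vol (D 1)"
  using vol_scaleR[of "D 1" r] D_scale[of r 1] borel_compact[OF compact_D] by simp

lemma vol_D_pos: "vol (D 1) > 0"
proof -
  have "emeasure L (D 1) = emeasure L (cball 0 1)"
    using AE_E borel_compact[OF compact_D[of 1]]
    by (intro emeasure_eq_AE) (auto simp: in_D sets_L elim!: eventually_mono)
  then show ?thesis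
    using emeasure_unit_pos emeasure_unit_finite
    by (simp add: vol_def measure_def enn2real_positive_iff)
qed

text \<open>A line in direction \<open>u\<close> meets the convex set \<open>Q\<close> in an
  interval, and adding a segment only pushes its far end outwards. So the layer gained between the
  lengths \<open>s\<close> and \<open>s + t\<close> is the translate by \<open>s *\<^sub>R u\<close>
  of the layer gained between 0 and \<open>t\<close>.\<close>

lemma vol_add_seg_add:
  assumes Q: "body Q" and u: "u \<in> E" and st: "s \<ge> 0" "t \<ge> 0"
  shows "vol (Q + seg ((s + t) *\<^sub>R u)) - vol (Q + seg (s *\<^sub>R u)) = vol (Q + seg (t *\<^sub>R u)) - vol Q"
proof -
  have uE: "c *\<^sub>R u \<in> E" for c using u subspace_E by (simp add: subspace_scale)
  have conv: "convex Q" using Q by (simp add: body_def)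
  have eq: "Q + seg ((s + t) *\<^sub>R u) - (Q + seg (s *\<^sub>R u)) = (+) (s *\<^sub>R u) ` (Q + seg (t *\<^sub>R u) - Q)"
  proof (intro equalityI subsetI)
    fix z assume z: "z \<in> Q + seg ((s + t) *\<^sub>R u) - (Q + seg (s *\<^sub>R u))"
    then obtain q v where q: "q \<in> Q" "0 \<le> v" "v \<le> s + t" "z = q + v *\<^sub>R u"
      using st by (auto simp: set_plus_def in_seg_scaleR)
    have "v > s"
    proof (rule ccontr)
      assume "\<not> v > s"
      then have "z \<in> Q + seg (s *\<^sub>R u)"
        unfolding q(4) using q st by (intro set_plus_intro) (auto intro: in_seg_scaleRI)
      then show False using z by simp
    qed
    have "q + (v - s) *\<^sub>R u \<in> Q + seg (t *\<^sub>R u)"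
      using q st \<open>v > s\<close> by (intro set_plus_intro) (auto intro: in_seg_scaleRI)
    moreover have "q + (v - s) *\<^sub>R u \<notin> Q"
    proof
      assume "q + (v - s) *\<^sub>R u \<in> Q"
      then have "(q + (v - s) *\<^sub>R u) + s *\<^sub>R u \<in> Q + seg (s *\<^sub>R u)"
        using st by (intro set_plus_intro) (auto intro: in_seg_scaleRI)
      then show False using z q by (simp add: algebra_simps)
    qed
    ultimately show "z \<in> (+) (s *\<^sub>R u) ` (Q + seg (t *\<^sub>R u) - Q)"
      using q by (intro image_eqI[of _ _ "q + (v - s) *\<^sub>R u"]) (auto simp: algebra_simps)
  next
    fix z assume "z \<in> (+) (s *\<^sub>R u) ` (Q + seg (t *\<^sub>R u) - Q)"
    then obtain q v where q: "q \<in> Q" "0 \<le> v" "v \<le> t" "z = s *\<^sub>R u + (q + v *\<^sub>R u)" "q + v *\<^sub>R u \<notin> Q"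
      using st by (auto simp: set_plus_def in_seg_scaleR)
    have "q + (v + s) *\<^sub>R u \<in> Q + seg ((s + t) *\<^sub>R u)"
      using q st by (intro set_plus_intro) (auto intro: in_seg_scaleRI)
    moreover have "q + (v + s) *\<^sub>R u \<notin> Q + seg (s *\<^sub>R u)"
    proof
      assume "q + (v + s) *\<^sub>R u \<in> Q + seg (s *\<^sub>R u)"
      then obtain q' w where w: "q' \<in> Q" "0 \<le> w" "w \<le> s" "q + (v + s) *\<^sub>R u = q' + w *\<^sub>R u"
        using st by (auto simp: set_plus_def in_seg_scaleR)
      have q': "q' = q + (v + s - w) *\<^sub>R u" using w(4) by (simp add: algebra_simps)
      show False
      proof (cases "v = 0")
        case True then show False using q by simp
      next
        case False
        \<comment> \<open>The point \<open>q + v *\<^sub>R u\<close> lies between \<open>q\<close>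
          and \<open>q'\<close>, at the fraction \<open>l\<close>; convexity would put it into
          \<open>Q\<close>.\<close>
        define l where "l = v / (v + s - w)"
        have l: "0 \<le> l" "l \<le> 1" "l * (v + s - w) = v"
          using False q w by (auto simp: l_def field_simps)
        have "(1 - l) *\<^sub>R q + l *\<^sub>R q' \<in> Q"
          using conv q(1) w(1) l by (intro convexD_alt) auto
        moreover have "(1 - l) *\<^sub>R q + l *\<^sub>R q' = q + (l * (v + s - w)) *\<^sub>R u"
          unfolding q' by (simp add: algebra_simps)
        ultimately show False using q l by simp
      qed
    qed
    ultimately show "z \<in> Q + seg ((s + t) *\<^sub>R u) - (Q + seg (s *\<^sub>R u))"
      using q by (simp add: algebra_simps)
  qed
  have b: "body (Q + seg (c *\<^sub>R u))" for c
    by (intro body_add Q body_seg uE)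
  have sub: "Q + seg (s *\<^sub>R u) \<subseteq> Q + seg ((s + t) *\<^sub>R u)"
    using st by (intro set_plus_mono2) (auto simp: in_seg_scaleR[of s] intro!: in_seg_scaleRI)
  have sub': "Q \<subseteq> Q + seg (t *\<^sub>R u)"
    by (rule subset_plus_seg)
  have "vol (Q + seg ((s + t) *\<^sub>R u)) - vol (Q + seg (s *\<^sub>R u))
      = measure L (Q + seg ((s + t) *\<^sub>R u) - (Q + seg (s *\<^sub>R u)))"
    unfolding vol_def by (intro measurable_measure_Diff[symmetric] sub fmeasurableD body_fmeasurable b)
  also have "\<dots> = vol (Q + seg (t *\<^sub>R u) - Q)"
    unfolding eq using vol_plus[of "Q + seg (t *\<^sub>R u) - Q" "s *\<^sub>R u"] body_borel[OF Q] body_borel[OF b] uE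
    by (simp add: vol_def)
  also have "\<dots> = vol (Q + seg (t *\<^sub>R u)) - vol Q"
    unfolding vol_def by (intro measurable_measure_Diff sub' fmeasurableD body_fmeasurable b Q)
  finally show ?thesis .
qed

text \<open>This one-segment property is stable under adding a fixed body, under linear combinations
  and under taking slopes, so a zonotope can be added segment by segment. It takes the place of the
  multilinearity of mixed volumes.\<close>

definition seg_affine :: "('a set \<Rightarrow> real) \<Rightarrow> bool" where
  "seg_affine f \<longleftrightarrow> (\<forall>Q u t. body Q \<longrightarrow> u \<in> E \<longrightarrow> t \<ge> 0 \<longrightarrow>
     f (Q + seg (t *\<^sub>R u)) = f Q + t * (f (Q + seg u) - f Q))"

lemma seg_affineD:
  "seg_affine f \<Longrightarrow> body Q \<Longrightarrow> u \<in> E \<Longrightarrow> t \<ge> 0 \<Longrightarrow>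
     f (Q + seg (t *\<^sub>R u)) = f Q + t * (f (Q + seg u) - f Q)"
  by (simp add: seg_affine_def)

lemma seg_affine_vol: "seg_affine vol"
  unfolding seg_affine_def
proof (intro allI impI)
  fix Q u and t :: real assume Q: "body Q" and u: "u \<in> E" and t: "t \<ge> 0"
  define h where "h = (\<lambda>t. vol (Q + seg (t *\<^sub>R u)) - vol Q)"
  have "h t = t * h 1"
  proof (rule additive_nonneg_imp_linear[OF _ _ t])
    show "h (s + t) = h s + h t" if "s \<ge> 0" "t \<ge> 0" for s t
      using vol_add_seg_add[OF Q u that] by (simp add: h_def)
    show "h t \<ge> 0" if "t \<ge> 0" for t
    proof -
      have "Q \<subseteq> Q + seg (t *\<^sub>R u)" by (rule subset_plus_seg)
      then show ?thesis unfolding h_def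
        using vol_mono[OF Q body_add[OF Q body_seg], of "t *\<^sub>R u"] u subspace_E by (simp add: subspace_scale)
    qed
  qed
  then show "vol (Q + seg (t *\<^sub>R u)) = vol Q + t * (vol (Q + seg u) - vol Q)"
    by (simp add: h_def)
qed

lemma seg_affine_translate:
  assumes "seg_affine f" "body K" shows "seg_affine (\<lambda>Q. f (K + Q))"
  unfolding seg_affine_def
proof (intro allI impI)
  fix Q u and t :: real assume Q: "body Q" "u \<in> E" "t \<ge> 0"
  show "f (K + (Q + seg (t *\<^sub>R u))) = f (K + Q) + t * (f (K + (Q + seg u)) - f (K + Q))"
    using seg_affineD[OF assms(1) body_add[OF assms(2) Q(1)] Q(2,3)] by (simp add: add.assoc)
qed

lemma seg_affine_linear_combination:
  assumes f: "\<And>i. i \<in> I \<Longrightarrow> seg_affine (f i)"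
  shows "seg_affine (\<lambda>Q. \<Sum>i\<in>I. c i * f i Q)"
  unfolding seg_affine_def
proof (intro allI impI)
  fix Q u and t :: real
  assume Q: "body Q" "u \<in> E" "t \<ge> 0"
  have "(\<Sum>i\<in>I. c i * f i (Q + seg (t *\<^sub>R u))) = (\<Sum>i\<in>I. c i * f i Q + t * (c i * f i (Q + seg u) - c i * f i Q))"
  proof (rule sum.cong[OF refl])
    fix i assume "i \<in> I"
    then show "c i * f i (Q + seg (t *\<^sub>R u)) = c i * f i Q + t * (c i * f i (Q + seg u) - c i * f i Q)"
      by (subst seg_affineD[OF f Q]) (simp_all add: algebra_simps)
  qed
  then show "(\<Sum>i\<in>I. c i * f i (Q + seg (t *\<^sub>R u))) =
      (\<Sum>i\<in>I. c i * f i Q) + t * ((\<Sum>i\<in>I. c i * f i (Q + seg u)) - (\<Sum>i\<in>I. c i * f i Q))"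
    by (simp add: sum.distrib sum_subtractf sum_distrib_left[symmetric])
qed

lemma seg_affine_slope:
  assumes "seg_affine f" "u \<in> E" shows "seg_affine (\<lambda>Q. f (Q + seg u) - f Q)"
  unfolding seg_affine_def
proof (intro allI impI)
  fix Q v and t :: real assume Q: "body Q" and v: "v \<in> E" and t: "t \<ge> 0"
  have "f (Q + seg (t *\<^sub>R v) + seg u) = f (Q + seg u + seg (t *\<^sub>R v))" by (simp add: ac_simps)
  also have "\<dots> = f (Q + seg u) + t * (f (Q + seg u + seg v) - f (Q + seg u))"
    by (intro seg_affineD assms v t body_add Q body_seg)
  also have "Q + seg u + seg v = Q + seg v + seg u" by (simp add: ac_simps)
  finally show "f (Q + seg (t *\<^sub>R v) + seg u) - f (Q + seg (t *\<^sub>R v)) =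
      f (Q + seg u) - f Q + t * (f (Q + seg v + seg u) - f (Q + seg v) - (f (Q + seg u) - f Q))"
    using seg_affineD[OF assms(1) Q v t] by (simp add: algebra_simps)
qed

text \<open>An affine function that is bounded below on a half-line cannot decrease.\<close>

lemma seg_affine_slope_nonneg:
  assumes f: "seg_affine f" and nonneg: "\<And>Q. body Q \<Longrightarrow> f Q \<ge> 0" and Q: "body Q" and u: "u \<in> E"
  shows "f (Q + seg u) - f Q \<ge> 0"
proof (rule ccontr)
  define s where "s = f (Q + seg u) - f Q"
  assume "\<not> f (Q + seg u) - f Q \<ge> 0"
  then have s: "s < 0" by (simp add: s_def)
  define t where "t = - (f Q + 1) / s"
  have t: "t \<ge> 0" unfolding t_def using s nonneg[OF Q] by (intro divide_nonpos_neg) auto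
  have "0 \<le> f (Q + seg (t *\<^sub>R u))"
    using u subspace_E by (intro nonneg body_add Q body_seg) (simp add: subspace_scale)
  also have "\<dots> = f Q + t * s" using seg_affineD[OF f Q u t] by (simp add: s_def)
  also have "\<dots> = -1" using s by (simp add: t_def)
  finally show False by simp
qed

text \<open>Adding the segment \<open>r *\<^sub>R u\<close> contributes \<open>r\<close> times the
  slope functional \<open>g\<close>, which is again affine in segments and nonnegative, so the
  induction hypothesis applies to \<open>f\<close> and to \<open>g\<close>. The nonnegative
  coefficients are the point: they later turn an inequality between functionals into one between
  coefficients.\<close>

lemma seg_affine_zonotope_poly:
  assumes "seg_affine f" "\<And>Q. body Q \<Longrightarrow> f Q \<ge> 0" "set us \<subseteq> E" "body Q"
  shows "\<exists>e. (\<forall>i. e i \<ge> 0) \<and> (\<forall>i>length us. e i = 0) \<and>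
     (\<forall>r\<ge>0. f (Q + zonotope (map ((*\<^sub>R) r) us)) = (\<Sum>i\<le>length us. e i * r ^ i))"
  using assms
proof (induction us arbitrary: f)
  case Nil
  then show ?case by (intro exI[of _ "\<lambda>i. if i = 0 then f Q else 0"]) (auto simp: set_plus_def)
next
  case (Cons u us)
  define g where "g Q = f (Q + seg u) - f Q" for Q
  have u: "u \<in> E" and us: "set us \<subseteq> E" using Cons.prems by auto
  have gA: "seg_affine g" unfolding g_def by (rule seg_affine_slope[OF Cons.prems(1) u])
  have gN: "body Q \<Longrightarrow> g Q \<ge> 0" for Q
    unfolding g_def by (rule seg_affine_slope_nonneg[OF Cons.prems(1,2) _ u])
  have "\<exists>e. (\<forall>i. e i \<ge> 0) \<and> (\<forall>i>length us. e i = 0) \<and>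
    (\<forall>r\<ge>0. f (Q + zonotope (map ((*\<^sub>R) r) us)) = (\<Sum>i\<le>length us. e i * r ^ i))"
    using Cons.prems gA gN us by (intro Cons.IH) auto
  then obtain e where e0: "(\<forall>i. e i \<ge> 0) \<and> (\<forall>i>length us. e i = 0) \<and>
    (\<forall>r\<ge>0. f (Q + zonotope (map ((*\<^sub>R) r) us)) = (\<Sum>i\<le>length us. e i * r ^ i))"
    by (elim exE)
  then have e: "\<And>i. e i \<ge> 0" "\<And>i. i > length us \<Longrightarrow> e i = 0"
    "\<And>r. r \<ge> 0 \<Longrightarrow> f (Q + zonotope (map ((*\<^sub>R) r) us)) = (\<Sum>i\<le>length us. e i * r ^ i)"
    by blast+
  have "\<exists>e. (\<forall>i. e i \<ge> 0) \<and> (\<forall>i>length us. e i = 0) \<and>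
    (\<forall>r\<ge>0. g (Q + zonotope (map ((*\<^sub>R) r) us)) = (\<Sum>i\<le>length us. e i * r ^ i))"
    using Cons.prems gA gN us by (intro Cons.IH) auto
  then obtain e' where e'0: "(\<forall>i. e' i \<ge> 0) \<and> (\<forall>i>length us. e' i = 0) \<and>
    (\<forall>r\<ge>0. g (Q + zonotope (map ((*\<^sub>R) r) us)) = (\<Sum>i\<le>length us. e' i * r ^ i))"
    by (elim exE)
  then have e': "\<And>i. e' i \<ge> 0" "\<And>i. i > length us \<Longrightarrow> e' i = 0"
    "\<And>r. r \<ge> 0 \<Longrightarrow> g (Q + zonotope (map ((*\<^sub>R) r) us)) = (\<Sum>i\<le>length us. e' i * r ^ i)"
    by blast+
  define a where "a i = e i + (case i of 0 \<Rightarrow> 0 | Suc k \<Rightarrow> e' k)" for i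
  have "f (Q + zonotope (map ((*\<^sub>R) r) (u # us))) = (\<Sum>i\<le>length (u # us). a i * r ^ i)"
    if r: "r \<ge> 0" for r
  proof -
    have Z: "body (Q + zonotope (map ((*\<^sub>R) r) us))"
      using us subspace_E by (intro body_add Cons.prems(4) body_zonotope) (auto simp: subspace_scale)
    have "Q + zonotope (map ((*\<^sub>R) r) (u # us)) = Q + zonotope (map ((*\<^sub>R) r) us) + seg (r *\<^sub>R u)"
      by (simp add: ac_simps)
    then have "f (Q + zonotope (map ((*\<^sub>R) r) (u # us)))
        = (\<Sum>i\<le>length us. e i * r ^ i) + r * (\<Sum>i\<le>length us. e' i * r ^ i)"
      using seg_affineD[OF Cons.prems(1) Z u r] e(3)[OF r] e'(3)[OF r] by (simp add: g_def)
    also have "(\<Sum>i\<le>length us. e i * r ^ i) = (\<Sum>i\<le>Suc (length us). e i * r ^ i)"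
      using e(2) by simp
    also have "r * (\<Sum>i\<le>length us. e' i * r ^ i)
        = (\<Sum>i\<le>Suc (length us). (case i of 0 \<Rightarrow> 0 | Suc k \<Rightarrow> e' k) * r ^ i)"
      by (subst sum.atMost_Suc_shift) (simp add: sum_distrib_left algebra_simps)
    finally show ?thesis
      unfolding a_def by (simp add: sum.distrib distrib_right del: sum.atMost_Suc)
  qed
  moreover have "a i \<ge> 0" for i using e(1) e'(1) by (auto simp: a_def split: nat.split)
  moreover have "a i = 0" if "i > length (u # us)" for i
    using that e(2) e'(2) by (auto simp: a_def split: nat.split)
  ultimately show ?case by blast
qed

text \<open>The number of segments bounds the degree only by \<open>length us\<close>. For
  \<open>r \<ge> 1\<close> everything lies in a ball of radius \<open>(R + S) * r\<close>, whose
  volume grows like \<open>r ^ n\<close>, so the terms above \<open>n\<close> vanish.\<close>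

lemma vol_zonotope_poly:
  assumes K: "body K" and us: "set us \<subseteq> E"
  shows "\<exists>e. \<forall>r\<ge>0. vol (K + zonotope (map ((*\<^sub>R) r) us)) = (\<Sum>i\<le>n. e i * r ^ i)"
proof -
  obtain e where e: "\<And>i. e i \<ge> 0" "\<And>i. i > length us \<Longrightarrow> e i = 0"
    "\<And>r. r \<ge> 0 \<Longrightarrow> vol (K + zonotope (map ((*\<^sub>R) r) us)) = (\<Sum>i\<le>length us. e i * r ^ i)"
    using seg_affine_zonotope_poly[OF seg_affine_vol _ us K] by auto
  obtain R where R: "R > 0" "K \<subseteq> D R" using body_subset_D[OF K] by blast
  obtain S where S: "S > 0" "zonotope us \<subseteq> D S" using body_subset_D[OF body_zonotope[OF us]] by blast
  have "(\<Sum>i\<le>length us. e i * r ^ i) \<le> ((R + S) ^ n * vol (D 1)) * r ^ n" if r: "r \<ge> 1" for r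
  proof -
    have "x + y \<in> D ((R + S) * r)" if xy: "x \<in> K" "y \<in> (*\<^sub>R) r ` zonotope us" for x y
    proof -
      obtain z where z: "y = r *\<^sub>R z" "z \<in> zonotope us" using xy(2) by blast
      have "norm x \<le> R" "norm z \<le> S" "x \<in> E" "z \<in> E" using xy(1) z R S by (auto simp: in_D)
      then have "x + y \<in> E" using subspace_E z by (simp add: subspace_add subspace_scale)
      moreover have "norm (x + y) \<le> R + r * S"
      proof -
        have "r * norm z \<le> r * S" using r \<open>norm z \<le> S\<close> by (intro mult_left_mono) auto
        moreover have "norm y = r * norm z" using r z by simp
        ultimately show ?thesis using norm_triangle_ineq[of x y] \<open>norm x \<le> R\<close> by linarith
      qed
      moreover have "R + r * S \<le> (R + S) * r" using R r by (simp add: algebra_simps)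
      ultimately show ?thesis by (simp add: in_D)
    qed
    then have "K + zonotope (map ((*\<^sub>R) r) us) \<subseteq> D ((R + S) * r)"
      using r by (auto simp: zonotope_scaleR set_plus_def)
    then have "vol (K + zonotope (map ((*\<^sub>R) r) us)) \<le> vol (D ((R + S) * r))"
      using r R S us subspace_E K
      by (intro vol_mono body_add body_zonotope body_D) (auto simp: subspace_scale)
    also have "\<dots> = ((R + S) ^ n * vol (D 1)) * r ^ n"
      using R S r by (subst vol_D) (auto simp: power_mult_distrib)
    finally show ?thesis using e(3) r by simp
  qed
  then have high: "e i = 0" if "i > n" for i
    using poly_growth_coeffs[of e "length us" _ n i] e(1,2) that by (cases "i \<le> length us") auto
  have "(\<Sum>i\<le>length us. e i * r ^ i) = (\<Sum>i\<le>n. e i * r ^ i)" for r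
  proof (cases "length us \<le> n")
    case True then show ?thesis using e(2) by (intro sum.mono_neutral_left) auto
  next
    case False then show ?thesis using high by (intro sum.mono_neutral_right) auto
  qed
  then show ?thesis using e(3) by (intro exI[of _ e]) auto
qed

text \<open>Two polynomial expressions of the same function, of degrees at most \<open>n\<close> and
  \<open>length us\<close>, are padded by zeros to a common bound and compared; the second one is
  known to have nonnegative coefficients.\<close>

lemma seg_affine_zonotope_coeff_nonneg:
  assumes "seg_affine f" "\<And>Q. body Q \<Longrightarrow> f Q \<ge> 0" "set us \<subseteq> E" "body Q"
    and e: "\<And>r. r > 0 \<Longrightarrow> f (Q + zonotope (map ((*\<^sub>R) r) us)) = (\<Sum>i\<le>n. e i * r ^ i)" and i: "i \<le> n"
  shows "e i \<ge> 0"
proof -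
  obtain a where a: "\<And>i. a i \<ge> 0" "\<And>i. i > length us \<Longrightarrow> a i = 0"
    "\<And>r. r \<ge> 0 \<Longrightarrow> f (Q + zonotope (map ((*\<^sub>R) r) us)) = (\<Sum>i\<le>length us. a i * r ^ i)"
    using seg_affine_zonotope_poly[OF assms(1-4)] by blast
  define m where "m = max n (length us)"
  have 1: "(\<Sum>i\<le>m. a i * r ^ i) = (\<Sum>i\<le>length us. a i * r ^ i)" for r
    using a(2) by (intro sum.mono_neutral_right) (auto simp: m_def)
  have 2: "(\<Sum>i\<le>m. (if i \<le> n then e i else 0) * r ^ i) = (\<Sum>i\<le>n. e i * r ^ i)" for r
    by (intro sum.mono_neutral_cong_right) (auto simp: m_def)
  have "(if i \<le> n then e i else 0) = a i"
    by (rule poly_coeffs_unique[where m=m]) (use 1 2 a(3) e i in \<open>auto simp: m_def\<close>)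
  then show ?thesis using a(1)[of i] i by simp
qed

text \<open>Shrinking \<open>K + D r\<close> by the factor \<open>s\<close> about a point
  \<open>k\<close> of \<open>K\<close> keeps the part from \<open>K\<close> inside \<open>K\<close>
  by convexity and turns the ball into \<open>D (s * r)\<close>. This is the quantitative continuity
  in the radius on which the limits below rest.\<close>

lemma vol_add_D_ge:
  assumes K: "body K" and s: "0 < s" "s \<le> 1" and r: "r > 0"
  shows "s ^ n * vol (K + D r) \<le> vol (K + D (s * r))"
proof -
  obtain k where k: "k \<in> K" using K by (auto simp: body_def)
  then have kE: "(1 - s) *\<^sub>R k \<in> E" using K subspace_E by (auto simp: body_def subspace_scale)
  have b: "body (K + D r)" "body (K + D (s * r))" using r s by (auto intro!: body_add K body_D)
  have "(+) ((1 - s) *\<^sub>R k) ` (*\<^sub>R) s ` (K + D r) \<subseteq> K + D (s * r)"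
  proof clarify
    fix z assume "z \<in> K + D r"
    then obtain x y where xy: "x \<in> K" "y \<in> D r" "z = x + y" by (auto simp: set_plus_def)
    have "((1 - s) *\<^sub>R k + s *\<^sub>R x) + s *\<^sub>R y \<in> K + D (s * r)"
    proof (rule set_plus_intro)
      show "(1 - s) *\<^sub>R k + s *\<^sub>R x \<in> K"
        using K k xy s by (intro convexD_alt) (auto simp: body_def)
      show "s *\<^sub>R y \<in> D (s * r)" using D_scale[OF s(1), of r] xy(2) by blast
    qed
    then show "(1 - s) *\<^sub>R k + s *\<^sub>R z \<in> K + D (s * r)" by (simp add: xy(3) algebra_simps)
  qed
  then have "vol ((+) ((1 - s) *\<^sub>R k) ` (*\<^sub>R) s ` (K + D r)) \<le> vol (K + D (s * r))"
    by (intro vol_mono body_plus body_scaleR b kE)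
  then show ?thesis
    using vol_plus[OF body_borel[OF body_scaleR[OF b(1)]] kE] vol_scaleR[OF body_borel[OF b(1)] s(1)] by simp
qed

lemma vol_add_D_le:
  assumes K: "body K" and t: "t \<ge> 1" and r: "r > 0"
  shows "vol (K + D (t * r)) \<le> t ^ n * vol (K + D r)"
  using vol_add_D_ge[OF K, of "1 / t" "t * r"] t r by (simp add: field_simps power_divide)

end

section \<open>Support functions and the ball as a limit of zonotopes\<close>

lemma max_0_mult: "b \<ge> 0 \<Longrightarrow> max 0 (b * y) = b * max 0 (y :: real)"
  by (auto simp: max_def zero_le_mult_iff mult_le_0_iff)

lemma inner_zonotope_le:
  "z \<in> zonotope us \<Longrightarrow> x \<bullet> z \<le> (\<Sum>u\<leftarrow>us. max 0 (x \<bullet> u))"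
proof (induction us arbitrary: z)
  case (Cons u us)
  then obtain a b where ab: "a \<in> seg u" "b \<in> zonotope us" "z = a + b"
    by (auto simp: set_plus_def)
  obtain s where s: "0 \<le> s" "s \<le> 1" "a = s *\<^sub>R u" using ab(1) by (auto simp: in_seg)
  have "s * (x \<bullet> u) \<le> s * max 0 (x \<bullet> u)" using s by (intro mult_left_mono) auto
  also have "\<dots> \<le> max 0 (x \<bullet> u)" using s by (intro mult_left_le_one_le) auto
  finally show ?case using Cons.IH[OF ab(2)] by (simp add: ab(3) s(3) inner_add_right)
qed simp

text \<open>With the preceding bound, this identifies the support function of a zonotope as a sum of
  positive parts; in each segment the endpoint is chosen by the sign of
  \<open>x \<bullet> u\<close>.\<close>

lemma inner_zonotope_attained:
  "\<exists>z\<in>zonotope us. x \<bullet> z = (\<Sum>u\<leftarrow>us. max 0 (x \<bullet> u))"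
proof (induction us)
  case (Cons u us)
  then obtain z where z: "z \<in> zonotope us" "x \<bullet> z = (\<Sum>u\<leftarrow>us. max 0 (x \<bullet> u))" by blast
  define a where "a = (if x \<bullet> u \<ge> 0 then u else 0)"
  have "a + z \<in> seg u + zonotope us"
    by (intro set_plus_intro z) (auto simp: a_def seg_def)
  moreover have "x \<bullet> (a + z) = (\<Sum>u\<leftarrow>u # us. max 0 (x \<bullet> u))"
    using z(2) by (auto simp: a_def inner_add_right)
  ultimately show ?case by auto
qed simp

context euclid_volume
begin

text \<open>Compactness supplies the closest point, convexity the obtuse angle. With
  \<open>y - p\<close> as normal vector it stands in for separating hyperplanes throughout.\<close>

lemma nearest_point:
  assumes "body Q"
  obtains p where "p \<in> Q" "\<And>q. q \<in> Q \<Longrightarrow> (y - p) \<bullet> (q - p) \<le> 0"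
proof -
  have Q: "compact Q" "Q \<noteq> {}" "convex Q" using assms by (auto simp: body_def)
  have "\<exists>p\<in>Q. \<forall>q\<in>Q. dist y p \<le> dist y q"
    by (intro continuous_attains_inf Q continuous_intros)
  then obtain p where p: "p \<in> Q" "\<forall>q\<in>Q. dist y p \<le> dist y q" by blast
  show ?thesis
    using any_closest_point_dot[OF Q(3) compact_imp_closed[OF Q(1)] p(1) _ p(2)] p(1) that by blast
qed

text \<open>With \<open>p\<close> the nearest point of \<open>Z\<close> and
  \<open>x = y - p\<close>, one gets r |x| <= x.z <= x.p = x.y - |x|^2 <= r |x| - |x|^2, hence
  \<open>x = 0\<close>.\<close>

lemma D_subset_body:
  assumes Z: "body Z" and sup: "\<And>x. x \<in> E \<Longrightarrow> \<exists>z\<in>Z. r * norm x \<le> x \<bullet> z"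
  shows "D r \<subseteq> Z"
proof
  fix y assume y: "y \<in> D r"
  obtain p where p: "p \<in> Z" "\<And>q. q \<in> Z \<Longrightarrow> (y - p) \<bullet> (q - p) \<le> 0" using nearest_point[OF Z] by blast
  define x where "x = y - p"
  have "x \<in> E" using y p(1) Z subspace_E by (auto simp: x_def in_D body_def subspace_diff)
  then obtain z where z: "z \<in> Z" "r * norm x \<le> x \<bullet> z" using sup by blast
  have "x \<bullet> z \<le> x \<bullet> p" using p(2)[OF z(1)] by (simp add: x_def inner_diff_right)
  also have "x \<bullet> p = x \<bullet> y - x \<bullet> x" by (simp add: x_def inner_diff_left inner_diff_right)
  also have "x \<bullet> y \<le> norm x * norm y" by (rule norm_cauchy_schwarz)
  also have "norm x * norm y \<le> r * norm x" using y mult_right_mono[of "norm y" r "norm x"] by (simp add: in_D mult.commute)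
  finally have "x \<bullet> x \<le> 0" using z(2) by linarith
  then have "x = 0" by (metis inner_eq_zero_iff inner_ge_zero order_antisym)
  then show "y \<in> Z" using p(1) by (simp add: x_def)
qed

lemma D_refl_along: "d \<in> E \<Longrightarrow> refl_along d u \<in> D r \<longleftrightarrow> u \<in> D r"
  using refl_along_E[of d u] refl_along_E[of d "refl_along d u"] by (auto simp: in_D)

lemma integrable_D_max: "integrable L (\<lambda>u. indicator (D 1) u * max 0 (x \<bullet> u))"
proof (rule Bochner_Integration.integrable_bound[where f = "\<lambda>u. norm x * indicator (D 1) u"])
  show "integrable L (\<lambda>u. norm x * indicator (D 1) u)"
    using compact_D[of 1] emeasure_D_finite[of 1]
    by (intro integrable_mult_right integrable_real_indicator) (auto simp: sets_L borel_compact)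
  have [measurable]: "D 1 \<in> sets borel" using compact_D[of 1] by (rule borel_compact)
  show "(\<lambda>u. indicator (D 1) u * max 0 (x \<bullet> u)) \<in> borel_measurable L" by measurable
  show "AE u in L. norm (indicator (D 1) u * max 0 (x \<bullet> u)) \<le> norm (norm x * indicator (D 1) u)"
  proof (intro always_eventually allI)
    fix u
    have "max 0 (x \<bullet> u) \<le> norm x" if "norm u \<le> 1"
      using norm_cauchy_schwarz[of x u] mult_left_mono[OF that, of "norm x"] by simp
    then show "norm (indicator (D 1) u * max 0 (x \<bullet> u)) \<le> norm (norm x * indicator (D 1) u)"
      by (auto simp: indicator_def in_D)
  qed
qed

text \<open>The support function of the zonoid obtained by integrating the segments from 0 to
  \<open>u\<close> over the unit ball.\<close>

definition zonoid_support :: "'a \<Rightarrow> real" where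
  "zonoid_support x = (\<integral>u. indicator (D 1) u * max 0 (x \<bullet> u) \<partial>L)"

lemma zonoid_support_refl_along:
  assumes d: "d \<in> E" shows "zonoid_support (refl_along d x) = zonoid_support x"
proof -
  have [measurable]: "D 1 \<in> sets borel" using compact_D[of 1] by (rule borel_compact)
  have "zonoid_support x = (\<integral>u. indicator (D 1) u * max 0 (x \<bullet> u) \<partial>distr L borel (refl_along d))"
    by (simp add: zonoid_support_def distr_refl_along[OF d])
  also have "\<dots> = (\<integral>u. indicator (D 1) (refl_along d u) * max 0 (x \<bullet> refl_along d u) \<partial>L)"
    by (rule integral_distr) measurable
  also have "\<dots> = zonoid_support (refl_along d x)"
    unfolding zonoid_support_def using D_refl_along[OF d]
    by (intro Bochner_Integration.integral_cong) (auto simp: indicator_def inner_refl_along)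
  finally show ?thesis by simp
qed

lemma zonoid_support_scaleR:
  "r \<ge> 0 \<Longrightarrow> zonoid_support (r *\<^sub>R x) = r * zonoid_support x"
proof -
  assume "r \<ge> 0"
  then have "max 0 ((r *\<^sub>R x) \<bullet> u) = r * max 0 (x \<bullet> u)" for u
    by (simp add: max_0_mult)
  then show ?thesis by (simp add: zonoid_support_def mult.left_commute)
qed

lemma zonoid_support_norm:
  assumes "x \<in> E" "e \<in> E" "norm e = 1"
  shows "zonoid_support x = norm x * zonoid_support e"
proof -
  have "norm (norm x *\<^sub>R e) = norm x" using assms by simp
  then have "refl_along (norm x *\<^sub>R e - x) (norm x *\<^sub>R e) = x" by (rule refl_along_diff)
  moreover have "norm x *\<^sub>R e - x \<in> E" using assms subspace_E by (simp add: subspace_diff subspace_scale)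
  ultimately have "zonoid_support x = zonoid_support (norm x *\<^sub>R e)"
    by (metis zonoid_support_refl_along)
  then show ?thesis by (simp add: zonoid_support_scaleR)
qed

text \<open>The ball of radius 1/4 about half of \<open>e\<close> lies in the unit ball, has
  positive volume, and there the integrand is at least 1/4.\<close>

lemma zonoid_support_pos:
  assumes e: "e \<in> E" "norm e = 1" shows "zonoid_support e > 0"
proof -
  define A where "A = (+) ((1/2) *\<^sub>R e) ` D (1/4)"
  have eE: "(1/2) *\<^sub>R e \<in> E" using e subspace_E by (simp add: subspace_scale)
  have bA: "body A" unfolding A_def by (intro body_plus body_D eE) simp
  have A: "norm u \<le> 1 \<and> e \<bullet> u \<ge> 1/4 \<and> u \<in> E" if "u \<in> A" for u
  proof -
    obtain v where v: "u = (1/2) *\<^sub>R e + v" "v \<in> E" "norm v \<le> 1/4"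
      using \<open>u \<in> A\<close> by (auto simp: A_def in_D)
    have "norm u \<le> 1/2 + 1/4" unfolding v(1) using e v norm_triangle_ineq[of "(1/2) *\<^sub>R e" v] by simp
    moreover have "\<bar>e \<bullet> v\<bar> \<le> 1/4" using Cauchy_Schwarz_ineq2[of e v] e v by simp
    moreover have "e \<bullet> u = 1/2 + e \<bullet> v" using e by (simp add: v(1) inner_add_right dot_square_norm)
    ultimately show ?thesis using eE v subspace_E by (auto simp: subspace_add)
  qed
  have "0 < (1/4) * vol A"
    using vol_plus[OF borel_compact[OF compact_D] eE] vol_D[of "1/4"] vol_D_pos by (simp add: A_def)
  also have "\<dots> = (\<integral>u. (1/4) * indicator A u \<partial>L)"
    using fmeasurableD[OF body_fmeasurable[OF bA]] by (simp add: vol_def)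
  also have "\<dots> \<le> zonoid_support e"
    unfolding zonoid_support_def
  proof (rule integral_mono)
    show "integrable L (\<lambda>u. (1/4) * indicator A u :: real)"
      using body_fmeasurable[OF bA]
      by (intro integrable_mult_right integrable_real_indicator) (auto simp: fmeasurable_def)
    show "integrable L (\<lambda>u. indicator (D 1) u * max 0 (e \<bullet> u))" by (rule integrable_D_max)
    show "(1/4) * indicator A u \<le> indicator (D 1) u * max 0 (e \<bullet> u)" for u
      using A[of u] by (auto simp: indicator_def in_D)
  qed
  finally show ?thesis .
qed

text \<open>The ball is a zonoid: \<open>|x|\<close> is a multiple of \<open>\<integral>\<^sub>D max 0 (x \<bullet> u) du\<close> because the integral is
  invariant under reflections and homogeneous; cutting \<open>D\<close> into small pieces gives zonotopes.\<close>

lemma zonotope_approx: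
  assumes \<epsilon>: "\<epsilon> > 0"
  shows "\<exists>us. set us \<subseteq> E \<and> D (1 - \<epsilon>) \<subseteq> zonotope us \<and> zonotope us \<subseteq> D (1 + \<epsilon>)"
proof (cases "E = {0}")
  case True
  have "x \<in> D r \<Longrightarrow> x = 0" for x r using True in_D[of x r] by blast
  moreover have "0 \<in> D (1 + \<epsilon>)" using in_D[of 0 "1 + \<epsilon>"] subspace_0[OF subspace_E] \<epsilon> by auto
  ultimately show ?thesis by (intro exI[of _ "[]"]) auto
next
  case False
  then obtain x0 where "x0 \<in> E" "x0 \<noteq> 0" using subspace_0[OF subspace_E] by auto
  define e where "e = (1 / norm x0) *\<^sub>R x0"
  have e: "e \<in> E" "norm e = 1" using \<open>x0 \<in> E\<close> \<open>x0 \<noteq> 0\<close> subspace_E by (auto simp: e_def subspace_scale)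
  define c where "c = zonoid_support e"
  have c: "c > 0" using zonoid_support_pos[OF e] by (simp add: c_def)
  define \<kappa> where "\<kappa> = vol (D 1)"
  have \<kappa>: "\<kappa> > 0" using vol_D_pos by (simp add: \<kappa>_def)
  \<comment> \<open>Within one piece \<open>max 0 (x \<bullet> u)\<close> differs from its value at
    the centre by at most \<open>norm x * \<delta>\<close>; over the total volume
    \<open>\<kappa>\<close> this adds up to \<open>c * (\<epsilon> * norm x)\<close>.\<close>
  define \<delta> where "\<delta> = \<epsilon> * c / \<kappa>"
  have \<delta>: "\<delta> > 0" using \<epsilon> c \<kappa> by (simp add: \<delta>_def)
  have D1 [measurable]: "D 1 \<in> sets borel" using compact_D[of 1] by (rule borel_compact)
  obtain T where T: "finite T" "T \<subseteq> D 1" "D 1 \<subseteq> (\<Union>t\<in>T. ball t \<delta>)"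
    using compactE_image[OF compact_D[of 1], of "D 1" "\<lambda>t. ball t \<delta>"] \<delta> by force
  obtain m f where f: "T = f ` {..<m::nat}"
    using finite_imp_nat_seg_image_inj_on[OF T(1)] by (metis lessThan_def)
  define A where "A k = (if k < m then D 1 \<inter> ball (f k) \<delta> else {})" for k
  define P where "P = disjointed A"
  have "range A \<subseteq> sets borel" by (auto simp: A_def)
  then have P [measurable]: "P k \<in> sets borel" for k
    unfolding P_def using sets.range_disjointed_sets[of A borel] by auto
  have PA: "P k \<subseteq> A k" for k unfolding P_def by (rule disjointed_subset)
  have disj: "disjoint_family P" unfolding P_def by (rule disjoint_family_disjointed)
  have "(\<Union>k. P k) = (\<Union>k. A k)" unfolding P_def by (rule UN_disjointed_eq)
  also have "\<dots> = D 1" using T(3) f by (auto simp: A_def split: if_splits)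
  finally have PU: "(\<Union>k. P k) = D 1" .
  have ind: "indicator (D 1) u = (\<Sum>k<m. indicator (P k) u :: real)" for u
  proof -
    have Pm: "P k = {}" if "k \<ge> m" for k using PA[of k] that by (auto simp: A_def)
    have "(\<Union>k. P k) \<subseteq> (\<Union>k<m. P k)"
    proof
      fix u assume "u \<in> (\<Union>k. P k)"
      then obtain k where k: "u \<in> P k" by blast
      then have "k < m" using Pm[of k] by (cases "k < m") auto
      then show "u \<in> (\<Union>k<m. P k)" using k by blast
    qed
    then have "D 1 = (\<Union>k\<in>{..<m}. P k)" using PU by blast
    then show ?thesis
      using indicator_UN_disjoint[of "{..<m}" P u] disj
      by (simp add: disjoint_family_on_def)
  qed
  define g where "g x u = max 0 (x \<bullet> u)" for x u :: 'a
  have gl: "\<bar>g x u - g x v\<bar> \<le> norm x * norm (u - v)" for x u v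
  proof -
    have "\<bar>g x u - g x v\<bar> \<le> \<bar>x \<bullet> (u - v)\<bar>" by (auto simp: g_def max_def inner_diff_right)
    also have "\<dots> \<le> norm x * norm (u - v)" by (rule Cauchy_Schwarz_ineq2)
    finally show ?thesis .
  qed
  have PD: "P k \<subseteq> D 1" for k using PU by blast
  have Pf: "P k \<in> fmeasurable L" for k by (rule fmeasurable_D[OF P PD])
  have int1: "integrable L (\<lambda>u. indicator (P k) u * g x u)" for k x
  proof (rule Bochner_Integration.integrable_bound[OF integrable_D_max[of x]])
    show "(\<lambda>u. indicator (P k) u * g x u) \<in> borel_measurable L" unfolding g_def by measurable
    show "AE u in L. norm (indicator (P k) u * g x u) \<le> norm (indicator (D 1) u * max 0 (x \<bullet> u))"
      using PD[of k] by (auto simp: g_def indicator_def)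
  qed
  have int2: "integrable L (\<lambda>u. indicator (P k) u * (b::real))" for k b
    using Pf by (intro integrable_mult_left integrable_real_indicator) (auto simp: fmeasurable_def)
  \<comment> \<open>A Riemann sum for the zonoid: each piece contributes the segment to its centre,
    weighted by its volume. Dividing by \<open>c\<close> normalises the support function to
    approximate the norm.\<close>
  define us where "us = map (\<lambda>k. (vol (P k) / c) *\<^sub>R f k) [0..<m]"
  have fD: "f k \<in> D 1" if "k < m" for k using T(2) f that by auto
  have usE: "set us \<subseteq> E" using fD subspace_E by (auto simp: us_def in_D subspace_scale)
  have \<kappa>sum: "\<kappa> = (\<Sum>k<m. vol (P k))"
  proof -
    have "\<kappa> = (\<integral>u. indicator (D 1) u \<partial>L)" using D1 by (simp add: \<kappa>_def vol_def sets_L)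
    also have "\<dots> = (\<Sum>k<m. \<integral>u. indicator (P k) u \<partial>L)"
      unfolding ind using int2[of _ 1] by (subst Bochner_Integration.integral_sum) auto
    finally show ?thesis using P by (simp add: vol_def sets_L)
  qed
  have S: "\<bar>(\<Sum>u\<leftarrow>us. max 0 (x \<bullet> u)) - norm x\<bar> \<le> \<epsilon> * norm x" if x: "x \<in> E" for x
  proof -
    have "c * (\<Sum>u\<leftarrow>us. max 0 (x \<bullet> u)) = (\<Sum>k<m. vol (P k) * g x (f k))"
    proof -
      have "max 0 (x \<bullet> ((vol (P k) / c) *\<^sub>R f k)) = vol (P k) / c * g x (f k)" for k
        using max_0_mult[of "vol (P k) / c" "x \<bullet> f k"] c by (simp add: g_def)
      then have "(\<Sum>u\<leftarrow>us. max 0 (x \<bullet> u)) = (\<Sum>k<m. vol (P k) / c * g x (f k))"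
        unfolding us_def by (simp add: interv_sum_list_conv_sum_set_nat atLeast0LessThan o_def)
      then show ?thesis using c by (simp add: sum_distrib_left)
    qed
    also have "\<dots> = (\<Sum>k<m. \<integral>u. indicator (P k) u * g x (f k) \<partial>L)"
      using P by (simp add: vol_def sets_L)
    finally have 1: "c * (\<Sum>u\<leftarrow>us. max 0 (x \<bullet> u)) = (\<Sum>k<m. \<integral>u. indicator (P k) u * g x (f k) \<partial>L)" .
    have "c * norm x = zonoid_support x"
      using zonoid_support_norm[OF x e] by (simp add: c_def)
    also have "\<dots> = (\<integral>u. (\<Sum>k<m. indicator (P k) u * g x u) \<partial>L)"
      unfolding zonoid_support_def ind g_def by (simp add: sum_distrib_right)
    also have "\<dots> = (\<Sum>k<m. \<integral>u. indicator (P k) u * g x u \<partial>L)"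
      by (rule Bochner_Integration.integral_sum) (rule int1)
    finally have 2: "c * norm x = (\<Sum>k<m. \<integral>u. indicator (P k) u * g x u \<partial>L)" .
    have "\<bar>(\<integral>u. indicator (P k) u * g x (f k) \<partial>L) - (\<integral>u. indicator (P k) u * g x u \<partial>L)\<bar>
        \<le> vol (P k) * (norm x * \<delta>)" if "k < m" for k
    proof -
      have "\<bar>(\<integral>u. indicator (P k) u * g x (f k) \<partial>L) - (\<integral>u. indicator (P k) u * g x u \<partial>L)\<bar>
          = norm (\<integral>u. indicator (P k) u * g x (f k) - indicator (P k) u * g x u \<partial>L)"
        by (subst Bochner_Integration.integral_diff[OF int2 int1]) simp
      also have "\<dots> \<le> (\<integral>u. indicator (P k) u * (norm x * \<delta>) \<partial>L)"
      proof (rule order_trans[OF integral_norm_bound integral_mono])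
        show "integrable L (\<lambda>u. norm (indicator (P k) u * g x (f k) - indicator (P k) u * g x u))"
          by (intro integrable_norm Bochner_Integration.integrable_diff int1 int2)
        show "norm (indicator (P k) u * g x (f k) - indicator (P k) u * g x u) \<le> indicator (P k) u * (norm x * \<delta>)" for u
        proof (cases "u \<in> P k")
          case True
          then have "norm (f k - u) \<le> \<delta>" using PA[of k] \<open>k < m\<close> by (auto simp: A_def dist_norm)
          then show ?thesis using gl[of x "f k" u] True mult_left_mono[of "norm (f k - u)" \<delta> "norm x"] by simp
        qed simp
      qed (rule int2)
      also have "\<dots> = vol (P k) * (norm x * \<delta>)" using P by (simp add: vol_def sets_L)
      finally show ?thesis .
    qed
    then have "\<bar>c * (\<Sum>u\<leftarrow>us. max 0 (x \<bullet> u)) - c * norm x\<bar> \<le> (\<Sum>k<m. vol (P k) * (norm x * \<delta>))"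
      unfolding 1 2 sum_subtractf[symmetric] by (intro order_trans[OF sum_abs sum_mono]) auto
    also have "\<dots> = c * (\<epsilon> * norm x)"
      using \<kappa> unfolding sum_distrib_right[symmetric] \<kappa>sum[symmetric] by (simp add: \<delta>_def)
    finally have "c * \<bar>(\<Sum>u\<leftarrow>us. max 0 (x \<bullet> u)) - norm x\<bar> \<le> c * (\<epsilon> * norm x)"
      using c by (simp add: abs_mult right_diff_distrib[symmetric])
    then show ?thesis using c by simp
  qed
  have "D (1 - \<epsilon>) \<subseteq> zonotope us"
  proof (rule D_subset_body[OF body_zonotope[OF usE]])
    fix x assume x: "x \<in> E"
    obtain z where "z \<in> zonotope us" "x \<bullet> z = (\<Sum>u\<leftarrow>us. max 0 (x \<bullet> u))"
      using inner_zonotope_attained by blast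
    then show "\<exists>z\<in>zonotope us. (1 - \<epsilon>) * norm x \<le> x \<bullet> z"
      using S[OF x] by (intro bexI[of _ z]) (auto simp: abs_le_iff left_diff_distrib)
  qed
  moreover have "zonotope us \<subseteq> D (1 + \<epsilon>)"
  proof
    fix z assume z: "z \<in> zonotope us"
    then have zE: "z \<in> E" using body_zonotope[OF usE] by (auto simp: body_def)
    have "norm z * norm z \<le> (1 + \<epsilon>) * norm z"
      using inner_zonotope_le[OF z, of z] S[OF zE] 
      by (simp add: abs_le_iff distrib_right dot_square_norm power2_eq_square)
    then have "norm z \<le> 1 + \<epsilon>" using \<epsilon> by (cases "z = 0") auto
    then show "z \<in> D (1 + \<epsilon>)" using zE by (simp add: in_D)
  qed
  ultimately show ?thesis using usE by blast
qed

end

section \<open>Steiner coefficients\<close>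

lemma refl_along_image_set_plus: "refl_along d ` (A + B) = refl_along d ` A + refl_along d ` B"
proof (intro equalityI subsetI)
  have lin: "refl_along d (a + b) = refl_along d a + refl_along d b" for a b
    using linear_add[OF linear_refl_along] .
  fix x
  show "x \<in> refl_along d ` A + refl_along d ` B" if x: "x \<in> refl_along d ` (A + B)"
  proof -
    obtain a b where "a \<in> A" "b \<in> B" "x = refl_along d a + refl_along d b"
      using x by (auto simp: set_plus_def lin)
    then show ?thesis by blast
  qed
  assume "x \<in> refl_along d ` A + refl_along d ` B"
  then obtain a b where "a \<in> A" "b \<in> B" "x = refl_along d (a + b)"
    by (auto simp: set_plus_def lin)
  then show "x \<in> refl_along d ` (A + B)" by blast
qed

context euclid_volume
begin

lemma D_0: "D 0 = {0}"
  using subspace_0[OF subspace_E] by (auto simp: in_D)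

lemma D_mono: "r \<le> s \<Longrightarrow> D r \<subseteq> D s"
  by (auto simp: in_D)

lemma D_add:
  assumes "s > 0" "r \<ge> 0" shows "D s + D r = D (s + r)"
proof (intro equalityI subsetI)
  fix x assume "x \<in> D s + D r"
  then obtain a b where ab: "a \<in> D s" "b \<in> D r" "x = a + b" by (auto simp: set_plus_def)
  then show "x \<in> D (s + r)"
    using norm_triangle_ineq[of a b] subspace_add[OF subspace_E] by (auto simp: in_D)
next
  fix x assume x: "x \<in> D (s + r)"
  have "(s / (s + r)) *\<^sub>R x + (r / (s + r)) *\<^sub>R x \<in> D s + D r"
  proof (rule set_plus_intro)
    have "norm x / (s + r) \<le> 1" using x assms by (simp add: in_D)
    then have "s * (norm x / (s + r)) \<le> s" "r * (norm x / (s + r)) \<le> r"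
      using assms by (blast intro: mult_left_le less_imp_le)+
    then show "(s / (s + r)) *\<^sub>R x \<in> D s" "(r / (s + r)) *\<^sub>R x \<in> D r"
      using x assms subspace_scale[OF subspace_E] by (auto simp: in_D)
  qed
  moreover have "(s / (s + r)) *\<^sub>R x + (r / (s + r)) *\<^sub>R x = x"
    using assms by (simp add: scaleR_add_left[symmetric] add_divide_distrib[symmetric])
  ultimately show "x \<in> D s + D r" by simp
qed

lemma refl_along_image_D: "d \<in> E \<Longrightarrow> refl_along d ` D r = D r"
  using D_refl_along by (auto simp: refl_along_image_eq_vimage)

lemma body_refl_along: "d \<in> E \<Longrightarrow> body K \<Longrightarrow> body (refl_along d ` K)"
  unfolding body_def using refl_along_E[of d]
  by (auto intro!: compact_continuous_image continuous_refl_along convex_linear_image linear_refl_along)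

text \<open>One sequence is fixed for all bodies, so that the coefficients of different bodies refer
  to the same zonotopes and linear inequalities between them survive the limit. The shift by 2 keeps
  the inner radius positive.\<close>

definition zonotope_seq :: "nat \<Rightarrow> 'a list" where
  "zonotope_seq = (SOME us. \<forall>m. set (us m) \<subseteq> E \<and>
     D (1 - 1 / real (m + 2)) \<subseteq> zonotope (us m) \<and> zonotope (us m) \<subseteq> D (1 + 1 / real (m + 2)))"

lemma zonotope_seq: "set (zonotope_seq m) \<subseteq> E"
    "D (1 - 1 / real (m + 2)) \<subseteq> zonotope (zonotope_seq m)"
    "zonotope (zonotope_seq m) \<subseteq> D (1 + 1 / real (m + 2))"
proof -
  have "\<exists>us. \<forall>m. set (us m) \<subseteq> E \<and>
     D (1 - 1 / real (m + 2)) \<subseteq> zonotope (us m) \<and> zonotope (us m) \<subseteq> D (1 + 1 / real (m + 2))"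
    using zonotope_approx[of "1 / real (m + 2)" for m] by (intro choice allI) simp
  then have "\<forall>m. set (zonotope_seq m) \<subseteq> E \<and>
     D (1 - 1 / real (m + 2)) \<subseteq> zonotope (zonotope_seq m) \<and>
     zonotope (zonotope_seq m) \<subseteq> D (1 + 1 / real (m + 2))"
    unfolding zonotope_seq_def by (rule someI_ex)
  then show "set (zonotope_seq m) \<subseteq> E"
    "D (1 - 1 / real (m + 2)) \<subseteq> zonotope (zonotope_seq m)"
    "zonotope (zonotope_seq m) \<subseteq> D (1 + 1 / real (m + 2))" by blast+
qed

definition zonotope_coeff :: "'a set \<Rightarrow> nat \<Rightarrow> nat \<Rightarrow> real" where
  "zonotope_coeff K m = (SOME e. \<forall>r\<ge>0.
     vol (K + zonotope (map ((*\<^sub>R) r) (zonotope_seq m))) = (\<Sum>i\<le>n. e i * r ^ i))"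

lemma zonotope_coeff:
  assumes "body K" "r \<ge> 0"
  shows "vol (K + zonotope (map ((*\<^sub>R) r) (zonotope_seq m))) = (\<Sum>i\<le>n. zonotope_coeff K m i * r ^ i)"
  using someI_ex[OF vol_zonotope_poly[OF assms(1) zonotope_seq(1)], of m] assms(2)
  unfolding zonotope_coeff_def by blast

text \<open>For a body and \<open>i \<le> n\<close> this is the volume of the
  \<open>i\<close>-dimensional unit ball times V_(n-i). As a limit of zonotope coefficients it
  inherits their inequalities.\<close>

definition steiner_coeff :: "'a set \<Rightarrow> nat \<Rightarrow> real" where
  "steiner_coeff K i = lim (\<lambda>m. zonotope_coeff K m i)"

text \<open>The scaled zonotope lies between two balls whose radii differ from \<open>r\<close> by
  the factors 1 - 1/(m+2) and 1 + 1/(m+2); \<open>vol_add_D_ge\<close> and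
  \<open>vol_add_D_le\<close> turn this into volume factors that tend to 1.\<close>

lemma zonotope_poly_tendsto:
  assumes K: "body K" and r: "r > 0"
  shows "(\<lambda>m. \<Sum>i\<le>n. zonotope_coeff K m i * r ^ i) \<longlonglongrightarrow> vol (K + D r)"
proof (rule tendsto_sandwich)
  define Z where "Z m = zonotope (map ((*\<^sub>R) r) (zonotope_seq m))" for m
  have E: "set (map ((*\<^sub>R) r) (zonotope_seq m)) \<subseteq> E" for m
    using zonotope_seq(1)[of m] subspace_scale[OF subspace_E] by auto
  have Z: "Z m = (*\<^sub>R) r ` zonotope (zonotope_seq m)" for m
    using r by (simp add: Z_def zonotope_scaleR)
  have bZ: "body (K + Z m)" for m unfolding Z_def by (intro body_add K body_zonotope E)
  show "\<forall>\<^sub>F m in sequentially. (1 - 1 / real (m + 2)) ^ n * vol (K + D r)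
      \<le> (\<Sum>i\<le>n. zonotope_coeff K m i * r ^ i)"
  proof (intro always_eventually allI)
    fix m
    define s where "s = 1 - 1 / real (m + 2)"
    have s: "0 < s" "s \<le> 1" by (auto simp: s_def)
    have "D (s * r) = (*\<^sub>R) r ` D s" using D_scale[OF r, of s] by (simp add: mult.commute)
    then have "D (s * r) \<subseteq> Z m" using zonotope_seq(2)[of m] by (auto simp: Z s_def)
    then have "vol (K + D (s * r)) \<le> vol (K + Z m)"
      using s r by (intro vol_mono bZ body_add K body_D set_plus_mono2) auto
    then show "(1 - 1 / real (m + 2)) ^ n * vol (K + D r) \<le> (\<Sum>i\<le>n. zonotope_coeff K m i * r ^ i)"
      using vol_add_D_ge[OF K s r] zonotope_coeff[OF K, of r m] r by (simp add: Z_def s_def)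
  qed
  show "\<forall>\<^sub>F m in sequentially. (\<Sum>i\<le>n. zonotope_coeff K m i * r ^ i)
      \<le> (1 + 1 / real (m + 2)) ^ n * vol (K + D r)"
  proof (intro always_eventually allI)
    fix m
    define s where "s = 1 + 1 / real (m + 2)"
    have s: "s \<ge> 1" by (auto simp: s_def)
    have "D (s * r) = (*\<^sub>R) r ` D s" using D_scale[OF r, of s] by (simp add: mult.commute)
    then have "Z m \<subseteq> D (s * r)" using zonotope_seq(3)[of m] by (auto simp: Z s_def)
    then have "vol (K + Z m) \<le> vol (K + D (s * r))"
      using s r by (intro vol_mono bZ body_add K body_D set_plus_mono2) auto
    then show "(\<Sum>i\<le>n. zonotope_coeff K m i * r ^ i) \<le> (1 + 1 / real (m + 2)) ^ n * vol (K + D r)"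
      using vol_add_D_le[OF K s r] zonotope_coeff[OF K, of r m] r by (simp add: Z_def s_def)
  qed
  have l: "(\<lambda>m. 1 / real (m + 2)) \<longlonglongrightarrow> 0"
    using LIMSEQ_ignore_initial_segment[OF lim_1_over_n, of 2] by simp
  have "(\<lambda>m. (1 - 1 / real (m + 2)) ^ n * vol (K + D r)) \<longlonglongrightarrow> (1 - 0) ^ n * vol (K + D r)"
    by (intro tendsto_intros l)
  then show "(\<lambda>m. (1 - 1 / real (m + 2)) ^ n * vol (K + D r)) \<longlonglongrightarrow> vol (K + D r)" by simp
  have "(\<lambda>m. (1 + 1 / real (m + 2)) ^ n * vol (K + D r)) \<longlonglongrightarrow> (1 + 0) ^ n * vol (K + D r)"
    by (intro tendsto_intros l)
  then show "(\<lambda>m. (1 + 1 / real (m + 2)) ^ n * vol (K + D r)) \<longlonglongrightarrow> vol (K + D r)" by simp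
qed

lemma zonotope_coeff_tendsto:
  assumes "body K" "i \<le> n" shows "(\<lambda>m. zonotope_coeff K m i) \<longlonglongrightarrow> steiner_coeff K i"
proof -
  have "convergent (\<lambda>m. zonotope_coeff K m i)"
  proof (rule poly_coeffs_convergent[where n = n, OF _ assms(2)])
    fix r :: real assume "r > 0"
    then show "convergent (\<lambda>m. \<Sum>i\<le>n. zonotope_coeff K m i * r ^ i)"
      by (rule convergentI[OF zonotope_poly_tendsto[OF assms(1)]])
  qed
  then show ?thesis unfolding steiner_coeff_def by (rule iffD1[OF convergent_LIMSEQ_iff])
qed

theorem steiner:
  assumes K: "body K" and r: "r \<ge> 0"
  shows "vol (K + D r) = (\<Sum>i\<le>n. steiner_coeff K i * r ^ i)"
proof (cases "r = 0")
  case True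
  \<comment> \<open>The limit is known for positive \<open>r\<close> only. At \<open>r = 0\<close>
    the scaled zonotope is a point, so the constant coefficient is \<open>vol K\<close> for every
    \<open>m\<close>.\<close>
  have "zonotope_coeff K m 0 = vol K" for m
  proof -
    have "K + zonotope (map ((*\<^sub>R) 0) (zonotope_seq m)) = K"
    proof -
      have "zonotope (zonotope_seq m) \<noteq> {}" using body_zonotope[OF zonotope_seq(1)] by (simp add: body_def)
      then have "zonotope (map ((*\<^sub>R) 0) (zonotope_seq m)) = {0}" by (subst zonotope_scaleR) auto
      then show ?thesis by (auto simp: set_plus_def)
    qed
    then have "vol K = (\<Sum>i\<le>n. zonotope_coeff K m i * 0 ^ i)"
      using zonotope_coeff[OF K, of 0 m] by simp
    also have "\<dots> = (\<Sum>i\<in>{0}. zonotope_coeff K m i * 0 ^ i)"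
      by (rule sum.mono_neutral_right) auto
    finally show ?thesis by simp
  qed
  then have "steiner_coeff K 0 = vol K"
    using zonotope_coeff_tendsto[OF K, of 0] by (simp add: LIMSEQ_const_iff)
  moreover have "(\<Sum>i\<le>n. steiner_coeff K i * 0 ^ i) = (\<Sum>i\<in>{0}. steiner_coeff K i * 0 ^ i)"
    by (rule sum.mono_neutral_right) auto
  moreover have "K + D 0 = K" by (auto simp: D_0 set_plus_def)
  ultimately show ?thesis using True by simp
next
  case False
  then have "r > 0" using r by simp
  then have "(\<lambda>m. \<Sum>i\<le>n. zonotope_coeff K m i * r ^ i) \<longlonglongrightarrow> vol (K + D r)"
    by (rule zonotope_poly_tendsto[OF K])
  moreover have "(\<lambda>m. \<Sum>i\<le>n. zonotope_coeff K m i * r ^ i) \<longlonglongrightarrow> (\<Sum>i\<le>n. steiner_coeff K i * r ^ i)"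
    by (intro tendsto_intros zonotope_coeff_tendsto K) auto
  ultimately show ?thesis by (rule LIMSEQ_unique)
qed

lemma steiner_coeff_unique:
  assumes "body K" "\<And>r. r > 0 \<Longrightarrow> vol (K + D r) = (\<Sum>i\<le>n. b i * r ^ i)" "i \<le> n"
  shows "steiner_coeff K i = b i"
proof (rule poly_coeffs_unique[where m = n, OF _ assms(3)])
  fix r :: real assume "r > 0"
  then show "(\<Sum>i\<le>n. steiner_coeff K i * r ^ i) = (\<Sum>i\<le>n. b i * r ^ i)"
    using steiner[OF assms(1), of r] assms(2)[of r] by simp
qed

lemma steiner_coeff_scaleR:
  assumes K: "body K" and s: "s > 0" and i: "i \<le> n"
  shows "steiner_coeff ((*\<^sub>R) s ` K) i = s ^ (n - i) * steiner_coeff K i"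
proof (rule steiner_coeff_unique[where b = "\<lambda>i. s ^ (n - i) * steiner_coeff K i"])
  fix r :: real assume r: "r > 0"
  have "(*\<^sub>R) s ` D (r / s) = D r" using D_scale[OF s, of "r / s"] s by simp
  then have "(*\<^sub>R) s ` K + D r = (*\<^sub>R) s ` (K + D (r / s))" by (simp add: scaleR_image_set_plus)
  then have "vol ((*\<^sub>R) s ` K + D r) = s ^ n * vol (K + D (r / s))"
    using r s by (simp add: vol_scaleR body_borel body_add K body_D)
  also have "\<dots> = (\<Sum>i\<le>n. s ^ n * (steiner_coeff K i * (r / s) ^ i))"
    using r s by (simp add: steiner K sum_distrib_left)
  also have "\<dots> = (\<Sum>i\<le>n. s ^ (n - i) * steiner_coeff K i * r ^ i)"
  proof (rule sum.cong[OF refl])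
    fix i assume "i \<in> {..n}"
    then have "s ^ n = s ^ (n - i) * s ^ i" by (simp add: power_add[symmetric])
    then show "s ^ n * (steiner_coeff K i * (r / s) ^ i) = s ^ (n - i) * steiner_coeff K i * r ^ i"
      using s by (simp add: power_divide)
  qed
  finally show "vol ((*\<^sub>R) s ` K + D r) = (\<Sum>i\<le>n. s ^ (n - i) * steiner_coeff K i * r ^ i)" .
qed (use assms body_scaleR in auto)

lemma steiner_coeff_D1_pos:
  assumes i: "i \<le> n" shows "steiner_coeff (D 1) i > 0"
proof -
  have "steiner_coeff (D 1) i = real (n choose i) * vol (D 1)"
  proof (rule steiner_coeff_unique[OF body_D _ i])
    fix r :: real assume r: "r > 0"
    have "D 1 + D r = D (r + 1)" using D_add[of 1 r] r by (simp add: add.commute)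
    then have "vol (D 1 + D r) = (r + 1) ^ n * vol (D 1)" using vol_D[of "r + 1"] r by simp
    also have "\<dots> = (\<Sum>i\<le>n. real (n choose i) * vol (D 1) * r ^ i)"
      by (subst binomial_ring) (simp add: sum_distrib_left sum_distrib_right mult_ac)
    finally show "vol (D 1 + D r) = (\<Sum>i\<le>n. real (n choose i) * vol (D 1) * r ^ i)" .
  qed simp
  then show ?thesis using vol_D_pos i by simp
qed

lemma steiner_coeff_D:
  assumes "i \<le> n" "s > 0" shows "steiner_coeff (D s) i = s ^ (n - i) * steiner_coeff (D 1) i"
  using steiner_coeff_scaleR[OF body_D assms(2,1), of 1] D_scale[OF assms(2), of 1] by simp

lemma steiner_coeff_refl_along:
  assumes K: "body K" and d: "d \<in> E" and i: "i \<le> n"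
  shows "steiner_coeff (refl_along d ` K) i = steiner_coeff K i"
proof (rule steiner_coeff_unique[OF body_refl_along[OF d K] _ i])
  fix r :: real assume r: "r > 0"
  have "refl_along d ` K + D r = refl_along d ` (K + D r)"
    by (simp add: refl_along_image_set_plus refl_along_image_D d)
  then show "vol (refl_along d ` K + D r) = (\<Sum>i\<le>n. steiner_coeff K i * r ^ i)"
    using r d K steiner[OF K, of r] by (simp add: vol_refl_along body_borel body_add body_D)
qed

text \<open>A linear inequality between volumes of parallel bodies \<open>K + Q\<close> that holds for every body \<open>Q\<close>
  passes to the individual coefficients: for a zonotope \<open>Q\<close> the coefficients are mixed
  differences of a nonnegative function that is affine in each segment.\<close>

lemma steiner_coeff_transfer:
  fixes K :: "'b \<Rightarrow> 'a set" and c :: "'b \<Rightarrow> real"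
  assumes K: "\<And>i. i \<in> I \<Longrightarrow> body (K i)"
    and pos: "\<And>Q. body Q \<Longrightarrow> 0 \<le> (\<Sum>i\<in>I. c i * vol (K i + Q))" and j: "j \<le> n"
  shows "0 \<le> (\<Sum>i\<in>I. c i * steiner_coeff (K i) j)"
proof -
  have "0 \<le> (\<Sum>i\<in>I. c i * zonotope_coeff (K i) m j)" for m
  proof (rule seg_affine_zonotope_coeff_nonneg[OF _ pos zonotope_seq(1) _ _ j,
        where e = "\<lambda>j. \<Sum>i\<in>I. c i * zonotope_coeff (K i) m j"])
    show "seg_affine (\<lambda>Q. \<Sum>i\<in>I. c i * vol (K i + Q))"
      by (intro seg_affine_linear_combination seg_affine_translate seg_affine_vol K)
    show "body {0}" by (simp add: body_singleton subspace_0[OF subspace_E])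
    fix r :: real assume "r > 0"
    have z: "{0} + A = A" for A :: "'a set" by (auto simp: set_plus_def)
    show "(\<Sum>i\<in>I. c i * vol (K i + ({0} + zonotope (map ((*\<^sub>R) r) (zonotope_seq m)))))
        = (\<Sum>j\<le>n. (\<Sum>i\<in>I. c i * zonotope_coeff (K i) m j) * r ^ j)"
      unfolding z sum_distrib_right
      using \<open>r > 0\<close> by (subst sum.swap) (auto intro!: sum.cong simp: zonotope_coeff K sum_distrib_left mult.assoc)
  qed
  moreover have "(\<lambda>m. \<Sum>i\<in>I. c i * zonotope_coeff (K i) m j) \<longlonglongrightarrow> (\<Sum>i\<in>I. c i * steiner_coeff (K i) j)"
    by (intro tendsto_intros zonotope_coeff_tendsto K j)
  ultimately show ?thesis by (intro LIMSEQ_le_const) auto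
qed

text \<open>The shape in which inequalities are transferred: two bodies, a finite family, and one
  body subtracted once per member. Indexing by a sum type keeps the roles apart even if some of the
  bodies coincide.\<close>

lemma steiner_coeff_transfer':
  fixes M :: "'b \<Rightarrow> 'a set"
  assumes I: "finite I" and b: "body X" "body Y" "body W" "\<And>i. i \<in> I \<Longrightarrow> body (M i)"
    and pos: "\<And>Q. body Q \<Longrightarrow>
      0 \<le> a * vol (X + Q) + b * vol (Y + Q) + c * (\<Sum>i\<in>I. vol (M i + Q) - vol (W + Q))" and j: "j \<le> n"
  shows "0 \<le> a * steiner_coeff X j + b * steiner_coeff Y j +
    c * (\<Sum>i\<in>I. steiner_coeff (M i) j - steiner_coeff W j)"
proof -
  define K where "K = case_sum (\<lambda>k::nat. if k = 0 then X else if k = 1 then Y else W) M"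
  define w where "w = case_sum (\<lambda>k::nat. if k = 0 then a else if k = 1 then b else - c * card I) (\<lambda>_ :: 'b. c)"
  have eq: "(\<Sum>i\<in>{0,1,2} <+> I. w i * f (K i)) = a * f X + b * f Y + c * (\<Sum>i\<in>I. f (M i) - f W)" for f
    using I by (simp add: sum.Plus K_def w_def sum_subtractf sum_distrib_left algebra_simps o_def)
  have "0 \<le> (\<Sum>i\<in>{0,1,2} <+> I. w i * steiner_coeff (K i) j)"
  proof (rule steiner_coeff_transfer[OF _ _ j])
    show "body (K i)" if "i \<in> {0,1,2} <+> I" for i
      using that b by (auto simp: K_def)
    show "0 \<le> (\<Sum>i\<in>{0,1,2} <+> I. w i * vol (K i + Q))" if "body Q" for Q
      using pos[OF that] eq[of "\<lambda>A. vol (A + Q)"] by simp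
  qed
  then show ?thesis using eq[of "\<lambda>A. steiner_coeff A j"] by simp
qed

text \<open>Intrinsic volumes inherit monotonicity from volume, by the transfer with an empty
  family.\<close>

lemma steiner_coeff_mono:
  assumes "body X" "body Y" "X \<subseteq> Y" "j \<le> n"
  shows "steiner_coeff X j \<le> steiner_coeff Y j"
proof -
  have "0 \<le> - 1 * vol (X + Q) + 1 * vol (Y + Q) + 0 * (\<Sum>i\<in>{}. vol (X + Q) - vol (X + Q))"
    if "body Q" for Q
    using vol_mono[of "X + Q" "Y + Q"] assms that by (simp add: body_add set_plus_mono2)
  from steiner_coeff_transfer'[OF _ assms(1,2,1) _ this assms(4)] show ?thesis by simp
qed

text \<open>The union bound for the volume of \<open>X + Q\<close>. Since \<open>W\<close> lies in
  each \<open>M i\<close>, the measures of the differences are differences of volumes, and these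
  transfer.\<close>

lemma steiner_coeff_cover:
  assumes I: "finite I" and b: "body X" "body Y" "body W" "\<And>i. i \<in> I \<Longrightarrow> body (M i)"
    and sub: "\<And>i. i \<in> I \<Longrightarrow> W \<subseteq> M i"
    and cover: "\<And>Q. body Q \<Longrightarrow> X + Q \<subseteq> (Y + Q) \<union> (\<Union>i\<in>I. (M i + Q) - (W + Q))" and j: "j \<le> n"
  shows "steiner_coeff X j \<le> steiner_coeff Y j + (\<Sum>i\<in>I. steiner_coeff (M i) j - steiner_coeff W j)"
proof -
  have "0 \<le> - 1 * vol (X + Q) + 1 * vol (Y + Q) + 1 * (\<Sum>i\<in>I. vol (M i + Q) - vol (W + Q))"
    if Q: "body Q" for Q
  proof -
    note f = body_fmeasurable[OF body_add[OF _ Q]]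
    have "vol (X + Q) \<le> measure L ((Y + Q) \<union> (\<Union>i\<in>I. (M i + Q) - (W + Q)))"
      unfolding vol_def using I f b
      by (intro measure_mono_fmeasurable cover Q fmeasurable.Un fmeasurable.finite_UN fmeasurableD) auto
    also have "\<dots> \<le> vol (Y + Q) + measure L (\<Union>i\<in>I. (M i + Q) - (W + Q))"
      unfolding vol_def using I f b
      by (intro measure_Un_le sets.finite_UN sets.Diff fmeasurableD) auto
    also have "measure L (\<Union>i\<in>I. (M i + Q) - (W + Q)) \<le> (\<Sum>i\<in>I. measure L ((M i + Q) - (W + Q)))"
      using I f b by (intro measure_UNION_le sets.Diff fmeasurableD) auto
    also have "(\<Sum>i\<in>I. measure L ((M i + Q) - (W + Q))) = (\<Sum>i\<in>I. vol (M i + Q) - vol (W + Q))"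
      unfolding vol_def using f b sub
      by (intro sum.cong refl measurable_measure_Diff fmeasurableD set_plus_mono2) auto
    finally show ?thesis by simp
  qed
  from steiner_coeff_transfer'[OF I b this j] show ?thesis by simp
qed

text \<open>Additivity of volume on disjoint differences inside \<open>X + Q\<close>. The overlap
  condition concerns the sums \<open>M i + Q\<close> and not the bodies \<open>M i\<close>, because
  disjointness is not preserved when \<open>Q\<close> is added.\<close>

lemma steiner_coeff_packing:
  assumes I: "finite I" and b: "body X" "body W" "\<And>i. i \<in> I \<Longrightarrow> body (M i)"
    and sub: "W \<subseteq> X" "\<And>i. i \<in> I \<Longrightarrow> W \<subseteq> M i" "\<And>i. i \<in> I \<Longrightarrow> M i \<subseteq> X"
    and disj: "\<And>Q i k. body Q \<Longrightarrow> i \<in> I \<Longrightarrow> k \<in> I \<Longrightarrow> i \<noteq> k \<Longrightarrow> (M i + Q) \<inter> (M k + Q) \<subseteq> W + Q" and j: "j \<le> n"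
  shows "(\<Sum>i\<in>I. steiner_coeff (M i) j - steiner_coeff W j) \<le> steiner_coeff X j - steiner_coeff W j"
proof -
  have "0 \<le> 1 * vol (X + Q) + (-1) * vol (W + Q) + (-1) * (\<Sum>i\<in>I. vol (M i + Q) - vol (W + Q))"
    if Q: "body Q" for Q
  proof -
    note f = body_fmeasurable[OF body_add[OF _ Q]]
    have "(\<Sum>i\<in>I. vol (M i + Q) - vol (W + Q)) = (\<Sum>i\<in>I. measure L ((M i + Q) - (W + Q)))"
      unfolding vol_def using f b sub
      by (intro sum.cong refl measurable_measure_Diff[symmetric] fmeasurableD set_plus_mono2) auto
    also have "\<dots> = measure L (\<Union>i\<in>I. (M i + Q) - (W + Q))"
    proof (rule measure_UNION'[symmetric, OF I])
      show "pairwise (\<lambda>i j. disjnt (M i + Q - (W + Q)) (M j + Q - (W + Q))) I"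
        using disj[OF Q] unfolding pairwise_def disjnt_def by blast
    qed (use f b in auto)
    also have "\<dots> \<le> measure L ((X + Q) - (W + Q))"
    proof (intro measure_mono_fmeasurable sets.finite_UN sets.Diff fmeasurableD fmeasurable.Diff)
      have "M i + Q \<subseteq> X + Q" if "i \<in> I" for i
        by (intro set_plus_mono2 sub(3) that subset_refl)
      then show "(\<Union>i\<in>I. (M i + Q) - (W + Q)) \<subseteq> (X + Q) - (W + Q)" by blast
    qed (use I f b in auto)
    also have "\<dots> = vol (X + Q) - vol (W + Q)"
      unfolding vol_def using f b sub
      by (intro measurable_measure_Diff fmeasurableD set_plus_mono2) auto
    finally show ?thesis by simp
  qed
  from steiner_coeff_transfer'[OF I b(1,2,2,3) this j] show ?thesis by simp
qed

end

section \<open>Caps\<close>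

lemma power_diff_le:
  fixes x y :: real
  assumes "0 \<le> y" "y \<le> x" "x > 0" "n > 0"
  shows "x ^ n - y ^ n \<le> n * (x - y) * x ^ (n - 1)"
proof -
  have "1 + real n * (y / x - 1) \<le> (1 + (y / x - 1)) ^ n"
    using assms by (intro Bernoulli_inequality) auto
  then have "1 + real n * (y / x - 1) \<le> (y / x) ^ n" by simp
  then have "x ^ n * (1 + real n * (y / x - 1)) \<le> x ^ n * (y / x) ^ n"
    using assms by (intro mult_left_mono) auto
  moreover have "x ^ n * (y / x) ^ n = y ^ n" using assms by (simp add: power_divide)
  moreover have "x ^ n = x * x ^ (n - 1)" using assms by (cases n) auto
  then have "x ^ n * (1 + real n * (y / x - 1)) = x ^ n - n * (x - y) * x ^ (n - 1)"
    using assms by (simp add: field_simps)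
  ultimately show ?thesis by linarith
qed

lemma norm_diff_unit_sq:
  fixes x w :: "'a::real_inner"
  assumes "norm w = 1" shows "(norm (x - w))\<^sup>2 = (norm x)\<^sup>2 + 1 - 2 * (x \<bullet> w)"
  using assms by (simp add: power2_norm_eq_inner inner_diff_left inner_diff_right inner_commute norm_eq_1)

lemma convex_hull_inner_le:
  assumes "k \<in> convex hull V" "\<And>v. v \<in> V \<Longrightarrow> x \<bullet> v < c"
  shows "x \<bullet> k < c"
proof -
  have "convex {v. x \<bullet> v < c}" by (rule convex_halfspace_lt)
  then have "convex hull V \<subseteq> {v. x \<bullet> v < c}" using assms(2) by (intro hull_minimal) auto
  then show ?thesis using assms(1) by blast
qed

context euclid_volume
begin

definition sphere1 :: "'a set" where "sphere1 = {u \<in> E. norm u = 1}"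

text \<open>Cut out by halfspaces instead of being generated by points: in directions farther than
  \<open>2 * \<rho>\<close> from \<open>w\<close> it does not exceed the ball of radius
  \<open>1 - \<rho>\<^sup>2 / 2\<close>, which is what packing needs, and by
  \<open>near_in_cap\<close> it is still large enough for covering.\<close>

definition cap :: "real \<Rightarrow> 'a \<Rightarrow> 'a set" where
  "cap \<rho> w = {x \<in> D 1. \<forall>u\<in>sphere1. norm (u - w) > 2 * \<rho> \<longrightarrow> x \<bullet> u \<le> 1 - \<rho>\<^sup>2 / 2}"

text \<open>Reduces membership in \<open>K + Q\<close>, for unknown \<open>Q\<close>, to the single
  vector \<open>y - p\<close>: if it lies in \<open>K\<close> then \<open>y\<close> lies in
  \<open>K + Q\<close>, and conversely any decomposition \<open>y = k + q\<close> forces its product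
  with \<open>k\<close> to be at least its squared norm. The coverings and packings below are
  decided on this vector.\<close>

lemma residual:
  assumes Q: "body Q" and y: "y \<in> E"
  obtains p where "p \<in> Q" "y - p \<in> E"
    "\<And>k q. q \<in> Q \<Longrightarrow> y = k + q \<Longrightarrow> (norm (y - p))\<^sup>2 \<le> (y - p) \<bullet> k"
proof -
  obtain p where p: "p \<in> Q" "\<And>q. q \<in> Q \<Longrightarrow> (y - p) \<bullet> (q - p) \<le> 0" using nearest_point[OF Q] by blast
  have "(norm (y - p))\<^sup>2 \<le> (y - p) \<bullet> k" if "q \<in> Q" "y = k + q" for k q
  proof -
    have "(norm (y - p))\<^sup>2 = (y - p) \<bullet> (k + (q - p))"
      using that(2) by (simp add: power2_norm_eq_inner algebra_simps)
    then show ?thesis using p(2)[OF that(1)] by (simp add: inner_add_right)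
  qed
  moreover have "y - p \<in> E" using y p(1) Q subspace_E by (auto simp: body_def subspace_diff)
  ultimately show ?thesis using that p(1) by blast
qed

lemma D_subset_cap:
  assumes "0 < \<rho>" "\<rho> < 1" shows "D (1 - \<rho>\<^sup>2 / 2) \<subseteq> cap \<rho> w"
proof
  fix x assume x: "x \<in> D (1 - \<rho>\<^sup>2 / 2)"
  have "x \<bullet> u \<le> 1 - \<rho>\<^sup>2 / 2" if "u \<in> sphere1" for u
    using norm_cauchy_schwarz[of x u] x that by (auto simp: in_D sphere1_def)
  moreover have "1 - \<rho>\<^sup>2 / 2 \<le> 1" by simp
  then have "x \<in> D 1" using x D_mono by blast
  ultimately show "x \<in> cap \<rho> w" by (simp add: cap_def)
qed

lemma cap_subset_D: "cap \<rho> w \<subseteq> D 1"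
  by (auto simp: cap_def)

lemma rho_bounds:
  fixes \<rho> :: real
  assumes "0 < \<rho>" "\<rho> < 1" shows "0 < 1 - \<rho>\<^sup>2 / 2" "1 - \<rho>\<^sup>2 / 2 < 1"
  using assms power_less_one_iff[of \<rho> 2] by auto

lemma body_cap:
  assumes "0 < \<rho>" "\<rho> < 1" shows "body (cap \<rho> w)"
proof -
  have eq: "cap \<rho> w = D 1 \<inter> (\<Inter>u\<in>{u\<in>sphere1. norm (u - w) > 2 * \<rho>}. {x. u \<bullet> x \<le> 1 - \<rho>\<^sup>2 / 2})"
    by (auto simp: cap_def inner_commute)
  have "compact (cap \<rho> w)"
    unfolding eq by (intro compact_Int_closed compact_D closed_INT ballI closed_halfspace_le)
  moreover have "convex (cap \<rho> w)"
    unfolding eq by (intro convex_Int convex_D convex_INT convex_halfspace_le)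
  moreover have "cap \<rho> w \<noteq> {}"
    using D_subset_cap[OF assms, of w] body_D[of "1 - \<rho>\<^sup>2 / 2"] rho_bounds[OF assms] by (auto simp: body_def)
  moreover have "cap \<rho> w \<subseteq> E" by (auto simp: cap_def in_D)
  ultimately show ?thesis by (simp add: body_def)
qed

text \<open>A direction \<open>u\<close> farther than \<open>2 * \<rho>\<close> from
  \<open>w\<close> has distance at least \<open>\<rho>\<close> from \<open>x\<close>, and with
  \<open>norm x \<le> 1\<close> the law of cosines turns this into the halfspace bound. This is the
  reason for the factor 2 in \<open>cap\<close>.\<close>

lemma near_in_cap:
  assumes "x \<in> D 1" "(norm (x - w))\<^sup>2 \<le> \<rho>\<^sup>2" "0 < \<rho>"
  shows "x \<in> cap \<rho> w"
proof -
  have xw: "norm (x - w) \<le> \<rho>" using power2_le_imp_le[OF assms(2)] assms(3) by simp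
  have "x \<bullet> u \<le> 1 - \<rho>\<^sup>2 / 2" if u: "u \<in> sphere1" "norm (u - w) > 2 * \<rho>" for u
  proof -
    have "norm (u - w) \<le> norm (x - u) + norm (x - w)"
      using norm_triangle_ineq4[of "x - w" "x - u"] by simp
    then have "norm (x - u) \<ge> \<rho>" using u(2) xw by linarith
    then have "\<rho>\<^sup>2 \<le> (norm (x - u))\<^sup>2" using assms(3) by (intro power_mono) auto
    also have "\<dots> = (norm x)\<^sup>2 + 1 - 2 * (x \<bullet> u)" using u(1) by (intro norm_diff_unit_sq) (simp add: sphere1_def)
    also have "(norm x)\<^sup>2 \<le> 1" using assms(1) by (simp add: in_D power_le_one)
    finally show ?thesis by simp
  qed
  then show ?thesis using assms(1) by (simp add: cap_def)
qed

lemma refl_along_image_cap: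
  assumes "w \<in> sphere1" "w' \<in> sphere1"
  shows "refl_along (w - w') ` cap \<rho> w = cap \<rho> w'"
proof -
  define g where "g = refl_along (w - w')"
  have d: "w - w' \<in> E" using assms subspace_E by (simp add: sphere1_def subspace_diff)
  have gw: "g w = w'" unfolding g_def using assms by (intro refl_along_diff) (simp add: sphere1_def)
  have gg: "g (g x) = x" for x by (simp add: g_def)
  have gS: "g u \<in> sphere1" if "u \<in> sphere1" for u
    using that refl_along_E[OF d] by (simp add: sphere1_def g_def)
  have gd: "norm (g u - g v) = norm (u - v)" for u v
    using linear_diff[OF linear_refl_along, of "w - w'" u v] norm_refl_along[of "w - w'" "u - v"] by (simp add: g_def)
  have gi: "g x \<bullet> u = x \<bullet> g u" for x u by (simp add: g_def inner_refl_along)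
  have gD: "g x \<in> D 1 \<longleftrightarrow> x \<in> D 1" for x by (simp add: g_def D_refl_along[OF d])
  have 1: "g x \<in> cap \<rho> v" if "x \<in> cap \<rho> (g v)" for x v
  proof -
    have "g x \<bullet> u \<le> 1 - \<rho>\<^sup>2 / 2" if u: "u \<in> sphere1" "norm (u - v) > 2 * \<rho>" for u
      using \<open>x \<in> cap \<rho> (g v)\<close> gS[OF u(1)] gd[of u v] u(2) by (simp add: cap_def gi)
    then show ?thesis using \<open>x \<in> cap \<rho> (g v)\<close> by (simp add: cap_def gD)
  qed
  show ?thesis
  proof (intro equalityI subsetI)
    fix x assume "x \<in> refl_along (w - w') ` cap \<rho> w"
    then obtain y where "y \<in> cap \<rho> w" "x = g y" by (auto simp: g_def)
    then show "x \<in> cap \<rho> w'" using 1[of y w'] gw gg by metis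
  next
    fix x assume "x \<in> cap \<rho> w'"
    then have "g x \<in> cap \<rho> w" using 1[of x w] gw by simp
    then have "g (g x) \<in> g ` cap \<rho> w" by blast
    then show "x \<in> refl_along (w - w') ` cap \<rho> w" by (simp only: gg) (simp add: g_def)
  qed
qed

lemma steiner_coeff_cap:
  assumes "w \<in> sphere1" "w' \<in> sphere1" "0 < \<rho>" "\<rho> < 1" "j \<le> n"
  shows "steiner_coeff (cap \<rho> w') j = steiner_coeff (cap \<rho> w) j"
proof -
  have "w - w' \<in> E" using assms subspace_E by (simp add: sphere1_def subspace_diff)
  then show ?thesis
    using steiner_coeff_refl_along[OF body_cap[OF assms(3,4), of w] _ assms(5)]
      refl_along_image_cap[OF assms(1,2)] by metis
qed

text \<open>The part of \<open>cap \<rho> w + Q\<close> outside \<open>D a + Q\<close>, where \<open>a = 1 - \<rho>\<^sup>2 / 2\<close>, consists of points whose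
  direction from the nearest point of \<open>Q\<close> is within \<open>2\<rho>\<close> of \<open>w\<close>; so separated caps do not interfere.\<close>

lemma cap_packing:
  assumes T: "finite T" "T \<subseteq> sphere1" and sep: "\<And>s t. s \<in> T \<Longrightarrow> t \<in> T \<Longrightarrow> s \<noteq> t \<Longrightarrow> norm (s - t) > 4 * \<rho>"
    and \<rho>: "0 < \<rho>" "\<rho> < 1" and j: "j \<le> n" and w: "w \<in> sphere1"
  shows "card T * (steiner_coeff (cap \<rho> w) j - steiner_coeff (D (1 - \<rho>\<^sup>2 / 2)) j)
    \<le> steiner_coeff (D 1) j - steiner_coeff (D (1 - \<rho>\<^sup>2 / 2)) j"
proof -
  define a where "a = 1 - \<rho>\<^sup>2 / 2"
  have a: "0 < a" "a < 1" using rho_bounds[OF \<rho>] by (auto simp: a_def)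
  have "(\<Sum>t\<in>T. steiner_coeff (cap \<rho> t) j - steiner_coeff (D a) j) \<le> steiner_coeff (D 1) j - steiner_coeff (D a) j"
  proof (rule steiner_coeff_packing[OF T(1) _ _ _ _ _ _ _ j])
    show "D a \<subseteq> cap \<rho> t" for t unfolding a_def by (rule D_subset_cap[OF \<rho>])
    fix Q s t assume Q: "body Q" and st: "s \<in> T" "t \<in> T" "s \<noteq> t"
    show "(cap \<rho> s + Q) \<inter> (cap \<rho> t + Q) \<subseteq> D a + Q"
    proof
      fix y assume y: "y \<in> (cap \<rho> s + Q) \<inter> (cap \<rho> t + Q)"
      then have yE: "y \<in> E" using body_add[OF body_cap[OF \<rho>] Q, of s] by (auto simp: body_def)
      obtain p where p: "p \<in> Q" "y - p \<in> E"
        "\<And>k q. q \<in> Q \<Longrightarrow> y = k + q \<Longrightarrow> (norm (y - p))\<^sup>2 \<le> (y - p) \<bullet> k"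
        using residual[OF Q yE] by blast
      define x where "x = y - p"
      have near: "norm ((1 / norm x) *\<^sub>R x - v) \<le> 2 * \<rho>" if v: "y \<in> cap \<rho> v + Q" and x: "norm x > a" for v
      proof (rule ccontr)
        assume far: "\<not> norm ((1 / norm x) *\<^sub>R x - v) \<le> 2 * \<rho>"
        obtain k q where kq: "k \<in> cap \<rho> v" "q \<in> Q" "y = k + q" using v by (auto simp: set_plus_def)
        have x0: "norm x > 0" using x a by linarith
        have xS: "(1 / norm x) *\<^sub>R x \<in> sphere1"
          using x0 p(2) subspace_E by (simp add: sphere1_def x_def[symmetric] subspace_scale)
        have "\<forall>u\<in>sphere1. norm (u - v) > 2 * \<rho> \<longrightarrow> k \<bullet> u \<le> a"
          using kq(1) by (simp add: cap_def a_def)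
        then have "k \<bullet> ((1 / norm x) *\<^sub>R x) \<le> a" using xS far by (meson not_le)
        then have "x \<bullet> k \<le> a * norm x" using x0 by (simp add: field_simps inner_commute)
        moreover have "norm x * norm x \<le> x \<bullet> k" using p(3)[OF kq(2,3)] by (simp add: x_def power2_eq_square)
        ultimately have "norm x * norm x \<le> a * norm x" by linarith
        then show False using x x0 by simp
      qed
      have "norm x \<le> a"
      proof (rule ccontr)
        assume "\<not> norm x \<le> a"
        then have "norm ((1 / norm x) *\<^sub>R x - s) \<le> 2 * \<rho>" "norm ((1 / norm x) *\<^sub>R x - t) \<le> 2 * \<rho>"
          using near y by auto
        then have "norm (s - t) \<le> 4 * \<rho>"
          using norm_triangle_ineq4[of "(1 / norm x) *\<^sub>R x - t" "(1 / norm x) *\<^sub>R x - s"] by simp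
        then show False using sep[OF st] by simp
      qed
      then have "x + p \<in> D a + Q" using p by (intro set_plus_intro) (auto simp: in_D x_def)
      then show "y \<in> D a + Q" by (simp add: x_def)
    qed
  qed (use a \<rho> body_cap body_D cap_subset_D D_mono[of a 1] in auto)
  also have "(\<Sum>t\<in>T. steiner_coeff (cap \<rho> t) j - steiner_coeff (D a) j)
      = (\<Sum>t\<in>T. steiner_coeff (cap \<rho> w) j - steiner_coeff (D a) j)"
  proof (rule sum.cong[OF refl])
    fix t assume "t \<in> T"
    then have "t \<in> sphere1" using T(2) by auto
    from steiner_coeff_cap[OF w this \<rho> j]
    show "steiner_coeff (cap \<rho> t) j - steiner_coeff (D a) j
        = steiner_coeff (cap \<rho> w) j - steiner_coeff (D a) j" by (simp only:)
  qed
  finally show ?thesis by (simp add: a_def)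
qed

text \<open>Let a = 1 - \<rho>^2/2. Outside \<open>D a + Q\<close> the residual x has norm greater
  than a. Some \<open>v i\<close> satisfies x.v_i >= x.k >= |x|^2, and normalising it to
  \<open>w i\<close> does not decrease the product; hence |x - w_i|^2 <= 1 - |x|^2 <= 1 - a^2 <=
  \<rho>^2, and x lies in the cap at \<open>w i\<close>.\<close>

lemma inner_cover:
  assumes I: "finite I" and v: "v ` I \<subseteq> D 1" and K: "body (convex hull (v ` I))"
    and w: "\<And>i. i \<in> I \<Longrightarrow> v i \<noteq> 0 \<Longrightarrow> w i = (1 / norm (v i)) *\<^sub>R v i" and \<rho>: "0 < \<rho>" "\<rho> < 1" and Q: "body Q"
  shows "convex hull (v ` I) + Q \<subseteq> (D (1 - \<rho>\<^sup>2 / 2) + Q) \<union>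
    (\<Union>i\<in>I. (cap \<rho> (w i) + Q) - (D (1 - \<rho>\<^sup>2 / 2) + Q))"
proof
  define a where "a = 1 - \<rho>\<^sup>2 / 2"
  have a: "0 < a" "a < 1" using rho_bounds[OF \<rho>] by (auto simp: a_def)
  fix y assume y: "y \<in> convex hull (v ` I) + Q"
  then obtain k q where kq: "k \<in> convex hull (v ` I)" "q \<in> Q" "y = k + q" by (auto simp: set_plus_def)
  have yE: "y \<in> E" using y body_add[OF K Q] by (auto simp: body_def)
  obtain p where p: "p \<in> Q" "y - p \<in> E"
    "\<And>k q. q \<in> Q \<Longrightarrow> y = k + q \<Longrightarrow> (norm (y - p))\<^sup>2 \<le> (y - p) \<bullet> k"
    using residual[OF Q yE] by blast
  define x where "x = y - p"
  have "y \<in> (\<Union>i\<in>I. (cap \<rho> (w i) + Q) - (D a + Q))" if ny: "y \<notin> D a + Q"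
  proof -
    have xa: "norm x > a"
    proof (rule ccontr)
      assume "\<not> norm x > a"
      then have "x + p \<in> D a + Q" using p by (intro set_plus_intro) (auto simp: in_D x_def)
      then show False using ny by (simp add: x_def)
    qed
    have xk: "(norm x)\<^sup>2 \<le> x \<bullet> k" using p(3)[OF kq(2,3)] by (simp add: x_def)
    obtain i where i: "i \<in> I" "x \<bullet> v i \<ge> x \<bullet> k"
      using convex_hull_inner_le[OF kq(1), of x "x \<bullet> k"] by (force simp: not_le[symmetric])
    have vi: "norm (v i) \<le> 1" using v i(1) by (auto simp: in_D)
    have "norm x * norm x \<le> norm x * norm (v i)"
      using xk i(2) norm_cauchy_schwarz[of x "v i"] by (simp add: power2_eq_square)
    moreover have "0 < norm x" using xa a by linarith
    ultimately have xv: "norm x \<le> norm (v i)" by (rule mult_left_le_imp_le)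
    then have v0: "v i \<noteq> 0" using xa a by auto
    have wi: "w i = (1 / norm (v i)) *\<^sub>R v i" by (rule w[OF i(1) v0])
    have nw: "norm (w i) = 1" using v0 by (simp add: wi)
    have xv0: "x \<bullet> v i \<ge> 0" using xk i(2) zero_le_power2[of "norm x"] by linarith
    have "x \<bullet> v i \<le> (x \<bullet> v i) / norm (v i)"
      using mult_right_mono[OF vi xv0] v0 by (simp add: field_simps)
    then have "x \<bullet> w i \<ge> (norm x)\<^sup>2" using xk i(2) by (simp add: wi)
    then have "(norm (x - w i))\<^sup>2 \<le> 1 - (norm x)\<^sup>2" using norm_diff_unit_sq[OF nw, of x] by simp
    also have "\<dots> \<le> 1 - a\<^sup>2" using xa a by (simp add: power_mono)
    also have "\<dots> \<le> \<rho>\<^sup>2"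
    proof -
      have "(1 - a) * (1 + a) \<le> (1 - a) * 2" using a by (intro mult_left_mono) auto
      then show ?thesis by (simp add: a_def power2_eq_square algebra_simps)
    qed
    finally have "x \<in> cap \<rho> (w i)"
      using xv vi p(2) \<rho> by (intro near_in_cap) (auto simp: in_D x_def)
    then have "x + p \<in> cap \<rho> (w i) + Q" using p(1) by (rule set_plus_intro)
    then show ?thesis using ny i(1) by (auto simp: x_def)
  qed
  then show "y \<in> (D (1 - \<rho>\<^sup>2 / 2) + Q) \<union> (\<Union>i\<in>I. (cap \<rho> (w i) + Q) - (D (1 - \<rho>\<^sup>2 / 2) + Q))"
    unfolding a_def by blast
qed

text \<open>For \<open>a > 0\<close>: the polyhedron of all \<open>x\<close> in \<open>E\<close>
  with \<open>w i \<bullet> x \<le> 1\<close>, shrunk by \<open>a\<close> and cut off by the unit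
  ball. Shrinking allows circumscribed polytopes to be studied inside \<open>D 1\<close>.\<close>

definition slab :: "real \<Rightarrow> 'i set \<Rightarrow> ('i \<Rightarrow> 'a) \<Rightarrow> 'a set" where
  "slab a I w = {x \<in> D 1. \<forall>i\<in>I. w i \<bullet> x \<le> a}"

lemma D_subset_slab:
  assumes "a \<le> 1" "w ` I \<subseteq> D 1" shows "D a \<subseteq> slab a I w"
proof
  fix x assume x: "x \<in> D a"
  have "w i \<bullet> x \<le> a" if "i \<in> I" for i
  proof -
    have "norm (w i) \<le> 1" "norm x \<le> a" using assms that x by (auto simp: in_D)
    then have "norm (w i) * norm x \<le> 1 * a" by (intro mult_mono) (auto intro: order_trans[OF norm_ge_zero])
    then show ?thesis using norm_cauchy_schwarz[of "w i" x] by simp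
  qed
  then show "x \<in> slab a I w" using x assms(1) by (auto simp: slab_def in_D)
qed

lemma body_slab:
  assumes "0 \<le> a" "a \<le> 1" "w ` I \<subseteq> D 1" shows "body (slab a I w)"
proof -
  have eq: "slab a I w = D 1 \<inter> (\<Inter>i\<in>I. {x. w i \<bullet> x \<le> a})" by (auto simp: slab_def)
  have "compact (slab a I w)"
    unfolding eq by (intro compact_Int_closed compact_D closed_INT ballI closed_halfspace_le)
  moreover have "convex (slab a I w)"
    unfolding eq by (intro convex_Int convex_D convex_INT convex_halfspace_le)
  moreover have "slab a I w \<noteq> {}" using D_subset_slab[OF assms(2,3)] body_D[OF assms(1)] by (auto simp: body_def)
  moreover have "slab a I w \<subseteq> E" by (auto simp: slab_def in_D)
  ultimately show ?thesis by (simp add: body_def)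
qed

text \<open>The residual lies in \<open>D 1\<close>. If it violates a constraint, so that w_i.x > a,
  then |x - w_i|^2 <= 2 - 2a = \<rho>^2 and it lies in the cap at \<open>w i\<close>; the radius 1 -
  \<rho>^2/2 is the one for which this fits exactly.\<close>

lemma outer_cover:
  assumes w: "w ` I \<subseteq> sphere1" and \<rho>: "0 < \<rho>" "\<rho> < 1" and Q: "body Q"
  shows "D 1 + Q \<subseteq> (slab (1 - \<rho>\<^sup>2 / 2) I w + Q) \<union>
    (\<Union>i\<in>I. (cap \<rho> (w i) + Q) - (D (1 - \<rho>\<^sup>2 / 2) + Q))"
proof
  define a where "a = 1 - \<rho>\<^sup>2 / 2"
  have a: "0 < a" "a < 1" using rho_bounds[OF \<rho>] by (auto simp: a_def)
  fix y assume y: "y \<in> D 1 + Q"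
  then obtain k q where kq: "k \<in> D 1" "q \<in> Q" "y = k + q" by (auto simp: set_plus_def)
  have yE: "y \<in> E" using y body_add[OF body_D Q, of 1] by (auto simp: body_def)
  obtain p where p: "p \<in> Q" "y - p \<in> E"
    "\<And>k q. q \<in> Q \<Longrightarrow> y = k + q \<Longrightarrow> (norm (y - p))\<^sup>2 \<le> (y - p) \<bullet> k"
    using residual[OF Q yE] by blast
  define x where "x = y - p"
  have "norm x * norm x \<le> norm x * norm k"
    using p(3)[OF kq(2,3)] norm_cauchy_schwarz[of x k] by (simp add: power2_eq_square x_def)
  then have "norm x \<le> norm k \<or> x = 0" by auto
  then have x1: "x \<in> D 1" using kq(1) p(2) by (auto simp: in_D x_def)
  have "y \<in> (\<Union>i\<in>I. (cap \<rho> (w i) + Q) - (D a + Q))" if ny: "y \<notin> slab a I w + Q"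
  proof -
    have "x \<notin> slab a I w"
    proof
      assume "x \<in> slab a I w"
      then have "x + p \<in> slab a I w + Q" using p(1) by (rule set_plus_intro)
      then show False using ny by (simp add: x_def)
    qed
    then obtain i where i: "i \<in> I" "w i \<bullet> x > a" using x1 by (auto simp: slab_def not_le)
    have nw: "norm (w i) = 1" using w i(1) by (auto simp: sphere1_def)
    have "(norm (x - w i))\<^sup>2 \<le> 2 - 2 * a"
      using norm_diff_unit_sq[OF nw, of x] i(2) x1 power_le_one[of "norm x" 2] by (simp add: in_D inner_commute)
    then have "x \<in> cap \<rho> (w i)" using x1 \<rho> by (intro near_in_cap) (auto simp: a_def)
    then have "x + p \<in> cap \<rho> (w i) + Q" using p(1) by (rule set_plus_intro)
    moreover have "D a + Q \<subseteq> slab a I w + Q"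
      using a w by (intro set_plus_mono2 D_subset_slab) (auto simp: sphere1_def in_D)
    ultimately show ?thesis using ny i(1) by (auto simp: x_def)
  qed
  then show "y \<in> (slab (1 - \<rho>\<^sup>2 / 2) I w + Q) \<union> (\<Union>i\<in>I. (cap \<rho> (w i) + Q) - (D (1 - \<rho>\<^sup>2 / 2) + Q))"
    unfolding a_def by blast
qed

text \<open>By symmetry all caps have the same coefficient, and at least twice as many of them fit
  between the smaller ball and \<open>D 1\<close>; the caps at \<open>I\<close> therefore account
  for at most half of the difference, whether or not they overlap.\<close>

lemma cap_sum_le:
  assumes I: "finite I" "2 * card I \<le> card T" and w: "w ` I \<subseteq> sphere1"
    and T: "finite T" "T \<subseteq> sphere1" and sep: "\<And>s t. s \<in> T \<Longrightarrow> t \<in> T \<Longrightarrow> s \<noteq> t \<Longrightarrow> norm (s - t) > 4 * \<rho>"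
    and \<rho>: "0 < \<rho>" "\<rho> < 1" and j: "j \<le> n"
  shows "(\<Sum>i\<in>I. steiner_coeff (cap \<rho> (w i)) j - steiner_coeff (D (1 - \<rho>\<^sup>2 / 2)) j)
    \<le> (1 - (1 - \<rho>\<^sup>2 / 2) ^ (n - j)) / 2 * steiner_coeff (D 1) j"
proof (cases "I = {}")
  case True
  have "(1 - \<rho>\<^sup>2 / 2) ^ (n - j) \<le> 1" using rho_bounds[OF \<rho>] by (intro power_le_one) auto
  then show ?thesis using True steiner_coeff_D1_pos[OF j] by simp
next
  case False
  then obtain i0 where i0: "i0 \<in> I" by blast
  define a where "a = 1 - \<rho>\<^sup>2 / 2"
  have a: "0 < a" "a < 1" using rho_bounds[OF \<rho>] by (auto simp: a_def)
  define c where "c = steiner_coeff (cap \<rho> (w i0)) j - steiner_coeff (D a) j"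
  have w0: "w i0 \<in> sphere1" using w i0 by auto
  have "D a \<subseteq> cap \<rho> (w i0)" unfolding a_def by (rule D_subset_cap[OF \<rho>])
  then have c: "c \<ge> 0"
    using steiner_coeff_mono[OF body_D body_cap[OF \<rho>] _ j, of a "w i0"] a by (simp add: c_def)
  have "(\<Sum>i\<in>I. steiner_coeff (cap \<rho> (w i)) j - steiner_coeff (D a) j) = (\<Sum>i\<in>I. c)"
  proof (rule sum.cong[OF refl])
    fix i assume "i \<in> I"
    then have "w i \<in> sphere1" using w by auto
    from steiner_coeff_cap[OF w0 this \<rho> j]
    show "steiner_coeff (cap \<rho> (w i)) j - steiner_coeff (D a) j = c" by (simp only: c_def)
  qed
  then have "2 * (\<Sum>i\<in>I. steiner_coeff (cap \<rho> (w i)) j - steiner_coeff (D a) j) = real (2 * card I) * c" by simp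
  also have "\<dots> \<le> real (card T) * c" using I(2) c by (intro mult_right_mono of_nat_mono) auto
  also have "\<dots> \<le> steiner_coeff (D 1) j - steiner_coeff (D a) j"
    using cap_packing[OF T sep \<rho> j w0] by (simp add: c_def a_def)
  also have "\<dots> = (1 - a ^ (n - j)) * steiner_coeff (D 1) j"
    using steiner_coeff_D[OF j a(1)] by (simp add: left_diff_distrib)
  finally show ?thesis by (simp add: a_def)
qed

lemma inner_upper:
  assumes I: "finite I" "I \<noteq> {}" "2 * card I \<le> card T" and v: "v ` I \<subseteq> D 1"
    and T: "finite T" "T \<subseteq> sphere1" "T \<noteq> {}" and sep: "\<And>s t. s \<in> T \<Longrightarrow> t \<in> T \<Longrightarrow> s \<noteq> t \<Longrightarrow> norm (s - t) > 4 * \<rho>"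
    and \<rho>: "0 < \<rho>" "\<rho> < 1" and j: "j \<le> n"
  shows "steiner_coeff (convex hull (v ` I)) j \<le> (1 + (1 - \<rho>\<^sup>2 / 2) ^ (n - j)) / 2 * steiner_coeff (D 1) j"
proof -
  define a where "a = 1 - \<rho>\<^sup>2 / 2"
  have a: "0 < a" "a < 1" using rho_bounds[OF \<rho>] by (auto simp: a_def)
  obtain e where e: "e \<in> sphere1" using T by blast
  define w where "w i = (if v i = 0 then e else (1 / norm (v i)) *\<^sub>R v i)" for i
  have w: "w ` I \<subseteq> sphere1"
    using e v subspace_scale[OF subspace_E] by (auto simp: w_def sphere1_def in_D)
  have K: "body (convex hull (v ` I))"
    using I v hull_minimal[of "v ` I" "D 1" convex] convex_D
    by (auto simp: body_def finite_imp_compact_convex_hull in_D subset_iff)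
  have "steiner_coeff (convex hull (v ` I)) j \<le> steiner_coeff (D a) j +
      (\<Sum>i\<in>I. steiner_coeff (cap \<rho> (w i)) j - steiner_coeff (D a) j)"
    unfolding a_def
  proof (rule steiner_coeff_cover[OF I(1) K _ _ _ _ inner_cover[OF I(1) v K _ \<rho>] j])
    show "D (1 - \<rho>\<^sup>2 / 2) \<subseteq> cap \<rho> (w i)" for i by (rule D_subset_cap[OF \<rho>])
  qed (use a body_D body_cap[OF \<rho>] in \<open>auto simp: w_def a_def\<close>)
  also have "\<dots> \<le> a ^ (n - j) * steiner_coeff (D 1) j + (1 - a ^ (n - j)) / 2 * steiner_coeff (D 1) j"
    using cap_sum_le[OF I(1,3) w T(1,2) sep \<rho> j] steiner_coeff_D[OF j a(1)] by (simp add: a_def)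
  also have "\<dots> = (1 + a ^ (n - j)) / 2 * steiner_coeff (D 1) j" by (simp add: field_simps)
  finally show ?thesis by (simp add: a_def)
qed

lemma slab_lower:
  assumes I: "finite I" "2 * card I \<le> card T" and w: "w ` I \<subseteq> sphere1"
    and T: "finite T" "T \<subseteq> sphere1" and sep: "\<And>s t. s \<in> T \<Longrightarrow> t \<in> T \<Longrightarrow> s \<noteq> t \<Longrightarrow> norm (s - t) > 4 * \<rho>"
    and \<rho>: "0 < \<rho>" "\<rho> < 1" and j: "j \<le> n"
  shows "(1 + (1 - \<rho>\<^sup>2 / 2) ^ (n - j)) / 2 * steiner_coeff (D 1) j \<le> steiner_coeff (slab (1 - \<rho>\<^sup>2 / 2) I w) j"
proof -
  define a where "a = 1 - \<rho>\<^sup>2 / 2"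
  have a: "0 < a" "a < 1" using rho_bounds[OF \<rho>] by (auto simp: a_def)
  have wD: "w ` I \<subseteq> D 1" using w by (auto simp: sphere1_def in_D)
  have "steiner_coeff (D 1) j \<le> steiner_coeff (slab a I w) j +
      (\<Sum>i\<in>I. steiner_coeff (cap \<rho> (w i)) j - steiner_coeff (D a) j)"
    unfolding a_def
  proof (rule steiner_coeff_cover[OF I(1) _ _ _ _ _ outer_cover[OF w \<rho>] j])
    show "D (1 - \<rho>\<^sup>2 / 2) \<subseteq> cap \<rho> (w i)" for i by (rule D_subset_cap[OF \<rho>])
  qed (use a body_D body_cap[OF \<rho>] body_slab[OF _ _ wD, of a] in \<open>auto simp: a_def\<close>)
  moreover have "(\<Sum>i\<in>I. steiner_coeff (cap \<rho> (w i)) j - steiner_coeff (D a) j)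
      \<le> (1 - a ^ (n - j)) / 2 * steiner_coeff (D 1) j"
    using cap_sum_le[OF I w T sep \<rho> j] by (simp add: a_def)
  moreover have "(1 + a ^ (n - j)) / 2 * steiner_coeff (D 1) j
      = steiner_coeff (D 1) j - (1 - a ^ (n - j)) / 2 * steiner_coeff (D 1) j"
    by (simp add: field_simps)
  ultimately show ?thesis unfolding a_def[symmetric] by linarith
qed

end

section \<open>Nets and extremal polytopes\<close>

context euclid_volume
begin

definition separated :: "real \<Rightarrow> 'a set \<Rightarrow> bool" where
  "separated \<delta> T \<longleftrightarrow> finite T \<and> T \<subseteq> sphere1 \<and> (\<forall>s\<in>T. \<forall>t\<in>T. s \<noteq> t \<longrightarrow> norm (s - t) > \<delta>)"

lemma vol_annulus:
  assumes "0 < r" "r \<le> s" shows "vol (D s) - vol (D r) = (s ^ n - r ^ n) * vol (D 1)"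
  using vol_D[of r] vol_D[of s] assms by (simp add: left_diff_distrib)

lemma vol_Diff_D: "r \<le> s \<Longrightarrow> measure L (D s - D r) = vol (D s) - vol (D r)"
  unfolding vol_def using borel_compact[OF compact_D]
  by (intro measurable_measure_Diff D_mono fmeasurable_D[OF _ subset_refl]) (auto simp: sets_L)

lemma translate_D: "t \<in> E \<Longrightarrow> x \<in> (+) t ` D s \<longleftrightarrow> x \<in> E \<and> norm (x - t) \<le> s"
  using subspace_diff[OF subspace_E] subspace_add[OF subspace_E]
  by (auto simp: in_D intro!: image_eqI[of _ _ "x - t"])

text \<open>Disjoint balls of radius \<delta>/2 are compared with an annulus of width 3\<delta>/2
  instead of a ball; its volume carries a factor \<delta>, which lowers the exponent to n - 1. The
  remaining factors 3, n, (3/2)^(n-1) and 2^(n-1) are absorbed into 18 = 3 * 2 * 3 by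
  \<open>3 \<le> 3 ^ (n - 1)\<close> and \<open>real n \<le> 2 ^ (n - 1)\<close>.\<close>

lemma separated_card:
  assumes T: "separated \<delta> T" and \<delta>: "0 < \<delta>" "\<delta> < 1" and n: "n \<ge> 2"
  shows "real (card T) * \<delta> ^ (n - 1) \<le> 18 ^ (n - 1)"
proof -
  define s where "s = \<delta> / 2"
  have s: "0 < s" "\<delta> = 2 * s" "s < 1/2" using \<delta> by (auto simp: s_def)
  have fin: "finite T" and TS: "T \<subseteq> sphere1" using T by (auto simp: separated_def)
  have TE: "t \<in> E" "norm t = 1" if "t \<in> T" for t using that TS by (auto simp: sphere1_def)
  have B: "(+) t ` D s \<in> fmeasurable L" if "t \<in> T" for t
    using s TE[OF that] by (intro body_fmeasurable body_plus body_D) auto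
  have "real (card T) * (s ^ n * vol (D 1)) = (\<Sum>t\<in>T. measure L ((+) t ` D s))"
    using vol_plus[OF borel_compact[OF compact_D]] TE vol_D[OF s(1)] by (simp add: vol_def)
  also have "\<dots> = measure L (\<Union>t\<in>T. (+) t ` D s)"
  proof (rule measure_UNION'[symmetric, OF fin B])
    show "pairwise (\<lambda>i j. disjnt ((+) i ` D s) ((+) j ` D s)) T"
    proof (rule pairwiseI)
      fix i j assume ij: "i \<in> T" "j \<in> T" "i \<noteq> j"
      have "norm (i - j) > \<delta>" using T ij by (auto simp: separated_def)
      then have "\<not> (norm (x - i) \<le> s \<and> norm (x - j) \<le> s)" for x
        using norm_triangle_ineq4[of "x - j" "x - i"] s by auto
      then show "disjnt ((+) i ` D s) ((+) j ` D s)"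
        unfolding disjnt_iff using translate_D TE ij by blast
    qed
  qed
  also have "\<dots> \<le> measure L (D (1 + s) - D (1 - \<delta>))"
  proof (rule measure_mono_fmeasurable)
    show "(\<Union>t\<in>T. (+) t ` D s) \<subseteq> D (1 + s) - D (1 - \<delta>)"
    proof
      fix x assume "x \<in> (\<Union>t\<in>T. (+) t ` D s)"
      then obtain t where t: "t \<in> T" "x \<in> E" "norm (x - t) \<le> s" using translate_D TE by blast
      have "norm x \<le> 1 + s" "norm x \<ge> 1 - s"
        using norm_triangle_ineq2[of x t] norm_triangle_ineq2[of t x] t TE[OF t(1)] by (auto simp: norm_minus_commute)
      then show "x \<in> D (1 + s) - D (1 - \<delta>)" using s t by (auto simp: in_D)
    qed
    show "(\<Union>t\<in>T. (+) t ` D s) \<in> sets L" using fin B by (intro sets.finite_UN fmeasurableD)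
    show "D (1 + s) - D (1 - \<delta>) \<in> fmeasurable L"
      using borel_compact[OF compact_D] by (intro fmeasurable.Diff fmeasurable_D[OF _ subset_refl])
  qed
  also have "\<dots> = ((1 + s) ^ n - (1 - \<delta>) ^ n) * vol (D 1)"
    using s \<delta> by (simp add: vol_Diff_D vol_annulus)
  finally have "real (card T) * s ^ n \<le> (1 + s) ^ n - (1 - \<delta>) ^ n" using vol_D_pos by simp
  also have "\<dots> \<le> real n * ((1 + s) - (1 - \<delta>)) * (1 + s) ^ (n - 1)"
    using s \<delta> n by (intro power_diff_le) auto
  also have "\<dots> \<le> real n * ((1 + s) - (1 - \<delta>)) * (3/2) ^ (n - 1)"
    using s \<delta> by (intro mult_left_mono power_mono) auto
  finally have "real (card T) * s ^ (n - 1) * s \<le> (3 * real n * (3/2) ^ (n - 1)) * s"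
    using n s by (simp add: power_eq_if algebra_simps)
  then have *: "real (card T) * s ^ (n - 1) \<le> 3 * real n * (3/2) ^ (n - 1)" using s by simp
  have n2: "real n \<le> 2 ^ (n - 1)"
  proof -
    have "n - 1 < 2 ^ (n - 1)" by (rule less_exp)
    then have "n \<le> 2 ^ (n - 1)" by linarith
    then have "real n \<le> real (2 ^ (n - 1))" by (rule of_nat_mono)
    then show ?thesis by simp
  qed
  have n3: "(3::real) \<le> 3 ^ (n - 1)" using n power_increasing[of 1 "n - 1" "3::real"] by simp
  have "real (card T) * \<delta> ^ (n - 1) = 2 ^ (n - 1) * (real (card T) * s ^ (n - 1))"
    by (simp add: s(2) power_mult_distrib)
  also have "\<dots> \<le> 2 ^ (n - 1) * (3 * real n * (3/2) ^ (n - 1))" using * by (intro mult_left_mono) auto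
  also have "\<dots> = 3 * real n * 3 ^ (n - 1)" by (simp add: power_divide)
  also have "\<dots> \<le> 3 ^ (n - 1) * 2 ^ (n - 1) * 3 ^ (n - 1)"
    using n2 n3 by (intro mult_right_mono mult_mono) auto
  also have "\<dots> = 18 ^ (n - 1)" by (simp add: power_mult_distrib[symmetric])
  finally show ?thesis .
qed

text \<open>Balls of radius \<open>2 * \<delta>\<close> about the net cover the annulus between the
  radii 1 - \<delta> and 1 + \<delta>, whose volume is at least \<open>2 * \<delta>\<close> times
  that of the unit ball; cancelling this factor leaves the exponent n - 1.\<close>

lemma net_card:
  assumes T: "finite T" "T \<subseteq> sphere1" and net: "\<And>u. u \<in> sphere1 \<Longrightarrow> \<exists>t\<in>T. norm (u - t) \<le> \<delta>"
    and \<delta>: "0 < \<delta>" "\<delta> < 1" and n: "n \<ge> 1"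
  shows "1 \<le> real (card T) * (2 * \<delta>) ^ (n - 1)"
proof -
  have TE: "t \<in> E" "norm t = 1" if "t \<in> T" for t using that T by (auto simp: sphere1_def)
  have B: "(+) t ` D (2 * \<delta>) \<in> fmeasurable L" if "t \<in> T" for t
    using \<delta> TE[OF that] by (intro body_fmeasurable body_plus body_D) auto
  have sub: "D (1 + \<delta>) - D (1 - \<delta>) \<subseteq> (\<Union>t\<in>T. (+) t ` D (2 * \<delta>))"
  proof
    fix x assume x: "x \<in> D (1 + \<delta>) - D (1 - \<delta>)"
    then have nx: "norm x \<le> 1 + \<delta>" "norm x > 1 - \<delta>" "x \<in> E" by (auto simp: in_D)
    define u where "u = (1 / norm x) *\<^sub>R x"
    have x0: "norm x > 0" using nx \<delta> by linarith
    have u: "u \<in> sphere1" using x0 nx(3) subspace_E by (auto simp: u_def sphere1_def subspace_scale)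
    obtain t where t: "t \<in> T" "norm (u - t) \<le> \<delta>" using net[OF u] by blast
    have "x = norm x *\<^sub>R u" using x0 by (simp add: u_def)
    then have "x - u = (norm x - 1) *\<^sub>R u" by (metis scaleR_left_diff_distrib scaleR_one)
    then have "norm (x - u) = \<bar>norm x - 1\<bar>" using u by (simp add: sphere1_def)
    then have "norm (x - u) \<le> \<delta>" using nx(1,2) by linarith
    moreover have "norm (x - t) \<le> norm (x - u) + norm (u - t)"
      using norm_triangle_ineq[of "x - u" "u - t"] by simp
    ultimately have "norm (x - t) \<le> 2 * \<delta>" using t(2) by linarith
    then show "x \<in> (\<Union>t\<in>T. (+) t ` D (2 * \<delta>))" using t(1) nx(3) translate_D[OF TE(1)[OF t(1)]] by blast
  qed
  have "((1 + \<delta>) ^ n - (1 - \<delta>) ^ n) * vol (D 1) = measure L (D (1 + \<delta>) - D (1 - \<delta>))"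
    using \<delta> by (simp add: vol_Diff_D vol_annulus)
  also have "\<dots> \<le> measure L (\<Union>t\<in>T. (+) t ` D (2 * \<delta>))"
    using T B borel_compact[OF compact_D]
    by (intro measure_mono_fmeasurable sub fmeasurable.finite_UN) (auto simp: sets_L)
  also have "\<dots> \<le> (\<Sum>t\<in>T. measure L ((+) t ` D (2 * \<delta>)))"
    using T B by (intro measure_UNION_le fmeasurableD)
  also have "\<dots> = real (card T) * (2 * \<delta>) ^ n * vol (D 1)"
    using vol_plus[OF borel_compact[OF compact_D]] TE vol_D[of "2 * \<delta>"] \<delta> by (simp add: vol_def)
  finally have "(1 + \<delta>) ^ n - (1 - \<delta>) ^ n \<le> real (card T) * (2 * \<delta>) ^ n" using vol_D_pos by simp
  moreover have "1 + \<delta> \<le> (1 + \<delta>) ^ n" using n \<delta> self_le_power[of "1 + \<delta>" n] by simp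
  moreover have "(1 - \<delta>) ^ n \<le> 1 - \<delta>" using n \<delta> power_decreasing[of 1 n "1 - \<delta>"] by simp
  moreover have "real (card T) * (2 * \<delta>) ^ n = (real (card T) * (2 * \<delta>) ^ (n - 1)) * (2 * \<delta>)"
    using n by (cases n) auto
  ultimately have "1 * (2 * \<delta>) \<le> (real (card T) * (2 * \<delta>) ^ (n - 1)) * (2 * \<delta>)" by linarith
  then show ?thesis using \<delta> by (intro mult_right_le_imp_le[of 1 "2 * \<delta>"]) auto
qed

text \<open>A separated set of greatest cardinality is a net, since a point far from all its members
  could be added; \<open>separated_card\<close> guarantees that a greatest cardinality
  exists.\<close>

lemma ex_net:
  assumes \<delta>: "0 < \<delta>" "\<delta> < 1" and n: "n \<ge> 2"
  shows "\<exists>T. separated \<delta> T \<and> (\<forall>u\<in>sphere1. \<exists>t\<in>T. norm (u - t) \<le> \<delta>)"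
proof -
  have bound: "card T \<le> nat \<lceil>(18 / \<delta>) ^ (n - 1)\<rceil>" if "separated \<delta> T" for T
  proof -
    have "real (card T) \<le> (18 / \<delta>) ^ (n - 1)"
      using separated_card[OF that \<delta> n] \<delta> by (simp add: power_divide field_simps)
    then show ?thesis by linarith
  qed
  have "separated \<delta> {}" by (simp add: separated_def)
  then have "\<exists>T. separated \<delta> T \<and> (\<forall>T'. separated \<delta> T' \<longrightarrow> card T' \<le> card T)"
    by (rule ex_has_greatest_nat[where P = "separated \<delta>" and f = card and
          b = "Suc (nat \<lceil>(18 / \<delta>) ^ (n - 1)\<rceil>)"])
       (intro allI impI le_imp_less_Suc bound)
  then obtain T where T: "separated \<delta> T" "\<And>T'. separated \<delta> T' \<Longrightarrow> card T' \<le> card T" by blast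
  have "\<exists>t\<in>T. norm (u - t) \<le> \<delta>" if u: "u \<in> sphere1" for u
  proof (rule ccontr)
    assume "\<not> (\<exists>t\<in>T. norm (u - t) \<le> \<delta>)"
    then have far: "\<And>t. t \<in> T \<Longrightarrow> norm (u - t) > \<delta>" by (auto simp: not_le)
    then have uT: "u \<notin> T" using \<delta> by force
    have "separated \<delta> (insert u T)"
      using T(1) u far unfolding separated_def by (auto simp: norm_minus_commute)
    then have "card (insert u T) \<le> card T" by (rule T(2))
    then show False using uT T(1) by (simp add: separated_def)
  qed
  then show ?thesis using T(1) by blast
qed

text \<open>An r/4-separated r/4-net has at least \<open>2 ^ (n - 1) * N\<close> points, and
  \<open>n \<ge> 2\<close> makes this at least \<open>2 * N\<close>. The separation is written
  \<open>4 * (r / 16)\<close> because caps of parameter \<open>\<rho>\<close> require separation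
  \<open>4 * \<rho>\<close>.\<close>

lemma ex_packing:
  fixes r :: real and N :: nat
  assumes n: "n \<ge> 2" and r: "0 < r" "r \<le> 1" "r ^ (n - 1) * N = 1"
  shows "\<exists>T. separated (4 * (r / 16)) T \<and> T \<noteq> {} \<and> 2 * N \<le> card T"
proof -
  obtain T where T: "separated (r / 4) T" "\<forall>u\<in>sphere1. \<exists>t\<in>T. norm (u - t) \<le> r / 4"
    using ex_net[of "r / 4"] n r by auto
  have "1 \<le> real (card T) * (2 * (r / 4)) ^ (n - 1)"
    using T n r by (intro net_card) (auto simp: separated_def)
  then have "2 ^ (n - 1) \<le> real (card T) * r ^ (n - 1)" by (simp add: power_divide field_simps)
  then have "2 ^ (n - 1) * real N \<le> real (card T) * r ^ (n - 1) * real N" by (intro mult_right_mono) auto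
  then have "2 ^ (n - 1) * real N \<le> real (card T)" using r(3) by (simp add: mult.assoc)
  moreover have "(2::real) \<le> 2 ^ (n - 1)" using n power_increasing[of 1 "n - 1" "2::real"] by simp
  then have "2 * real N \<le> 2 ^ (n - 1) * real N" by (intro mult_right_mono) auto
  ultimately have "2 * N \<le> card T" by linarith
  moreover have "N > 0" using r by (cases N) auto
  ultimately show ?thesis using T(1) by (intro exI[of _ T]) auto
qed

text \<open>The spacing \<open>18 * r\<close> is the one at which the bound of
  \<open>separated_card\<close> becomes \<open>N\<close>.\<close>

lemma ex_small_net:
  fixes r :: real and N :: nat
  assumes n: "n \<ge> 2" and r: "0 < r" "18 * r < 1" "r ^ (n - 1) * N = 1"
  shows "\<exists>T. finite T \<and> T \<noteq> {} \<and> T \<subseteq> sphere1 \<and> card T \<le> N \<and> (\<forall>u\<in>sphere1. \<exists>t\<in>T. norm (u - t) \<le> 18 * r)"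
proof -
  obtain T where T: "separated (18 * r) T" "\<forall>u\<in>sphere1. \<exists>t\<in>T. norm (u - t) \<le> 18 * r"
    using ex_net[of "18 * r"] n r by auto
  have "real (card T) * (18 * r) ^ (n - 1) \<le> 18 ^ (n - 1)"
    using separated_card[OF T(1)] n r by auto
  then have "real (card T) * r ^ (n - 1) \<le> 1" by (simp add: power_mult_distrib)
  then have "real (card T) * r ^ (n - 1) * real N \<le> 1 * real N" by (intro mult_right_mono) auto
  then have "real (card T) \<le> real N" using r(3) by (simp add: mult.assoc)
  moreover have "1 \<le> real (card T) * (2 * (18 * r)) ^ (n - 1)"
    using T n r by (intro net_card) (auto simp: separated_def)
  then have "T \<noteq> {}" by auto
  ultimately show ?thesis using T by (auto simp: separated_def)
qed

lemma net_inner: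
  assumes net: "\<And>u. u \<in> sphere1 \<Longrightarrow> \<exists>t\<in>T. norm (u - t) \<le> \<delta>" and x: "x \<in> E" and T: "T \<noteq> {}" "T \<subseteq> sphere1"
  shows "\<exists>t\<in>T. (1 - \<delta>\<^sup>2 / 2) * norm x \<le> x \<bullet> t"
proof (cases "x = 0")
  case False
  define u where "u = (1 / norm x) *\<^sub>R x"
  have u: "u \<in> sphere1" using False x subspace_E by (auto simp: u_def sphere1_def subspace_scale)
  obtain t where t: "t \<in> T" "norm (u - t) \<le> \<delta>" using net[OF u] by blast
  have "(norm (u - t))\<^sup>2 \<le> \<delta>\<^sup>2" using t by (intro power_mono) auto
  moreover have "(norm (u - t))\<^sup>2 = (norm u)\<^sup>2 + 1 - 2 * (u \<bullet> t)"
    using t T by (intro norm_diff_unit_sq) (auto simp: sphere1_def)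
  ultimately have "1 - \<delta>\<^sup>2 / 2 \<le> u \<bullet> t" using u by (simp add: sphere1_def)
  then have "(1 - \<delta>\<^sup>2 / 2) * norm x \<le> (u \<bullet> t) * norm x" by (intro mult_right_mono) auto
  also have "\<dots> = x \<bullet> t" using False by (simp add: u_def)
  finally show ?thesis using t by blast
qed (use T in auto)

lemma net_hull:
  assumes net: "\<And>u. u \<in> sphere1 \<Longrightarrow> \<exists>t\<in>T. norm (u - t) \<le> \<delta>" and T: "finite T" "T \<noteq> {}" "T \<subseteq> sphere1"
  shows "D (1 - \<delta>\<^sup>2 / 2) \<subseteq> convex hull T"
proof (rule D_subset_body)
  have "T \<subseteq> D 1" using T by (auto simp: sphere1_def in_D)
  then show "body (convex hull T)"
    using T hull_minimal[of T "D 1" convex] convex_D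
    by (auto simp: body_def finite_imp_compact_convex_hull in_D subset_iff)
  show "\<exists>z\<in>convex hull T. (1 - \<delta>\<^sup>2 / 2) * norm x \<le> x \<bullet> z" if "x \<in> E" for x
    using net_inner[OF net that T(2,3)] hull_subset[of T convex] by blast
qed

lemma net_polar:
  assumes net: "\<And>u. u \<in> sphere1 \<Longrightarrow> \<exists>t\<in>T. norm (u - t) \<le> \<delta>" and T: "T \<noteq> {}" "T \<subseteq> sphere1"
    and x: "x \<in> E" "\<And>t. t \<in> T \<Longrightarrow> t \<bullet> x \<le> 1" and \<delta>: "0 < \<delta>" "\<delta> < 1"
  shows "x \<in> D (1 / (1 - \<delta>\<^sup>2 / 2))"
proof -
  obtain t where t: "t \<in> T" "(1 - \<delta>\<^sup>2 / 2) * norm x \<le> x \<bullet> t" using net_inner[OF net x(1) T] by blast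
  have "(1 - \<delta>\<^sup>2 / 2) * norm x \<le> 1" using t x(2)[OF t(1)] by (simp add: inner_commute)
  then show ?thesis using rho_bounds[OF \<delta>] x(1) by (simp add: in_D field_simps)
qed

text \<open>Shrunk by \<open>a\<close>, the body \<open>P\<close> contains the slab with normalised
  normals: as each \<open>w i\<close> has norm at most 1, its constraint is implied by that of the
  corresponding unit vector. A zero vector imposes no constraint and may be replaced by any unit
  vector.\<close>

lemma outer_lower:
  assumes I: "finite I" "2 * card I \<le> card T" and w: "w ` I \<subseteq> D 1" and T: "separated (4 * \<rho>) T" "T \<noteq> {}"
    and \<rho>: "0 < \<rho>" "\<rho> < 1" and j: "j \<le> n"
    and P: "body P" "\<And>x. x \<in> D (1 / (1 - \<rho>\<^sup>2 / 2)) \<Longrightarrow> (\<And>i. i \<in> I \<Longrightarrow> w i \<bullet> x \<le> 1) \<Longrightarrow> x \<in> P"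
  shows "(1 + (1 - \<rho>\<^sup>2 / 2) ^ (n - j)) / 2 * steiner_coeff (D 1) j \<le> (1 - \<rho>\<^sup>2 / 2) ^ (n - j) * steiner_coeff P j"
proof -
  define a where "a = 1 - \<rho>\<^sup>2 / 2"
  have a: "0 < a" "a < 1" using rho_bounds[OF \<rho>] by (auto simp: a_def)
  obtain e where e: "e \<in> sphere1" using T by (auto simp: separated_def)
  define u where "u i = (if w i = 0 then e else (1 / norm (w i)) *\<^sub>R w i)" for i
  have u: "u ` I \<subseteq> sphere1"
    using e w subspace_scale[OF subspace_E] by (auto simp: u_def sphere1_def in_D)
  have "slab a I u \<subseteq> (*\<^sub>R) a ` P"
  proof
    fix x assume x: "x \<in> slab a I u"
    have "(1 / a) *\<^sub>R x \<in> P"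
    proof (rule P(2))
      show "(1 / a) *\<^sub>R x \<in> D (1 / (1 - \<rho>\<^sup>2 / 2))"
        using x a subspace_scale[OF subspace_E] unfolding a_def[symmetric]
        by (auto simp: slab_def in_D divide_right_mono)
      fix i assume i: "i \<in> I"
      have "w i \<bullet> x \<le> a"
      proof (cases "w i = 0")
        case False
        then have "w i \<bullet> x = norm (w i) * (u i \<bullet> x)" by (simp add: u_def)
        also have "\<dots> \<le> norm (w i) * a" using x i by (intro mult_left_mono) (auto simp: slab_def)
        also have "\<dots> \<le> 1 * a" using w i a by (intro mult_right_mono) (auto simp: in_D)
        finally show ?thesis by simp
      qed (use a in auto)
      then show "w i \<bullet> (1 / a) *\<^sub>R x \<le> 1" using a by simp
    qed
    then have "a *\<^sub>R ((1 / a) *\<^sub>R x) \<in> (*\<^sub>R) a ` P" by blast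
    then show "x \<in> (*\<^sub>R) a ` P" using a by simp
  qed
  then have "steiner_coeff (slab a I u) j \<le> steiner_coeff ((*\<^sub>R) a ` P) j"
    using a u by (intro steiner_coeff_mono body_slab body_scaleR P j) (auto simp: sphere1_def in_D)
  also have "\<dots> = a ^ (n - j) * steiner_coeff P j" by (rule steiner_coeff_scaleR[OF P(1) a(1) j])
  finally show ?thesis
    using slab_lower[OF I u, of \<rho> j] T \<rho> j unfolding a_def separated_def by (meson order_trans)
qed

text \<open>Hausdorff convergence, expressed by inclusions up to \<open>D (e m)\<close>. Enlarging
  the radius from \<open>r\<close> to \<open>r + e m\<close> costs at most the factor
  \<open>(1 + e m / r) ^ n\<close>, so the volumes of parallel bodies converge for each
  \<open>r > 0\<close>, and \<open>poly_coeffs_convergent\<close> passes to the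
  coefficients.\<close>

lemma steiner_coeff_tendsto:
  assumes K: "\<And>m. body (K m)" "body K'" and e: "e \<longlonglongrightarrow> 0" "\<And>m. e m \<ge> 0"
    and sub: "\<And>m. K m \<subseteq> K' + D (e m)" "\<And>m. K' \<subseteq> K m + D (e m)" and j: "j \<le> n"
  shows "(\<lambda>m. steiner_coeff (K m) j) \<longlonglongrightarrow> steiner_coeff K' j"
proof -
  have le: "vol (A + D r) \<le> (1 + e m / r) ^ n * vol (B + D r)"
    if "body A" "body B" "A \<subseteq> B + D (e m)" "r > 0" for A B m r
  proof -
    have "A + D r \<subseteq> B + D (e m) + D r" by (intro set_plus_mono2 that subset_refl)
    also have "\<dots> = B + (D r + D (e m))" by (simp add: ac_simps)
    also have "D r + D (e m) = D (r + e m)" using that(4) e(2)[of m] by (rule D_add)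
    also have "r + e m = (1 + e m / r) * r" using that(4) by (simp add: distrib_right)
    finally have "vol (A + D r) \<le> vol (B + D ((1 + e m / r) * r))"
      using that e(2)[of m] by (intro vol_mono body_add body_D) auto
    also have "\<dots> \<le> (1 + e m / r) ^ n * vol (B + D r)"
      using that e(2)[of m] by (intro vol_add_D_le) auto
    finally show ?thesis .
  qed
  have v: "(\<lambda>m. \<Sum>i\<le>n. steiner_coeff (K m) i * r ^ i) \<longlonglongrightarrow> vol (K' + D r)" if r: "r > 0" for r
  proof (rule tendsto_sandwich)
    have er: "(\<lambda>m. (1 + e m / r) ^ n) \<longlonglongrightarrow> (1 + 0 / r) ^ n"
      using r by (intro tendsto_intros e) auto
    have pos: "(1 + e m / r) ^ n > 0" for m using r e(2)[of m] by (simp add: add_pos_nonneg)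
    show "\<forall>\<^sub>F m in sequentially. vol (K' + D r) / (1 + e m / r) ^ n \<le> (\<Sum>i\<le>n. steiner_coeff (K m) i * r ^ i)"
      using le[OF K(2) K(1) sub(2) r] pos r steiner[OF K(1), of r]
      by (intro always_eventually allI) (simp add: divide_le_eq mult.commute)
    show "\<forall>\<^sub>F m in sequentially. (\<Sum>i\<le>n. steiner_coeff (K m) i * r ^ i) \<le> (1 + e m / r) ^ n * vol (K' + D r)"
      using le[OF K(1) K(2) sub(1) r] r steiner[OF K(1), of r]
      by (intro always_eventually allI) simp
    show "(\<lambda>m. vol (K' + D r) / (1 + e m / r) ^ n) \<longlonglongrightarrow> vol (K' + D r)"
      using tendsto_divide[OF tendsto_const er, of "vol (K' + D r)"] by simp
    show "(\<lambda>m. (1 + e m / r) ^ n * vol (K' + D r)) \<longlonglongrightarrow> vol (K' + D r)"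
      using tendsto_mult[OF er tendsto_const, of "vol (K' + D r)"] by simp
  qed
  have c: "(\<lambda>m. steiner_coeff (K m) i) \<longlonglongrightarrow> lim (\<lambda>m. steiner_coeff (K m) i)" if "i \<le> n" for i
  proof (rule iffD1[OF convergent_LIMSEQ_iff], rule poly_coeffs_convergent[where n = n, OF _ that])
    show "convergent (\<lambda>m. \<Sum>i\<le>n. steiner_coeff (K m) i * r ^ i)" if "r > 0" for r
      by (rule convergentI[OF v[OF that]])
  qed
  have "steiner_coeff K' j = lim (\<lambda>m. steiner_coeff (K m) j)"
  proof (rule steiner_coeff_unique[OF K(2) _ j])
    fix r :: real assume "r > 0"
    moreover have "(\<lambda>m. \<Sum>i\<le>n. steiner_coeff (K m) i * r ^ i) \<longlonglongrightarrow> (\<Sum>i\<le>n. lim (\<lambda>m. steiner_coeff (K m) i) * r ^ i)"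
      by (intro tendsto_intros c) simp
    ultimately show "vol (K' + D r) = (\<Sum>i\<le>n. lim (\<lambda>m. steiner_coeff (K m) i) * r ^ i)"
      using v LIMSEQ_unique by meson
  qed
  then show ?thesis using c[OF j] by simp
qed

section \<open>Compactness and the existence of extremal polytopes\<close>

definition D_seqs :: "(nat \<Rightarrow> 'a) set" where "D_seqs = {v. range v \<subseteq> D 1}"

text \<open>Tychonoff's theorem. Infinite sequences are used although a polytope depends on the
  first \<open>N\<close> entries only: the function type carries the product topology, and the
  parameter space is the same for all \<open>N\<close>.\<close>

lemma compact_D_seqs: "compact D_seqs"
proof -
  have "D_seqs = PiE UNIV (\<lambda>_. D 1)" by (auto simp: D_seqs_def PiE_def)
  moreover have "compactin (product_topology (\<lambda>_. euclidean) UNIV) (PiE UNIV (\<lambda>_::nat. D 1))"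
    by (subst compactin_PiE) (auto simp: compact_D)
  ultimately show ?thesis by (simp add: euclidean_product_topology)
qed

lemma D_seqs_nonempty: "D_seqs \<noteq> {}"
proof -
  have "(\<lambda>_. 0) \<in> D_seqs" using subspace_0[OF subspace_E] by (auto simp: D_seqs_def in_D)
  then show ?thesis by blast
qed

lemma tendsto_coord: "x \<longlonglongrightarrow> (a :: nat \<Rightarrow> 'a) \<Longrightarrow> (\<lambda>m. x m i) \<longlonglongrightarrow> a i"
  by (rule continuous_on_tendsto_compose[OF continuous_on_product_coordinates]) auto

lemma continuous_on_D_seqs:
  fixes K :: "(nat \<Rightarrow> 'a) \<Rightarrow> 'a set"
  assumes K: "\<And>v. v \<in> D_seqs \<Longrightarrow> body (K v)" and C: "C \<ge> 0"
    and sub: "\<And>u v. u \<in> D_seqs \<Longrightarrow> v \<in> D_seqs \<Longrightarrow> K u \<subseteq> K v + D (C * (\<Sum>i<N. norm (u i - v i)))" and j: "j \<le> n"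
  shows "continuous_on D_seqs (\<lambda>v. steiner_coeff (K v) j)"
  unfolding continuous_on_sequentially o_def
proof (intro allI ballI impI)
  fix x a assume a: "a \<in> D_seqs" and x: "(\<forall>m. x m \<in> D_seqs) \<and> x \<longlonglongrightarrow> a"
  define e where "e m = C * (\<Sum>i<N. norm (x m i - a i))" for m
  have "(\<lambda>m. x m i) \<longlonglongrightarrow> a i" for i using x by (intro tendsto_coord) auto
  then have "(\<lambda>m. x m i - a i) \<longlonglongrightarrow> 0" for i by (simp add: LIM_zero)
  then have "(\<lambda>m. norm (x m i - a i)) \<longlonglongrightarrow> 0" for i by (rule tendsto_norm_zero)
  then have "e \<longlonglongrightarrow> C * (\<Sum>i<N. 0)" unfolding e_def by (intro tendsto_intros)
  then show "(\<lambda>m. steiner_coeff (K (x m)) j) \<longlonglongrightarrow> steiner_coeff (K a) j"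
    using x a C sub[of "x m" a for m] sub[of a "x m" for m]
    by (intro steiner_coeff_tendsto[where e = e] K j) (auto simp: e_def norm_minus_commute sum_nonneg)
qed

text \<open>Points may coincide, so the \<open>N\<close> entries also describe hulls of fewer points
  and the parameter space is closed under limits.\<close>

lemma hull_max_attained:
  assumes j: "j \<le> n" and N: "N > 0"
  shows "\<exists>v\<in>D_seqs. \<forall>u\<in>D_seqs. steiner_coeff (convex hull (u ` {..<N})) j \<le> steiner_coeff (convex hull (v ` {..<N})) j"
proof (rule continuous_attains_sup[OF compact_D_seqs D_seqs_nonempty])
  show "continuous_on D_seqs (\<lambda>v. steiner_coeff (convex hull (v ` {..<N})) j)"
  proof (rule continuous_on_D_seqs[where C = 1 and N = N, OF _ _ _ j])
    fix v assume v: "v \<in> D_seqs"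
    then have "v ` {..<N} \<subseteq> D 1" by (auto simp: D_seqs_def)
    then have "convex hull (v ` {..<N}) \<subseteq> D 1" by (intro hull_minimal convex_D)
    then show "body (convex hull (v ` {..<N}))"
      using N by (auto simp: body_def finite_imp_compact_convex_hull in_D)
    fix u assume u: "u \<in> D_seqs"
    define e where "e = 1 * (\<Sum>i<N. norm (u i - v i))"
    have "u ` {..<N} \<subseteq> convex hull (v ` {..<N}) + D e"
    proof clarify
      fix i assume i: "i < N"
      have "norm (u i - v i) \<le> e" unfolding e_def using i member_le_sum[of i "{..<N}" "\<lambda>i. norm (u i - v i)"] by simp
      moreover have "u i \<in> D 1" "v i \<in> D 1" using u v by (auto simp: D_seqs_def)
      then have "u i - v i \<in> E" by (simp add: in_D subspace_diff[OF subspace_E])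
      ultimately have "v i + (u i - v i) \<in> convex hull (v ` {..<N}) + D e"
        using i by (intro set_plus_intro hull_inc) (auto simp: in_D)
      then show "u i \<in> convex hull (v ` {..<N}) + D e" by simp
    qed
    then show "convex hull (u ` {..<N}) \<subseteq> convex hull (v ` {..<N}) + D (1 * (\<Sum>i<N. norm (u i - v i)))"
      unfolding e_def[symmetric] by (intro hull_minimal convex_set_plus convex_convex_hull convex_D)
  qed simp
qed

text \<open>The constraints alone may define an unbounded set. Truncating at radius 2 yields a body
  that depends continuously on \<open>w\<close>.\<close>

definition poly2 :: "nat \<Rightarrow> (nat \<Rightarrow> 'a) \<Rightarrow> 'a set" where
  "poly2 N w = {x \<in> D 2. \<forall>i<N. w i \<bullet> x \<le> 1}"

lemma D_subset_poly2: "w \<in> D_seqs \<Longrightarrow> D 1 \<subseteq> poly2 N w"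
  using D_subset_slab[of 1 w "{..<N}"] D_mono[of 1 2] by (auto simp: poly2_def slab_def D_seqs_def)

lemma body_poly2: assumes "w \<in> D_seqs" shows "body (poly2 N w)"
proof -
  have eq: "poly2 N w = D 2 \<inter> (\<Inter>i\<in>{..<N}. {x. w i \<bullet> x \<le> 1})" by (auto simp: poly2_def)
  have "compact (poly2 N w)"
    unfolding eq by (intro compact_Int_closed compact_D closed_INT ballI closed_halfspace_le)
  moreover have "convex (poly2 N w)"
    unfolding eq by (intro convex_Int convex_D convex_INT convex_halfspace_le)
  moreover have "poly2 N w \<noteq> {}" using D_subset_poly2[OF assms] body_D[of 1] by (auto simp: body_def)
  moreover have "poly2 N w \<subseteq> E" by (auto simp: poly2_def in_D)
  ultimately show ?thesis by (simp add: body_def)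
qed

lemma poly2_min_attained:
  assumes j: "j \<le> n"
  shows "\<exists>w\<in>D_seqs. \<forall>u\<in>D_seqs. steiner_coeff (poly2 N w) j \<le> steiner_coeff (poly2 N u) j"
proof (rule continuous_attains_inf[OF compact_D_seqs D_seqs_nonempty])
  show "continuous_on D_seqs (\<lambda>w. steiner_coeff (poly2 N w) j)"
  proof (rule continuous_on_D_seqs[where C = 4 and N = N, OF body_poly2 _ _ j])
    fix u v assume uv: "u \<in> D_seqs" "v \<in> D_seqs"
    define e where "e = (\<Sum>i<N. norm (u i - v i))"
    have e: "e \<ge> 0" by (simp add: e_def sum_nonneg)
    show "poly2 N u \<subseteq> poly2 N v + D (4 * (\<Sum>i<N. norm (u i - v i)))"
      unfolding e_def[symmetric]
    proof
      fix x assume x: "x \<in> poly2 N u"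
      then have xD: "x \<in> E" "norm x \<le> 2" by (auto simp: poly2_def in_D)
      \<comment> \<open>On \<open>poly2 N u\<close> a constraint of \<open>v\<close> is exceeded by
        at most \<open>2 * e\<close>, as \<open>norm x \<le> 2\<close>. Scaling by \<open>s\<close>
        repairs this and moves \<open>x\<close> by at most \<open>(2 * e) * 2\<close>, which is the
        origin of the constant 4.\<close>
      define s where "s = 1 / (1 + 2 * e)"
      have s: "0 < s" "s \<le> 1" "1 - s \<le> 2 * e" using e by (auto simp: s_def field_simps)
      have "v i \<bullet> (s *\<^sub>R x) \<le> 1" if i: "i < N" for i
      proof -
        have "norm (u i - v i) \<le> e" unfolding e_def using i member_le_sum[of i "{..<N}" "\<lambda>i. norm (u i - v i)"] by simp
        then have "norm (v i - u i) * norm x \<le> e * 2"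
          using xD e by (intro mult_mono) (auto simp: norm_minus_commute)
        then have "(v i - u i) \<bullet> x \<le> e * 2" using norm_cauchy_schwarz[of "v i - u i" x] by linarith
        moreover have "u i \<bullet> x \<le> 1" using x i by (auto simp: poly2_def)
        ultimately have "v i \<bullet> x \<le> 1 + 2 * e" by (simp add: inner_diff_left)
        then have "s * (v i \<bullet> x) \<le> s * (1 + 2 * e)" using s by (intro mult_left_mono) auto
        then show ?thesis using e by (simp add: s_def)
      qed
      moreover have "s *\<^sub>R x \<in> D 2"
        using s xD subspace_scale[OF subspace_E] mult_mono[of s 1 "norm x" 2] by (auto simp: in_D)
      ultimately have 1: "s *\<^sub>R x \<in> poly2 N v" by (simp add: poly2_def)
      have "(1 - s) * norm x \<le> (2 * e) * 2" using s xD e by (intro mult_mono) auto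
      then have 2: "(1 - s) *\<^sub>R x \<in> D (4 * e)"
        using s xD subspace_scale[OF subspace_E] by (auto simp: in_D)
      have "s *\<^sub>R x + (1 - s) *\<^sub>R x \<in> poly2 N v + D (4 * e)" using 1 2 by (rule set_plus_intro)
      then show "x \<in> poly2 N v + D (4 * e)" by (simp add: scaleR_left_diff_distrib)
    qed
  qed simp_all
qed

text \<open>A body that contains \<open>D\<close> and a point at distance \<open>2\<close> has reflected copies that together cover
  the ball of radius \<open>9/8\<close>, so its coefficients exceed those of \<open>D\<close> by a fixed amount.\<close>

lemma far_point:
  assumes n: "n \<ge> 2" and j: "j < n"
  shows "\<exists>\<delta>>0. \<forall>K x. body K \<longrightarrow> D 1 \<subseteq> K \<longrightarrow> x \<in> K \<longrightarrow> norm x = 2 \<longrightarrow>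
    (1 + \<delta>) * steiner_coeff (D 1) j \<le> steiner_coeff K j"
proof -
  have jn: "j \<le> n" using j by simp
  obtain T where T0: "separated (1/4) T" "\<forall>u\<in>sphere1. \<exists>t\<in>T. norm (u - t) \<le> 1/4"
    using ex_net[of "1/4"] n by auto
  then have T: "finite T" "T \<subseteq> sphere1" by (auto simp: separated_def)
  have "1 \<le> real (card T) * (2 * (1/4)) ^ (n - 1)" using T T0 n by (intro net_card) auto
  then have cT: "card T > 0" by (cases "card T") auto
  \<comment> \<open>The gain from radius 1 to radius 9/8 is shared among \<open>card T\<close>
    congruent copies of the body.\<close>
  define \<delta> where "\<delta> = ((9/8) ^ (n - j) - 1) / real (card T)"
  have "(1::real) < (9/8) ^ (n - j)" using j by (intro one_less_power) auto
  then have \<delta>: "\<delta> > 0" using cT by (simp add: \<delta>_def)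
  have "(1 + \<delta>) * steiner_coeff (D 1) j \<le> steiner_coeff K j"
    if K: "body K" "D 1 \<subseteq> K" and x: "x \<in> K" "norm x = 2" for K x
  proof -
    have xE: "x \<in> E" using K x by (auto simp: body_def)
    define d where "d t = x - 2 *\<^sub>R t" for t
    have dE: "d t \<in> E" if "t \<in> T" for t
      using that T xE subspace_E by (auto simp: d_def sphere1_def subspace_diff subspace_scale)
    define M where "M t = refl_along (d t) ` K" for t
    have M: "body (M t)" if "t \<in> T" for t unfolding M_def by (rule body_refl_along[OF dE[OF that] K(1)])
    have DM: "D 1 \<subseteq> M t" if "t \<in> T" for t
      using image_mono[OF K(2), of "refl_along (d t)"] refl_along_image_D[OF dE[OF that]] by (simp add: M_def)
    have tM: "2 *\<^sub>R t \<in> M t" if "t \<in> T" for t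
    proof -
      have "refl_along (d t) x = 2 *\<^sub>R t"
        unfolding d_def using that T x(2) by (intro refl_along_diff) (auto simp: sphere1_def)
      then show ?thesis unfolding M_def using x(1) by (metis imageI)
    qed
    have "steiner_coeff (D (9/8)) j \<le> steiner_coeff (D 1) j + (\<Sum>t\<in>T. steiner_coeff (M t) j - steiner_coeff (D 1) j)"
    proof (rule steiner_coeff_cover[OF T(1) _ _ _ M DM _ jn])
      fix Q assume Q: "body Q"
      show "D (9/8) + Q \<subseteq> (D 1 + Q) \<union> (\<Union>t\<in>T. (M t + Q) - (D 1 + Q))"
      proof
        fix y assume y: "y \<in> D (9/8) + Q"
        then obtain k q where kq: "k \<in> D (9/8)" "q \<in> Q" "y = k + q" by (auto simp: set_plus_def)
        have yE: "y \<in> E" using y body_add[OF body_D Q, of "9/8"] by (auto simp: body_def)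
        obtain p where p: "p \<in> Q" "y - p \<in> E"
          "\<And>k q. q \<in> Q \<Longrightarrow> y = k + q \<Longrightarrow> (norm (y - p))\<^sup>2 \<le> (y - p) \<bullet> k"
          using residual[OF Q yE] by blast
        define z where "z = y - p"
        have "norm z * norm z \<le> norm z * norm k"
          using p(3)[OF kq(2,3)] norm_cauchy_schwarz[of z k] by (simp add: power2_eq_square z_def)
        then have "norm z \<le> norm k \<or> z = 0" by auto
        then have z98: "norm z \<le> 9/8" using kq(1) by (auto simp: in_D)
        have "y \<in> (\<Union>t\<in>T. (M t + Q) - (D 1 + Q))" if ny: "y \<notin> D 1 + Q"
        proof -
          have z1: "norm z > 1"
          proof (rule ccontr)
            assume "\<not> norm z > 1"
            then have "z + p \<in> D 1 + Q" using p by (intro set_plus_intro) (auto simp: in_D z_def)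
            then show False using ny by (simp add: z_def)
          qed
          define u where "u = (1 / norm z) *\<^sub>R z"
          have z0: "norm z \<noteq> 0" using z1 by linarith
          have u: "u \<in> sphere1" using z0 p(2) subspace_E by (auto simp: u_def sphere1_def z_def subspace_scale)
          then obtain t where t: "t \<in> T" "norm (u - t) \<le> 1/4" using T0(2) by blast
          \<comment> \<open>Solves z = (1/4)(2t) + (3/4)w. As \<open>norm z \<le> 9/8\<close> and
            \<open>t\<close> is within 1/4 of the direction of \<open>z\<close>, the distance from
            \<open>z\<close> to t/2 is at most 5/8 + 1/8 = 3/4, so \<open>w\<close> lies in the unit
            ball.\<close>
          define w where "w = (4/3) *\<^sub>R (z - (1/2) *\<^sub>R t)"
          have "z - (1/2) *\<^sub>R u = (norm z - 1/2) *\<^sub>R u" using z0 by (simp add: u_def algebra_simps)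
          then have "norm (z - (1/2) *\<^sub>R u) = norm z - 1/2" using u z1 by (simp add: sphere1_def)
          moreover have "norm ((1/2) *\<^sub>R (u - t)) \<le> 1/8" using t by simp
          moreover have "z - (1/2) *\<^sub>R t = (z - (1/2) *\<^sub>R u) + (1/2) *\<^sub>R (u - t)" by (simp add: algebra_simps)
          then have "norm (z - (1/2) *\<^sub>R t) \<le> norm (z - (1/2) *\<^sub>R u) + norm ((1/2) *\<^sub>R (u - t))"
            by (metis norm_triangle_ineq)
          ultimately have "norm (z - (1/2) *\<^sub>R t) \<le> 3/4" using z98 by linarith
          moreover have "z - (1/2) *\<^sub>R t \<in> E"
            using t T p(2) subspace_E by (auto simp: z_def sphere1_def intro!: subspace_diff subspace_scale)
          ultimately have "w \<in> D 1" using subspace_scale[OF subspace_E] by (auto simp: w_def in_D)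
          then have "w \<in> M t" using DM[OF t(1)] by blast
          moreover have "convex (M t)" using M[OF t(1)] by (simp add: body_def)
          ultimately have "(1/4) *\<^sub>R (2 *\<^sub>R t) + (3/4) *\<^sub>R w \<in> M t"
            using tM[OF t(1)] by (intro convexD) auto
          moreover have "(1/4) *\<^sub>R (2 *\<^sub>R t) + (3/4) *\<^sub>R w = z" by (simp add: w_def algebra_simps)
          ultimately have "z + p \<in> M t + Q" using p(1) by (intro set_plus_intro) auto
          then show ?thesis using ny t(1) by (auto simp: z_def)
        qed
        then show "y \<in> (D 1 + Q) \<union> (\<Union>t\<in>T. (M t + Q) - (D 1 + Q))" by blast
      qed
    qed (use body_D in auto)
    also have "(\<Sum>t\<in>T. steiner_coeff (M t) j - steiner_coeff (D 1) j) = (\<Sum>t\<in>T. steiner_coeff K j - steiner_coeff (D 1) j)"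
      unfolding M_def by (intro sum.cong refl) (simp add: steiner_coeff_refl_along[OF K(1) dE jn])
    finally have "((9/8) ^ (n - j) - 1) * steiner_coeff (D 1) j \<le> real (card T) * (steiner_coeff K j - steiner_coeff (D 1) j)"
      using steiner_coeff_D[OF jn, of "9/8"] by (simp add: algebra_simps)
    moreover have "(9/8) ^ (n - j) - 1 = real (card T) * \<delta>" using cT by (simp add: \<delta>_def)
    ultimately have "real (card T) * (\<delta> * steiner_coeff (D 1) j) \<le> real (card T) * (steiner_coeff K j - steiner_coeff (D 1) j)"
      by (simp add: mult.assoc)
    then have "\<delta> * steiner_coeff (D 1) j \<le> steiner_coeff K j - steiner_coeff (D 1) j"
      using cT by (simp only: mult_le_cancel_left_pos of_nat_0_less_iff)
    then show ?thesis by (simp add: distrib_right)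
  qed
  then show ?thesis using \<delta> by blast
qed

end

section \<open>Facets and polar bodies\<close>

text \<open>This and \<open>facet\<close> are polymorphic counterparts of \<open>affine_dim\<close>
  and \<open>is_facet\<close>, which makes the facet arguments available in an inner product
  space.\<close>

definition adim :: "'a::real_vector set \<Rightarrow> nat" where
  "adim S = dim {x - y | x y. x \<in> S \<and> y \<in> S}"

definition facet :: "'a::real_vector set \<Rightarrow> 'a set \<Rightarrow> bool" where
  "facet F P \<longleftrightarrow> F face_of P \<and> F \<noteq> {} \<and> adim F + 1 = adim P"

text \<open>Finitely many strict inequalities tolerate a common small displacement; this is used to
  prolong a segment inside a polytope.\<close>

lemma finite_ex_small:
  fixes a b :: "'b \<Rightarrow> real"
  assumes "finite S" "\<And>s. s \<in> S \<Longrightarrow> b s > 0"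
  shows "\<exists>\<epsilon>>0. \<forall>s\<in>S. \<epsilon> * a s \<le> b s"
  using assms
proof (induction S rule: finite_induct)
  case empty
  then show ?case by (intro exI[of _ 1]) auto
next
  case (insert x S)
  then obtain \<epsilon> where \<epsilon>: "\<epsilon> > 0" "\<forall>s\<in>S. \<epsilon> * a s \<le> b s" by auto
  define \<delta> where "\<delta> = min \<epsilon> (b x / (\<bar>a x\<bar> + 1))"
  have bx: "b x > 0" using insert.prems by simp
  then have \<delta>: "0 < \<delta>" using \<epsilon> by (simp add: \<delta>_def add_nonneg_pos)
  have "\<delta> * a x \<le> b x"
  proof -
    have "\<delta> * a x \<le> \<delta> * (\<bar>a x\<bar> + 1)" using \<delta> by (intro mult_left_mono) auto
    also have "\<dots> \<le> b x / (\<bar>a x\<bar> + 1) * (\<bar>a x\<bar> + 1)" by (intro mult_right_mono) (auto simp: \<delta>_def)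
    also have "\<dots> = b x" by simp
    finally show ?thesis .
  qed
  moreover have "\<delta> * a s \<le> b s" if s: "s \<in> S" for s
  proof (cases "a s \<ge> 0")
    case True
    then have "\<delta> * a s \<le> \<epsilon> * a s" by (intro mult_right_mono) (auto simp: \<delta>_def)
    then show ?thesis using \<epsilon> s by force
  next
    case False
    then have "\<delta> * a s \<le> 0" using \<delta> by (simp add: mult_le_0_iff)
    then show ?thesis using insert.prems[of s] s by simp
  qed
  ultimately show ?case using \<delta> by (intro exI[of _ \<delta>]) auto
qed

text \<open>Averaging keeps every strict inequality already reached. The resulting point behaves
  like a relative interior point of \<open>F\<close>.\<close>

lemma convex_common_strict:
  assumes "finite W" "convex F" "F \<noteq> {}" "\<And>w x. w \<in> W \<Longrightarrow> x \<in> F \<Longrightarrow> w \<bullet> x \<le> 1"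
    "\<And>w. w \<in> W \<Longrightarrow> \<exists>x\<in>F. w \<bullet> x < 1"
  shows "\<exists>z\<in>F. \<forall>w\<in>W. w \<bullet> z < 1"
  using assms(1,4,5)
proof (induction W rule: finite_induct)
  case empty
  then show ?case using assms(3) by auto
next
  case (insert v W)
  then obtain z where z: "z \<in> F" "\<forall>w\<in>W. w \<bullet> z < 1" by auto
  obtain x where x: "x \<in> F" "v \<bullet> x < 1" using insert.prems(2)[of v] by auto
  define m where "m = (1/2) *\<^sub>R z + (1/2) *\<^sub>R x"
  have "m \<in> F" unfolding m_def by (intro convexD assms z x) auto
  moreover have "w \<bullet> m < 1" if "w \<in> insert v W" for w
  proof -
    have "w \<bullet> z \<le> 1" "w \<bullet> x \<le> 1" "w \<bullet> z < 1 \<or> w \<bullet> x < 1"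
      using insert.prems(1)[OF that] z x that by auto
    then show ?thesis by (auto simp: m_def inner_add_right)
  qed
  ultimately show ?case by blast
qed

text \<open>The vector is \<open>a\<close> minus its projection, computed in an orthogonal set that
  spans the same subspace as \<open>T\<close>.\<close>

lemma ex_orthogonal_vector:
  assumes "finite T" "a \<notin> span T"
  shows "\<exists>d \<in> span (insert a T). d \<noteq> 0 \<and> (\<forall>t\<in>T. d \<bullet> t = 0)"
proof -
  obtain C where C: "finite C" "span C = span T" "pairwise orthogonal C"
    using basis_orthogonal[OF assms(1)] by blast
  define p where "p = (\<Sum>b\<in>C. (b \<bullet> a / (b \<bullet> b)) *\<^sub>R b)"
  have pC: "p \<in> span C" unfolding p_def by (intro span_sum span_scale span_base)
  have orth: "(a - p) \<bullet> c = 0" if c: "c \<in> C" for c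
  proof -
    have "p \<bullet> c = (\<Sum>b\<in>C. (b \<bullet> a / (b \<bullet> b)) * (b \<bullet> c))" by (simp add: p_def inner_sum_left)
    also have "\<dots> = (\<Sum>b\<in>C. if b = c then c \<bullet> a else 0)"
      using C(3) c by (intro sum.cong refl) (auto simp: pairwise_def orthogonal_def)
    also have "\<dots> = c \<bullet> a" using C(1) c by simp
    also have "\<dots> = a \<bullet> c" by (rule inner_commute)
    finally show ?thesis by (simp add: inner_diff_left)
  qed
  have "subspace {x. (a - p) \<bullet> x = 0}" by (rule subspace_hyperplane)
  then have "span C \<subseteq> {x. (a - p) \<bullet> x = 0}" using orth by (intro span_minimal) auto
  then have "(a - p) \<bullet> t = 0" if "t \<in> T" for t using that span_base[of t T] C(2) by auto
  moreover have "a - p \<noteq> 0" using pC C(2) assms(2) by auto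
  moreover have pS: "p \<in> span (insert a T)" using pC C(2) span_mono[of T "insert a T"] by auto
  have "a - p \<in> span (insert a T)" by (rule span_diff[OF span_base pS]) simp
  ultimately show ?thesis by blast
qed

text \<open>Ties the scaling exponent \<open>n\<close> to the linear dimension of \<open>E\<close>;
  volume arguments see only the former, facets are defined by the latter.\<close>

locale euclid_volume_dim = euclid_volume +
  assumes ex_basis: "\<exists>C. finite C \<and> independent C \<and> span C = E \<and> card C = n"
begin

lemma span_subset_E: "S \<subseteq> E \<Longrightarrow> span S \<subseteq> E"
  by (rule span_minimal[OF _ subspace_E])

lemma independent_E:
  assumes "independent B" "B \<subseteq> E" shows "finite B" "card B \<le> n"
  using ex_basis independent_span_bound[of _ B] assms by auto

lemma independent_card_eq_n:
  assumes "independent B" "B \<subseteq> E" shows "card B = n \<longleftrightarrow> span B = E"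
proof
  assume B: "card B = n"
  show "span B = E"
  proof (rule ccontr)
    assume "span B \<noteq> E"
    then obtain x where x: "x \<in> E" "x \<notin> span B" using span_subset_E[OF assms(2)] by blast
    then have "independent (insert x B)" using assms(1) by (simp add: independent_insertI)
    then have "card (insert x B) \<le> n" using x assms(2) by (intro independent_E) auto
    moreover have "x \<notin> B" using x span_base by blast
    ultimately show False using B independent_E(1)[OF assms] by simp
  qed
next
  assume B: "span B = E"
  obtain C where C: "finite C" "independent C" "span C = E" "card C = n" using ex_basis by blast
  have "C \<subseteq> span B" using C B span_superset by blast
  then have "card C \<le> card B" using independent_span_bound[OF independent_E(1)[OF assms] C(2)] by simp
  then show "card B = n" using C independent_E(2)[OF assms] by simp
qed

text \<open>The hyperplane misses the origin, so a point of \<open>F\<close> added to a basis of the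
  difference space gives a basis of \<open>span F\<close>. The facet condition thereby becomes a
  spanning condition.\<close>

lemma adim_hyperplane:
  assumes F: "F \<subseteq> E" "F \<noteq> {}" and w: "\<And>x. x \<in> F \<Longrightarrow> w \<bullet> x = 1"
  shows "adim F + 1 = n \<longleftrightarrow> span F = E"
proof -
  define U where "U = {x - y | x y. x \<in> F \<and> y \<in> F}"
  obtain B where B: "B \<subseteq> U" "independent B" "U \<subseteq> span B" "card B = dim U"
    using basis_exists by blast
  obtain x0 where x0: "x0 \<in> F" using F by blast
  have UE: "U \<subseteq> E" using F(1) by (auto simp: U_def intro!: subspace_diff[OF subspace_E])
  have fB: "finite B" using B UE by (intro independent_E) auto
  have "span B \<subseteq> {x. w \<bullet> x = 0}"
    using B(1) w by (intro span_minimal subspace_hyperplane) (auto simp: U_def inner_diff_right)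
  then have n0: "x0 \<notin> span B" using w[OF x0] by auto
  then have ind: "independent (insert x0 B)" using B(2) by (simp add: independent_insertI)
  have sub: "insert x0 B \<subseteq> E" using B(1) UE x0 F by auto
  have card: "card (insert x0 B) = adim F + 1"
  proof -
    have "x0 \<notin> B" using n0 span_base by blast
    then show ?thesis using fB B(4) by (simp add: adim_def U_def)
  qed
  have "span (insert x0 B) = span F"
  proof (rule antisym; rule span_minimal[OF _ subspace_span])
    have "u \<in> span F" if u: "u \<in> U" for u
    proof -
      obtain x y where "u = x - y" "x \<in> F" "y \<in> F" using u by (auto simp: U_def)
      then show ?thesis by (simp add: span_diff span_base)
    qed
    then show "insert x0 B \<subseteq> span F" using B(1) x0 span_base by blast
    show "F \<subseteq> span (insert x0 B)"
    proof
      fix x assume "x \<in> F"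
      then have "x - x0 \<in> span B" using B(3) x0 by (auto simp: U_def)
      then have "x - x0 \<in> span (insert x0 B)" using span_mono[of B "insert x0 B"] by auto
      then have "(x - x0) + x0 \<in> span (insert x0 B)" by (rule span_add[OF _ span_base]) simp
      then show "x \<in> span (insert x0 B)" by (simp only: diff_add_cancel)
    qed
  qed
  then show ?thesis using independent_card_eq_n[OF ind sub] card by simp
qed

lemma span_D: "span (D 1) = E"
proof (rule antisym)
  show "span (D 1) \<subseteq> E" by (rule span_subset_E) (auto simp: in_D)
  show "E \<subseteq> span (D 1)"
  proof
    fix x assume x: "x \<in> E"
    show "x \<in> span (D 1)"
    proof (cases "x = 0")
      case False
      then have "(1 / norm x) *\<^sub>R x \<in> span (D 1)"
        using x subspace_scale[OF subspace_E] by (intro span_base) (auto simp: in_D)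
      then have "norm x *\<^sub>R ((1 / norm x) *\<^sub>R x) \<in> span (D 1)" by (rule span_scale)
      then show ?thesis using False by simp
    qed (simp add: span_zero)
  qed
qed

lemma adim_full:
  assumes "D 1 \<subseteq> P" "P \<subseteq> E" shows "adim P = n"
proof -
  obtain C where C: "finite C" "independent C" "span C = E" "card C = n" using ex_basis by blast
  define U where "U = {x - y | x y. x \<in> P \<and> y \<in> P}"
  have "0 \<in> P" using assms(1) subspace_0[OF subspace_E] by (auto simp: in_D)
  then have "P \<subseteq> U" by (force simp: U_def)
  moreover have "U \<subseteq> E" using assms(2) by (auto simp: U_def intro!: subspace_diff[OF subspace_E])
  ultimately have "span U = E" using span_D assms(1) span_mono[of "D 1" U] span_subset_E[of U] by blast
  then show ?thesis using C dim_eq_card[of C U] by (simp add: adim_def U_def)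
qed

lemma eq_on_spanning:
  assumes "span T = E" "w \<in> E" "w' \<in> E" "\<And>t. t \<in> T \<Longrightarrow> w \<bullet> t = w' \<bullet> t"
  shows "w = w'"
proof -
  have "span T \<subseteq> {x. (w - w') \<bullet> x = 0}"
    using assms(4) by (intro span_minimal subspace_hyperplane) (auto simp: inner_diff_left)
  moreover have "w - w' \<in> span T" using assms subspace_E by (simp add: subspace_diff)
  ultimately have "(w - w') \<bullet> (w - w') = 0" by blast
  then show ?thesis by simp
qed

section \<open>Polar bodies and basic solutions\<close>

definition polar :: "'a set \<Rightarrow> 'a set" where
  "polar V = {w \<in> E. \<forall>v\<in>V. w \<bullet> v \<le> 1}"

text \<open>The basic feasible solutions of linear programming, that is, the vertices of
  \<open>polar V\<close>. The spanning condition makes such a point determined by its set of tight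
  constraints.\<close>

definition basic :: "'a set \<Rightarrow> 'a set" where
  "basic V = {w \<in> polar V. span {v \<in> V. w \<bullet> v = 1} = E}"

lemma finite_basic: assumes "finite V" shows "finite (basic V)"
proof (rule inj_on_finite)
  show "inj_on (\<lambda>w. {v \<in> V. w \<bullet> v = 1}) (basic V)"
  proof (rule inj_onI)
    fix w w' assume w: "w \<in> basic V" "w' \<in> basic V" and eq: "{v \<in> V. w \<bullet> v = 1} = {v \<in> V. w' \<bullet> v = 1}"
    show "w = w'"
      by (rule eq_on_spanning[of "{v \<in> V. w \<bullet> v = 1}"]) (use w eq in \<open>auto simp: basic_def polar_def\<close>)
  qed
  show "(\<lambda>w. {v \<in> V. w \<bullet> v = 1}) ` basic V \<subseteq> Pow V" by auto
qed (use assms in simp)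

text \<open>Among the optimal points one with the most tight constraints is basic: otherwise it can be
  moved orthogonally to its tight constraints until a new one becomes tight.\<close>

lemma lp_basic_solution:
  assumes V: "finite V" "V \<subseteq> E" and bdd: "polar V \<subseteq> D R" and c: "c \<in> E"
  shows "\<exists>w\<in>basic V. \<forall>u\<in>polar V. u \<bullet> c \<le> w \<bullet> c"
proof -
  have zero: "0 \<in> polar V" using subspace_0[OF subspace_E] by (simp add: polar_def)
  have "polar V = D R \<inter> (\<Inter>v\<in>V. {x. v \<bullet> x \<le> 1})"
    using bdd by (auto simp: polar_def inner_commute in_D)
  then have "compact (polar V)"
    by (metis compact_D closed_INT closed_halfspace_le compact_Int_closed)
  then have "\<exists>w\<in>polar V. \<forall>u\<in>polar V. u \<bullet> c \<le> w \<bullet> c"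
    using zero by (intro continuous_attains_sup continuous_intros) auto
  then obtain w0 where w0: "w0 \<in> polar V" "\<forall>u\<in>polar V. u \<bullet> c \<le> w0 \<bullet> c" by blast
  define tight where "tight w = {v \<in> V. w \<bullet> v = 1}" for w
  define M where "M w \<longleftrightarrow> w \<in> polar V \<and> (\<forall>u\<in>polar V. u \<bullet> c \<le> w \<bullet> c)" for w
  have "\<exists>w. M w \<and> (\<forall>u. M u \<longrightarrow> card (tight u) \<le> card (tight w))"
  proof (rule ex_has_greatest_nat[where P = M and k = w0 and f = "\<lambda>w. card (tight w)" and b = "Suc (card V)"])
    show "M w0" using w0 by (simp add: M_def)
    show "\<forall>u. M u \<longrightarrow> card (tight u) < Suc (card V)"
      using V(1) by (auto intro!: le_imp_less_Suc card_mono simp: tight_def)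
  qed
  then obtain w where w: "M w" "\<And>u. M u \<Longrightarrow> card (tight u) \<le> card (tight w)" by blast
  have wP: "w \<in> polar V" using w(1) by (simp add: M_def)
  have "span (tight w) = E"
  proof (rule ccontr)
    assume "span (tight w) \<noteq> E"
    moreover have tE: "tight w \<subseteq> E" using V by (auto simp: tight_def)
    ultimately obtain a where a: "a \<in> E" "a \<notin> span (tight w)" using span_subset_E by blast
    have "finite (tight w)" using V by (simp add: tight_def)
    then obtain d0 where d0: "d0 \<in> span (insert a (tight w))" "d0 \<noteq> 0" "\<forall>t\<in>tight w. d0 \<bullet> t = 0"
      using ex_orthogonal_vector a(2) by blast
    have d0E: "d0 \<in> E" using d0(1) span_subset_E[of "insert a (tight w)"] a(1) tE by auto
    \<comment> \<open>Orthogonality to the tight constraints leaves the sign free; this choice keeps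
      the objective from decreasing along \<open>d\<close>.\<close>
    define d where "d = (if d0 \<bullet> c \<ge> 0 then d0 else - d0)"
    have d: "d \<in> E" "d \<noteq> 0" "\<forall>t\<in>tight w. d \<bullet> t = 0" "d \<bullet> c \<ge> 0"
      using d0 d0E subspace_neg[OF subspace_E] by (auto simp: d_def)
    define X where "X = {v \<in> V. d \<bullet> v > 0}"
    have lineE: "w + s *\<^sub>R d \<in> E" for s
      using wP d(1) subspace_E by (simp add: polar_def subspace_add subspace_scale)
    have "X \<noteq> {}"
    proof
      assume X: "X = {}"
      have lineP: "w + s *\<^sub>R d \<in> polar V" if "s \<ge> 0" for s
      proof -
        have "(w + s *\<^sub>R d) \<bullet> v \<le> 1" if v: "v \<in> V" for v
        proof -
          have "s * (d \<bullet> v) \<le> 0" using X v \<open>s \<ge> 0\<close> by (auto simp: X_def mult_le_0_iff not_less)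
          moreover have "w \<bullet> v \<le> 1" using wP v by (auto simp: polar_def)
          ultimately show ?thesis by (simp add: inner_add_left)
        qed
        then show ?thesis using lineE by (simp add: polar_def)
      qed
      have le: "norm (w + s *\<^sub>R d) \<le> R" if "s \<ge> 0" for s
        using subsetD[OF bdd lineP[OF that]] by (simp add: in_D)
      \<comment> \<open>A ray contained in \<open>polar V\<close>, followed far enough to leave
        \<open>D R\<close>.\<close>
      define s where "s = (R + norm w + 1) / norm d"
      have "R \<ge> 0" using le[of 0] norm_ge_zero[of "w + 0 *\<^sub>R d"] by linarith
      then have "s \<ge> 0" by (simp add: s_def)
      have "norm (s *\<^sub>R d) = R + norm w + 1" using d(2) \<open>R \<ge> 0\<close> by (simp add: s_def)
      moreover have "norm (s *\<^sub>R d) \<le> norm (w + s *\<^sub>R d) + norm w"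
        using norm_triangle_ineq4[of "w + s *\<^sub>R d" w] by simp
      ultimately show False using le[OF \<open>s \<ge> 0\<close>] by linarith
    qed
    have fX: "finite X" using V by (simp add: X_def)
    define s where "s = Min ((\<lambda>v. (1 - w \<bullet> v) / (d \<bullet> v)) ` X)"
    have "s \<in> (\<lambda>v. (1 - w \<bullet> v) / (d \<bullet> v)) ` X"
      unfolding s_def using fX \<open>X \<noteq> {}\<close> by (intro Min_in) auto
    then obtain v0 where v0: "v0 \<in> X" "s = (1 - w \<bullet> v0) / (d \<bullet> v0)" by blast
    have smin: "s \<le> (1 - w \<bullet> v) / (d \<bullet> v)" if "v \<in> X" for v
      unfolding s_def using fX that by (intro Min_le) auto
    have s0: "s \<ge> 0" using v0 wP by (auto simp: X_def polar_def)
    define u where "u = w + s *\<^sub>R d"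
    have uv: "u \<bullet> v = w \<bullet> v + s * (d \<bullet> v)" for v by (simp add: u_def inner_add_left)
    have uP: "u \<in> polar V"
    proof -
      have "u \<bullet> v \<le> 1" if v: "v \<in> V" for v
      proof (cases "v \<in> X")
        case True
        then show ?thesis using smin[OF True] by (simp add: uv X_def field_simps)
      next
        case False
        then have "s * (d \<bullet> v) \<le> 0" using v s0 by (auto simp: X_def mult_le_0_iff not_less)
        moreover have "w \<bullet> v \<le> 1" using wP v by (auto simp: polar_def)
        ultimately show ?thesis by (simp add: uv)
      qed
      then show ?thesis using lineE by (simp add: polar_def u_def)
    qed
    have "w \<bullet> c \<le> u \<bullet> c" using s0 d(4) by (simp add: uv)
    then have Mu: "M u" using w(1) uP unfolding M_def by (meson order_trans)
    have "tight w \<subseteq> tight u" using d(3) by (auto simp: tight_def uv)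
    moreover have "v0 \<in> tight u" using v0 by (simp add: tight_def uv X_def)
    moreover have "v0 \<notin> tight w" using d(3) v0(1) by (force simp: X_def)
    ultimately have "tight w \<subset> tight u" by blast
    then have "card (tight w) < card (tight u)"
      using V(1) by (intro psubset_card_mono) (simp_all add: tight_def)
    then show False using w(2)[OF Mu] by simp
  qed
  then have "w \<in> basic V" using wP by (simp add: basic_def tight_def)
  then show ?thesis using w(1) by (auto simp: M_def)
qed

lemma polar_bounded:
  assumes "D 1 \<subseteq> convex hull V" shows "polar V \<subseteq> D 1"
proof
  fix w assume w: "w \<in> polar V"
  have "convex hull V \<subseteq> {x. w \<bullet> x \<le> 1}"
    using w by (intro hull_minimal convex_halfspace_le) (auto simp: polar_def)
  moreover have "(1 / norm w) *\<^sub>R w \<in> D 1"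
    using w subspace_scale[OF subspace_E] by (cases "w = 0") (auto simp: in_D polar_def)
  ultimately have "w \<bullet> ((1 / norm w) *\<^sub>R w) \<le> 1" using assms by blast
  then have "norm w \<le> 1"
    by (cases "w = 0") (simp_all add: dot_square_norm power2_eq_square)
  then show "w \<in> D 1" using w by (simp add: in_D polar_def)
qed

text \<open>A bipolar theorem with finitely many constraints: a point outside the hull is cut off by
  some \<open>w0\<close> in \<open>polar V\<close>, obtained from the nearest point, and optimising
  over \<open>polar V\<close> replaces \<open>w0\<close> by a basic point with at least the same
  value.\<close>

lemma hull_eq_polar_basic:
  assumes V: "finite V" "V \<subseteq> E" and D: "D 1 \<subseteq> convex hull V"
  shows "convex hull V = polar (basic V)"
proof (rule antisym)
  have "convex hull V \<subseteq> E" using V subspace_E by (intro hull_minimal subspace_imp_convex)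
  moreover have "x \<bullet> w \<le> 1" if "w \<in> basic V" "x \<in> convex hull V" for w x
  proof -
    have "convex hull V \<subseteq> {x. w \<bullet> x \<le> 1}"
      using that(1) by (intro hull_minimal convex_halfspace_le) (auto simp: basic_def polar_def)
    then show ?thesis using that(2) by (auto simp: inner_commute)
  qed
  ultimately show "convex hull V \<subseteq> polar (basic V)" by (auto simp: polar_def)
  have b: "body (convex hull V)"
    using V D \<open>convex hull V \<subseteq> E\<close> body_D[of 1] by (auto simp: body_def finite_imp_compact_convex_hull)
  show "polar (basic V) \<subseteq> convex hull V"
  proof
    fix x assume x: "x \<in> polar (basic V)"
    then have xE: "x \<in> E" by (simp add: polar_def)
    obtain p where p: "p \<in> convex hull V" "\<And>q. q \<in> convex hull V \<Longrightarrow> (x - p) \<bullet> (q - p) \<le> 0"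
      using nearest_point[OF b] by blast
    show "x \<in> convex hull V"
    proof (rule ccontr)
      assume nx: "x \<notin> convex hull V"
      define d where "d = x - p"
      have d0: "d \<noteq> 0" using nx p(1) by (auto simp: d_def)
      have dE: "d \<in> E" using p(1) b xE subspace_E by (auto simp: d_def body_def subspace_diff)
      have dq: "d \<bullet> q \<le> d \<bullet> p" if "q \<in> convex hull V" for q
        using p(2)[OF that] by (simp add: d_def inner_diff_right)
      have "(1 / norm d) *\<^sub>R d \<in> D 1" using d0 dE subspace_scale[OF subspace_E] by (auto simp: in_D)
      then have "d \<bullet> ((1 / norm d) *\<^sub>R d) \<le> d \<bullet> p" using dq D by blast
      moreover have "d \<bullet> ((1 / norm d) *\<^sub>R d) = norm d"
        using d0 by (simp add: dot_square_norm power2_eq_square)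
      \<comment> \<open>This is where the unit ball inside the hull is used: the separating
        hyperplane misses the origin and can be normalised to level 1.\<close>
      ultimately have dp: "d \<bullet> p > 0" using d0 by (metis less_le_trans zero_less_norm_iff)
      define w0 where "w0 = (1 / (d \<bullet> p)) *\<^sub>R d"
      have "w0 \<bullet> v \<le> 1" if "v \<in> V" for v
        using dq[of v] hull_inc[OF that] dp by (simp add: w0_def)
      then have w0: "w0 \<in> polar V" using dE subspace_scale[OF subspace_E] by (simp add: polar_def w0_def)
      have "d \<bullet> x - d \<bullet> p = d \<bullet> d" by (simp add: d_def inner_diff_right)
      then have "d \<bullet> x > d \<bullet> p" using d0 by (metis diff_gt_0_iff_gt inner_gt_zero_iff)
      then have "w0 \<bullet> x > 1" using dp by (simp add: w0_def)
      moreover obtain w where "w \<in> basic V" "\<forall>u\<in>polar V. u \<bullet> x \<le> w \<bullet> x"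
        using lp_basic_solution[OF V polar_bounded[OF D] xE] by blast
      ultimately show False using w0 x by (force simp: polar_def inner_commute)
    qed
  qed
qed

text \<open>A bounded polyhedron is a polytope: the direction from the nearest point of the hull to
  \<open>y\<close> attains its maximum over \<open>polar W\<close> at a basic point, which already
  lies in the hull, so that direction is zero.\<close>

lemma polar_eq_hull_basic:
  assumes W: "finite W" "W \<subseteq> E" and bdd: "polar W \<subseteq> D R"
  shows "polar W = convex hull (basic W)"
proof (rule antisym)
  have "convex (polar W)"
  proof -
    have "polar W = E \<inter> (\<Inter>v\<in>W. {x. v \<bullet> x \<le> 1})" by (auto simp: polar_def inner_commute)
    then show ?thesis
      by (simp add: convex_Int convex_INT convex_halfspace_le subspace_imp_convex subspace_E)
  qed
  then show "convex hull (basic W) \<subseteq> polar W" by (intro hull_minimal) (auto simp: basic_def)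
  have "basic W \<noteq> {}" using lp_basic_solution[OF W bdd subspace_0[OF subspace_E]] by blast
  moreover have "convex hull (basic W) \<subseteq> E"
    by (intro hull_minimal subspace_imp_convex subspace_E) (auto simp: basic_def polar_def)
  ultimately have b: "body (convex hull (basic W))"
    using finite_basic[OF W(1)] by (auto simp: body_def finite_imp_compact_convex_hull)
  show "polar W \<subseteq> convex hull (basic W)"
  proof
    fix y assume y: "y \<in> polar W"
    obtain p where p: "p \<in> convex hull (basic W)" "\<And>q. q \<in> convex hull (basic W) \<Longrightarrow> (y - p) \<bullet> (q - p) \<le> 0"
      using nearest_point[OF b] by blast
    define d where "d = y - p"
    have dE: "d \<in> E" using p(1) b y subspace_E by (auto simp: d_def body_def polar_def subspace_diff)
    obtain x where x: "x \<in> basic W" "\<forall>u\<in>polar W. u \<bullet> d \<le> x \<bullet> d"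
      using lp_basic_solution[OF W bdd dE] by blast
    have "d \<bullet> x \<le> d \<bullet> p" using p(2)[OF hull_inc[OF x(1)]] by (simp add: d_def inner_diff_right)
    moreover have "d \<bullet> y \<le> d \<bullet> x" using bspec[OF x(2) y] by (simp add: inner_commute)
    moreover have "d \<bullet> y - d \<bullet> p = d \<bullet> d" by (simp add: d_def inner_diff_right)
    ultimately have "d \<bullet> d \<le> 0" by linarith
    then have "d = 0" by (metis inner_eq_zero_iff inner_ge_zero order_antisym)
    then show "y \<in> convex hull (basic W)" using p(1) by (simp add: d_def)
  qed
qed

lemma D_subset_polar: assumes "W \<subseteq> D 1" shows "D 1 \<subseteq> polar W"
  using D_subset_slab[of 1 id W] assms by (auto simp: slab_def polar_def in_D inner_commute)

text \<open>Let \<open>T\<close> be the constraints tight on all of \<open>F\<close> and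
  \<open>z\<close> a point of \<open>F\<close> at which the others are strict. The segment from a
  point \<open>y\<close> of the polytope that is tight on \<open>T\<close> can be prolonged slightly
  beyond \<open>z\<close>, so the face property puts \<open>y\<close> into \<open>F\<close>. Thus
  \<open>T\<close> determines \<open>F\<close>, and as \<open>F\<close> spans \<open>E\<close>, all
  members of \<open>T\<close> coincide.\<close>

lemma facet_of_polar:
  assumes W: "finite W" "W \<subseteq> D 1" and F: "facet F (polar W)"
  shows "\<exists>w\<in>W. F = polar W \<inter> {x. w \<bullet> x = 1}"
proof -
  define P where "P = polar W"
  have PE: "P \<subseteq> E" by (auto simp: P_def polar_def)
  have face: "F face_of P" "F \<noteq> {}" "adim F + 1 = n"
    using F adim_full[OF D_subset_polar[OF W(2)]] PE by (auto simp: facet_def P_def)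
  have FP: "F \<subseteq> P" and conv: "convex F" using face(1) by (auto simp: face_of_def)
  have le: "w \<bullet> x \<le> 1" if "w \<in> W" "x \<in> P" for w x using that by (auto simp: P_def polar_def inner_commute)
  define T where "T = {w \<in> W. \<forall>x\<in>F. w \<bullet> x = 1}"
  have "\<exists>z\<in>F. \<forall>w\<in>W - T. w \<bullet> z < 1"
  proof (rule convex_common_strict[OF _ conv face(2)])
    fix w assume "w \<in> W - T"
    then obtain x where "x \<in> F" "w \<bullet> x \<noteq> 1" by (auto simp: T_def)
    then show "\<exists>x\<in>F. w \<bullet> x < 1" using le[of w x] \<open>w \<in> W - T\<close> FP by force
  qed (use W le FP in auto)
  then obtain z where z: "z \<in> F" "\<And>w. w \<in> W - T \<Longrightarrow> w \<bullet> z < 1" by blast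
  have sup: "y \<in> F" if y: "y \<in> P" "\<And>w. w \<in> T \<Longrightarrow> w \<bullet> y = 1" for y
  proof (cases "y = z")
    case False
    obtain \<epsilon> where \<epsilon>: "\<epsilon> > 0" "\<forall>w\<in>W - T. \<epsilon> * (w \<bullet> z - w \<bullet> y) \<le> 1 - w \<bullet> z"
      using finite_ex_small[of "W - T" "\<lambda>w. 1 - w \<bullet> z" "\<lambda>w. w \<bullet> z - w \<bullet> y"] W z(2) by auto
    define x where "x = z + \<epsilon> *\<^sub>R (z - y)"
    have wx: "w \<bullet> x = w \<bullet> z + \<epsilon> * (w \<bullet> z - w \<bullet> y)" for w
      by (simp add: x_def inner_add_right inner_diff_right)
    have "w \<bullet> x \<le> 1" if "w \<in> W" for w
    proof (cases "w \<in> T")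
      case True
      then have "w \<bullet> z = 1" using z(1) by (simp add: T_def)
      then show ?thesis using y(2)[OF True] by (simp add: wx)
    next
      case False
      then show ?thesis using \<epsilon>(2) that by (force simp: wx)
    qed
    moreover have "x \<in> E" using y(1) z(1) FP PE subspace_E
      by (auto simp: x_def intro!: subspace_add subspace_scale subspace_diff)
    ultimately have xP: "x \<in> P" by (simp add: P_def polar_def inner_commute)
    have "z \<in> open_segment y x"
    proof -
      have "z = (1 - 1 / (1 + \<epsilon>)) *\<^sub>R y + (1 / (1 + \<epsilon>)) *\<^sub>R x"
      proof -
        have "(1 + \<epsilon>) *\<^sub>R ((1 - 1 / (1 + \<epsilon>)) *\<^sub>R y + (1 / (1 + \<epsilon>)) *\<^sub>R x) = \<epsilon> *\<^sub>R y + x"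
          using \<epsilon>(1) by (simp add: scaleR_add_right right_diff_distrib)
        also have "\<dots> = (1 + \<epsilon>) *\<^sub>R z" by (simp add: x_def algebra_simps)
        finally show ?thesis using \<epsilon>(1) by simp
      qed
      moreover have "y \<noteq> x"
      proof
        assume "y = x"
        then have "(1 + \<epsilon>) *\<^sub>R (z - y) = 0" by (simp add: x_def algebra_simps)
        then show False using \<epsilon>(1) False by simp
      qed
      ultimately show ?thesis using \<epsilon>(1)
        unfolding in_segment by (intro conjI exI[of _ "1 / (1 + \<epsilon>)"]) auto
    qed
    then show ?thesis using face_ofD[OF face(1) _ y(1) xP z(1)] by blast
  qed (use z in simp)
  have "T \<noteq> {}"
  proof
    assume "T = {}"
    then have "F = P" using sup FP by blast
    then show False using face(3) adim_full[OF D_subset_polar[OF W(2)]] PE by (simp add: P_def)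
  qed
  then obtain w where w: "w \<in> T" by blast
  have span: "span F = E"
    using adim_hyperplane[of F w] w face FP PE by (auto simp: T_def)
  have "w' = w" if "w' \<in> T" for w'
    by (rule eq_on_spanning[OF span]) (use that w W in \<open>auto simp: T_def in_D\<close>)
  then have "T = {w}" using w by blast
  then have "F = P \<inter> {x. w \<bullet> x = 1}" using sup FP by (auto simp: T_def)
  then show ?thesis using w by (auto simp: T_def P_def)
qed

lemma card_facets_polar_le:
  assumes W: "finite W" "W \<subseteq> D 1"
  shows "finite {F. facet F (polar W)}" "card {F. facet F (polar W)} \<le> card W"
proof -
  have "{F. facet F (polar W)} \<subseteq> (\<lambda>w. polar W \<inter> {x. w \<bullet> x = 1}) ` W"
    using facet_of_polar[OF W] by blast
  then show "finite {F. facet F (polar W)}" "card {F. facet F (polar W)} \<le> card W"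
    by (rule finite_subset[OF _ finite_imageI[OF W(1)]], rule surj_card_le[OF W(1)])
qed

text \<open>Distinct basic points cut out distinct facets, since such a facet spans \<open>E\<close>
  and determines its normal. The finiteness of the set of facets is essential, because
  \<open>card\<close> of an infinite set is 0; it follows from the polar description.\<close>

lemma card_basic_le_facets:
  assumes V: "finite V" "V \<subseteq> E" and D: "D 1 \<subseteq> convex hull V" and n: "n > 0"
  shows "card (basic V) \<le> card {F. facet F (convex hull V)}"
proof (rule card_inj_on_le)
  define P where "P = convex hull V"
  have PE: "P \<subseteq> E" unfolding P_def using V subspace_E by (intro hull_minimal subspace_imp_convex)
  define \<phi> where "\<phi> w = P \<inter> {x. w \<bullet> x = 1}" for w
  have bas: "basic V \<subseteq> D 1" using polar_bounded[OF D] by (auto simp: basic_def)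
  have span: "span (\<phi> w) = E" if w: "w \<in> basic V" for w
  proof (rule antisym)
    show "span (\<phi> w) \<subseteq> E" by (rule span_subset_E) (use PE in \<open>auto simp: \<phi>_def\<close>)
    have "{v \<in> V. w \<bullet> v = 1} \<subseteq> \<phi> w" by (auto simp: \<phi>_def P_def hull_inc)
    then show "E \<subseteq> span (\<phi> w)" using span_mono[of "{v \<in> V. w \<bullet> v = 1}" "\<phi> w"] w by (auto simp: basic_def)
  qed
  show "inj_on \<phi> (basic V)"
  proof (rule inj_onI)
    fix w w' assume w: "w \<in> basic V" "w' \<in> basic V" and eq: "\<phi> w = \<phi> w'"
    have "w \<bullet> t = w' \<bullet> t" if "t \<in> \<phi> w" for t
    proof -
      have "t \<in> \<phi> w'" using that eq by simp
      then show ?thesis using that by (simp add: \<phi>_def)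
    qed
    then show "w = w'"
      using w by (intro eq_on_spanning[OF span[OF w(1)]]) (auto simp: basic_def polar_def)
  qed
  show "\<phi> ` basic V \<subseteq> {F. facet F (convex hull V)}"
  proof clarify
    fix w assume w: "w \<in> basic V"
    have le: "w \<bullet> x \<le> 1" if "x \<in> P" for x
      using that w hull_eq_polar_basic[OF V D] by (auto simp: P_def polar_def inner_commute)
    have "\<phi> w \<noteq> {}"
    proof
      assume "\<phi> w = {}"
      then have "span {} = E" using span[OF w] by simp
      then show False using independent_card_eq_n[OF independent_empty] n by simp
    qed
    moreover have "\<phi> w face_of P"
      unfolding \<phi>_def using le by (intro face_of_Int_supporting_hyperplane_le) (auto simp: P_def)
    moreover have "adim (\<phi> w) + 1 = adim P"
    proof -
      have sub: "\<phi> w \<subseteq> E" using PE by (auto simp: \<phi>_def)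
      have one: "x \<in> \<phi> w \<Longrightarrow> w \<bullet> x = 1" for x by (simp add: \<phi>_def)
      have "adim P = n" by (rule adim_full[OF _ PE]) (simp add: P_def D)
      then show ?thesis using adim_hyperplane[OF sub \<open>\<phi> w \<noteq> {}\<close> one] span[OF w] by simp
    qed
    ultimately show "facet (\<phi> w) (convex hull V)" by (simp add: facet_def P_def)
  qed
  have "finite {F. facet F (polar (basic V))}"
    by (rule card_facets_polar_le(1)[OF finite_basic[OF V(1)] bas])
  then show "finite {F. facet F (convex hull V)}" using hull_eq_polar_basic[OF V D] by simp
qed

end

section \<open>Lebesgue measure on finitely supported sequences\<close>

text \<open>A copy of the type of points that carries the Euclidean instead of the \<open>l\<^sup>1\<close> norm.\<close>

typedef fsvec = "UNIV :: (nat \<Rightarrow>\<^sub>0 real) set"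
  morphisms pt vec ..

lemma pt_vec [simp]: "pt (vec x) = x" by (simp add: vec_inverse)

lemma vec_pt [simp]: "vec (pt x) = x" by (rule pt_inverse)

instantiation fsvec :: real_vector
begin
definition "0 = vec 0"
definition "x + y = vec (pt x + pt y)"
definition "- x = vec (- pt x)"
definition "x - y = vec (pt x - pt y)"
definition "r *\<^sub>R x = vec (r *\<^sub>R pt x)"
instance
  by standard (simp_all add: zero_fsvec_def plus_fsvec_def uminus_fsvec_def minus_fsvec_def
      scaleR_fsvec_def algebra_simps)
end

definition crd :: "fsvec \<Rightarrow> nat \<Rightarrow> real" where "crd x i = Poly_Mapping.lookup (pt x) i"

lemma lookup_scaleR: "Poly_Mapping.lookup (r *\<^sub>R x) i = r * Poly_Mapping.lookup x (i :: nat)" for x :: "nat \<Rightarrow>\<^sub>0 real"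
proof -
  have "finite {i. r *\<^sub>R Poly_Mapping.lookup x i \<noteq> 0}"
    by (rule finite_subset[OF _ finite_keys[of x]]) (auto simp: in_keys_iff)
  then show ?thesis by (simp add: scaleR_poly_mapping_def Abs_poly_mapping_inverse)
qed

lemma crd_simps [simp]:
  "crd 0 i = 0" "crd (x + y) i = crd x i + crd y i" "crd (- x) i = - crd x i"
  "crd (x - y) i = crd x i - crd y i" "crd (r *\<^sub>R x) i = r * crd x i"
  by (simp_all add: crd_def zero_fsvec_def plus_fsvec_def uminus_fsvec_def minus_fsvec_def
      scaleR_fsvec_def lookup_add lookup_minus lookup_uminus lookup_scaleR)

lemma crd_sum [simp]: "crd (sum f A) i = (\<Sum>a\<in>A. crd (f a) i)"
  by (induction A rule: infinite_finite_induct) auto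

lemma fsvec_eqI: "(\<And>i. crd x i = crd y i) \<Longrightarrow> x = y"
  by (metis crd_def poly_mapping_eqI pt_inject)

lemma finite_crd: "finite {i. crd x i \<noteq> 0}"
  unfolding crd_def by simp

instantiation fsvec :: real_inner
begin
definition "inner x y = (\<Sum>i | crd x i \<noteq> 0. crd x i * crd y i)" for x y :: fsvec
definition "norm x = sqrt (inner x x)" for x :: fsvec
definition "dist x y = norm (x - y)" for x y :: fsvec
definition "sgn x = x /\<^sub>R norm x" for x :: fsvec
definition [code del]: "(uniformity :: (fsvec \<times> fsvec) filter) = (INF e\<in>{0<..}. principal {(x, y). dist x y < e})"
definition [code del]: "open (U :: fsvec set) \<longleftrightarrow> (\<forall>x\<in>U. \<forall>\<^sub>F (x', y) in uniformity. x' = x \<longrightarrow> y \<in> U)"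

text \<open>The defining sum runs over the support of the first argument; a common finite index set
  is what makes symmetry and additivity visible.\<close>

lemma inner_fsvec_sum:
  assumes "finite S" "\<And>i. i \<notin> S \<Longrightarrow> crd x i * crd y i = 0"
  shows "inner x y = (\<Sum>i\<in>S. crd x i * crd y i)"
proof -
  have "inner x y = (\<Sum>i\<in>S \<union> {i. crd x i \<noteq> 0}. crd x i * crd y i)"
    unfolding inner_fsvec_def using assms(1) finite_crd by (intro sum.mono_neutral_left) auto
  also have "\<dots> = (\<Sum>i\<in>S. crd x i * crd y i)"
    using assms finite_crd by (intro sum.mono_neutral_right) auto
  finally show ?thesis .
qed

instance
proof
  fix x y z :: fsvec and r :: real
  show "inner x y = inner y x"
    by (subst (2) inner_fsvec_sum[of "{i. crd x i \<noteq> 0}"]) (auto simp: finite_crd inner_fsvec_def mult.commute)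
  define S where "S = {i. crd x i \<noteq> 0} \<union> {i. crd y i \<noteq> 0}"
  have S: "finite S" by (simp add: S_def finite_crd)
  show "inner (x + y) z = inner x z + inner y z"
    using S by (subst (1 2 3) inner_fsvec_sum[of S]) (auto simp: S_def sum.distrib[symmetric] distrib_right)
  show "inner (r *\<^sub>R x) y = r * inner x y"
    using S by (subst (1 2) inner_fsvec_sum[of S]) (auto simp: S_def sum_distrib_left mult.assoc)
  show "0 \<le> inner x x" unfolding inner_fsvec_def by (intro sum_nonneg) simp
  show "inner x x = 0 \<longleftrightarrow> x = 0"
  proof
    assume "inner x x = 0"
    then have "\<forall>i\<in>{i. crd x i \<noteq> 0}. crd x i * crd x i = 0"
      unfolding inner_fsvec_def by (subst (asm) sum_nonneg_eq_0_iff) (auto simp: finite_crd)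
    then show "x = 0" by (intro fsvec_eqI) auto
  qed (simp add: inner_fsvec_def)
qed (simp_all add: norm_fsvec_def dist_fsvec_def sgn_fsvec_def uniformity_fsvec_def open_fsvec_def)

end

definition ax :: "nat \<Rightarrow> fsvec" where "ax i = vec (Poly_Mapping.single i 1)"

lemma crd_ax: "crd (ax i) k = (if i = k then 1 else 0)"
  by (simp add: crd_def ax_def lookup_single when_def)

lemma inner_ax [simp]: "x \<bullet> ax i = crd x i"
  by (subst inner_fsvec_sum[of "{i}"]) (auto simp: crd_ax)

lemma norm_ax [simp]: "norm (ax i) = 1"
  by (simp add: norm_eq_sqrt_inner crd_ax)

lemma abs_crd_le: "\<bar>crd x i\<bar> \<le> norm x"
  using Cauchy_Schwarz_ineq2[of x "ax i"] by simp

definition emb :: "nat \<Rightarrow> (nat \<Rightarrow> real) \<Rightarrow> fsvec" where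
  "emb n f = (\<Sum>i<n. f i *\<^sub>R ax i)"

lemma crd_emb: "crd (emb n f) i = (if i < n then f i else 0)"
  by (simp add: emb_def crd_ax if_distrib cong: if_cong)

definition Eu :: "nat \<Rightarrow> fsvec set" where "Eu n = {x. \<forall>i\<ge>n. crd x i = 0}"

lemma emb_crd: "x \<in> Eu n \<Longrightarrow> emb n (crd x) = x"
  by (rule fsvec_eqI) (auto simp: crd_emb Eu_def)

lemma emb_in_Eu: "emb n f \<in> Eu n"
  by (auto simp: Eu_def crd_emb)

lemma subspace_Eu: "subspace (Eu n)"
  by (auto simp: subspace_def Eu_def)

lemma ex_Eu: "\<exists>n. x \<in> Eu n"
proof -
  obtain m where "\<forall>i\<in>{i. crd x i \<noteq> 0}. i \<le> m" using finite_crd[of x] finite_nat_set_iff_bounded_le by blast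
  then have "x \<in> Eu (Suc m)" by (force simp: Eu_def)
  then show ?thesis by blast
qed

lemma norm_emb_le: "norm (emb n f) \<le> (\<Sum>i<n. \<bar>f i\<bar>)"
  unfolding emb_def by (rule order_trans[OF norm_sum]) simp

lemma emb_diff: "emb n f - emb n g = emb n (\<lambda>i. f i - g i)"
  by (rule fsvec_eqI) (simp add: crd_emb)

text \<open>Finite combinations of the unit vectors with rational coefficients are dense, and balls
  of rational radius about them form a countable basis. The sort of \<open>euclid_volume\<close>
  asks for this.\<close>

instance fsvec :: second_countable_topology
proof
  define Q where "Q = (\<Union>n. emb n ` (PiE {..<n} (\<lambda>_. \<rat>)))"
  have Q: "countable Q" unfolding Q_def by (intro countable_UN countable_image countable_PiE) (auto simp: countable_rat)
  define B where "B = (\<lambda>(q, r). ball q r) ` (Q \<times> \<rat>)"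
  have cB: "countable B" unfolding B_def using Q countable_rat by (intro countable_image countable_SIGMA) auto
  have dense: "\<exists>q\<in>Q. dist q x < e" if "e > 0" for x e
  proof -
    obtain n where n: "x \<in> Eu n" using ex_Eu by blast
    define d where "d = e / (real n + 1)"
    have d: "d > 0" using that by (simp add: d_def)
    have "\<exists>q\<in>\<rat>. \<bar>q - crd x i\<bar> < d" for i
    proof -
      obtain q where "q \<in> \<rat>" "crd x i < q" "q < crd x i + d"
        using Rats_dense_in_real[of "crd x i" "crd x i + d"] d by auto
      then show ?thesis by (intro bexI[of _ q]) auto
    qed
    then obtain q where q: "\<And>i. q i \<in> \<rat>" "\<And>i. \<bar>q i - crd x i\<bar> < d" by metis
    have "restrict q {..<n} \<in> PiE {..<n} (\<lambda>_. \<rat>)" using q(1) by auto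
    then have "emb n (restrict q {..<n}) \<in> Q" unfolding Q_def by blast
    moreover have "emb n (restrict q {..<n}) = emb n q" by (rule fsvec_eqI) (simp add: crd_emb)
    moreover have "dist (emb n q) x < e"
    proof -
      have "dist (emb n q) x = norm (emb n (\<lambda>i. q i - crd x i))"
        using emb_diff[of n q "crd x"] emb_crd[OF n] by (simp add: dist_norm)
      also have "\<dots> \<le> (\<Sum>i<n. \<bar>q i - crd x i\<bar>)" by (rule norm_emb_le)
      also have "\<dots> \<le> (\<Sum>i<n. d)" using q(2) by (intro sum_mono less_imp_le)
      also have "\<dots> < e" using that by (simp add: d_def field_simps)
      finally show ?thesis .
    qed
    ultimately show ?thesis by auto
  qed
  have "topological_basis B"
  proof (rule topological_basisI)
    show "open b" if "b \<in> B" for b using that by (auto simp: B_def)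
    fix U and x :: fsvec assume "open U" "x \<in> U"
    then obtain e where e: "e > 0" "ball x e \<subseteq> U" using openE by blast
    obtain r where r: "r \<in> \<rat>" "0 < r" "r < e / 2" using Rats_dense_in_real[of 0 "e / 2"] e(1) by auto
    obtain q where q: "q \<in> Q" "dist q x < r" using dense[OF r(2)] by blast
    have "ball q r \<subseteq> ball x e"
    proof
      fix y assume "y \<in> ball q r"
      then have "dist x y < r + r" using q(2) dist_triangle[of x y q] by (simp add: dist_commute)
      then show "y \<in> ball x e" using r by simp
    qed
    moreover have "ball q r \<in> B" using q r by (auto simp: B_def)
    moreover have "x \<in> ball q r" using q by simp
    ultimately show "\<exists>b\<in>B. x \<in> b \<and> b \<subseteq> U" using e by blast
  qed
  then show "\<exists>B::fsvec set set. countable B \<and> open = generate_topology B"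
    using cB topological_basis_imp_subbasis by blast
qed

section \<open>Lebesgue measure on the span of the first n axes\<close>

abbreviation PiL :: "nat \<Rightarrow> (nat \<Rightarrow> real) measure" where
  "PiL n \<equiv> Pi\<^sub>M {..<n} (\<lambda>_. lborel)"

definition Leb :: "nat \<Rightarrow> fsvec measure" where "Leb n = distr (PiL n) borel (emb n)"

lemma measurable_emb [measurable]: "emb n \<in> borel_measurable (PiL n)"
  unfolding emb_def
proof (intro borel_measurable_sum borel_measurable_scaleR borel_measurable_const)
  fix i assume "i \<in> {..<n}"
  then have "(\<lambda>f. f i) \<in> measurable (PiL n) lborel" by (rule measurable_component_singleton)
  then show "(\<lambda>f. f i) \<in> borel_measurable (PiL n)" by simp
qed

text \<open>A product measure is determined by its values on boxes, so rescaling by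
  \<open>1 / k ^ n\<close> the image under the coordinatewise map gives the product measure back.
  Translations are the case \<open>k = 1\<close>, dilations the case \<open>k = r\<close>.\<close>

lemma emeasure_PiL_map:
  fixes h :: "nat \<Rightarrow> real \<Rightarrow> real"
  assumes k: "k > 0" and h: "\<And>i. h i \<in> borel_measurable borel"
    and hk: "\<And>i A. A \<in> sets borel \<Longrightarrow> emeasure lborel (h i -` A) = ennreal k * emeasure lborel A"
    and B: "B \<in> sets (PiL n)"
  shows "emeasure (PiL n) ((\<lambda>f. \<lambda>i\<in>{..<n}. h i (f i)) -` B \<inter> space (PiL n)) = ennreal (k ^ n) * emeasure (PiL n) B"
proof -
  interpret product_sigma_finite "\<lambda>_::nat. lborel :: real measure" ..
  define T where "T = (\<lambda>f::nat \<Rightarrow> real. \<lambda>i\<in>{..<n}. h i (f i))"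
  have T [measurable]: "T \<in> measurable (PiL n) (PiL n)"
    unfolding T_def
  proof (rule measurable_restrict)
    fix i assume "i \<in> {..<n}"
    then have "(\<lambda>f. f i) \<in> measurable (PiL n) lborel" by (rule measurable_component_singleton)
    then show "(\<lambda>f. h i (f i)) \<in> measurable (PiL n) lborel"
      using h[of i] by (auto intro: measurable_compose)
  qed
  define M where "M = scale_measure (ennreal (1 / k ^ n)) (distr (PiL n) (PiL n) T)"
  have "M = PiL n"
  proof (rule PiM_eqI)
    show "sets M = sets (PiL n)" by (simp add: M_def)
    fix A :: "nat \<Rightarrow> real set" assume A: "\<And>i. i \<in> {..<n} \<Longrightarrow> A i \<in> sets lborel"
    have "T -` (PiE {..<n} A) \<inter> space (PiL n) = PiE {..<n} (\<lambda>i. h i -` A i)"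
      by (auto simp: T_def space_PiM PiE_iff)
    moreover have hA: "h i -` A i \<in> sets lborel" if "i \<in> {..<n}" for i
      using measurable_sets[OF h[of i], of "A i"] A[OF that] by simp
    moreover have "PiE {..<n} A \<in> sets (PiL n)" using A by (intro sets_PiM_I_finite) auto
    ultimately have "emeasure (distr (PiL n) (PiL n) T) (PiE {..<n} A) = emeasure (PiL n) (PiE {..<n} (\<lambda>i. h i -` A i))"
      by (simp add: emeasure_distr)
    also have "\<dots> = (\<Prod>i<n. emeasure lborel (h i -` A i))"
      by (rule emeasure_PiM[OF _ hA]) auto
    also have "\<dots> = (\<Prod>i<n. ennreal k * emeasure lborel (A i))"
      using A by (intro prod.cong refl hk) auto
    also have "\<dots> = ennreal (k ^ n) * (\<Prod>i<n. emeasure lborel (A i))"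
      using k by (simp add: prod.distrib ennreal_power)
    finally show "emeasure M (PiE {..<n} A) = (\<Prod>i\<in>{..<n}. emeasure lborel (A i))"
      using k by (simp add: M_def mult.assoc[symmetric] ennreal_mult'[symmetric])
  qed simp
  then have "emeasure (PiL n) B = ennreal (1 / k ^ n) * emeasure (PiL n) (T -` B \<inter> space (PiL n))"
    using B T by (metis M_def emeasure_distr emeasure_scale_measure)
  then show ?thesis
    using k by (simp add: T_def mult.assoc[symmetric] ennreal_mult'[symmetric])
qed

lemma emeasure_Leb: "A \<in> sets borel \<Longrightarrow> emeasure (Leb n) A = emeasure (PiL n) (emb n -` A \<inter> space (PiL n))"
  unfolding Leb_def by (rule emeasure_distr[OF measurable_emb])

lemma closed_Eu: "closed (Eu n)"
proof -
  have "Eu n = (\<Inter>i\<in>{n..}. {x. ax i \<bullet> x = 0})"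
    by (auto simp: Eu_def inner_commute[of "ax _"])
  then show ?thesis by (simp add: closed_INT closed_hyperplane)
qed

lemma continuous_emb: "continuous_on UNIV (emb n)"
  unfolding emb_def by (intro continuous_intros continuous_on_product_coordinates)

text \<open>In the infinite-dimensional ambient space closed and bounded would not suffice. The cube
  of sequences is compact by Tychonoff's theorem, and the ball is a closed subset of its continuous
  image.\<close>

lemma compact_Eu_cball: "compact (Eu n \<inter> cball 0 1)"
proof -
  define K where "K = PiE UNIV (\<lambda>_::nat. {-1..1::real})"
  have "compactin (product_topology (\<lambda>_. euclidean) UNIV) K"
    unfolding K_def by (subst compactin_PiE) auto
  then have "compact K" by (simp add: euclidean_product_topology)
  then have "compact (emb n ` K)"
    using continuous_on_subset[OF continuous_emb subset_UNIV] by (rule compact_continuous_image[rotated])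
  moreover have "Eu n \<inter> cball 0 1 \<subseteq> emb n ` K"
  proof
    fix x assume x: "x \<in> Eu n \<inter> cball 0 1"
    then have "\<bar>crd x i\<bar> \<le> 1" for i using abs_crd_le[of x i] by simp
    then have "crd x \<in> K" by (auto simp: K_def abs_le_iff minus_le_iff)
    then show "x \<in> emb n ` K" using emb_crd[of x n] x by (metis IntD1 imageI)
  qed
  ultimately have "compact (emb n ` K \<inter> (Eu n \<inter> cball 0 1))"
    by (intro compact_Int_closed closed_Int closed_Eu closed_cball)
  then show ?thesis using \<open>Eu n \<inter> cball 0 1 \<subseteq> emb n ` K\<close> by (simp add: Int_absorb1)
qed

lemma euclid_volume_dim_Leb: "euclid_volume_dim (Eu n) (Leb n) n"
proof
  show "subspace (Eu n)" by (rule subspace_Eu)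
  show "compact (Eu n \<inter> cball 0 1)" by (rule compact_Eu_cball)
  show "sets (Leb n) = sets borel" by (simp add: Leb_def)
  show "AE x in Leb n. x \<in> Eu n"
    unfolding Leb_def using closed_Eu[of n] by (subst AE_distr_iff) (auto simp: emb_in_Eu)
next
  fix a assume a: "a \<in> Eu n"
  show "distr (Leb n) borel ((+) a) = Leb n"
  proof (rule measure_eqI)
    fix A assume "A \<in> sets (distr (Leb n) borel ((+) a))"
    then have A: "A \<in> sets borel" by simp
    have A': "(+) a -` A \<in> sets borel"
      using measurable_sets[of "(+) a" borel borel A] A by simp
    have "emb n (\<lambda>i\<in>{..<n}. crd a i + f i) = a + emb n f" for f
      using a by (intro fsvec_eqI) (auto simp: crd_emb Eu_def)
    then have eq: "emb n -` ((+) a -` A) \<inter> space (PiL n)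
        = (\<lambda>f. \<lambda>i\<in>{..<n}. crd a i + f i) -` (emb n -` A \<inter> space (PiL n)) \<inter> space (PiL n)"
      by (auto simp: space_PiM)
    have "emeasure (distr (Leb n) borel ((+) a)) A = emeasure (Leb n) ((+) a -` A)"
      using A by (subst emeasure_distr) (auto simp: Leb_def)
    also have "\<dots> = ennreal (1 ^ n) * emeasure (PiL n) (emb n -` A \<inter> space (PiL n))"
      unfolding emeasure_Leb[OF A'] eq
    proof (rule emeasure_PiL_map)
      show "emeasure lborel ((+) (crd a i) -` S) = ennreal 1 * emeasure lborel S" if "S \<in> sets borel" for i S
        using emeasure_distr[of "(+) (crd a i)" lborel borel S] that lborel_distr_plus[of "crd a i"] by simp
    qed (use A in \<open>auto intro: measurable_sets\<close>)
    finally show "emeasure (distr (Leb n) borel ((+) a)) A = emeasure (Leb n) A"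
      by (simp add: emeasure_Leb[OF A])
  qed (simp add: Leb_def)
next
  fix r :: real and A assume r: "0 < r" and A: "A \<in> sets (borel :: fsvec measure)"
  have im: "(*\<^sub>R) r ` A = (*\<^sub>R) (1 / r) -` A"
    using r by (force simp: image_iff)
  have A': "(*\<^sub>R) r ` A \<in> sets borel"
    unfolding im using measurable_sets[of "(*\<^sub>R) (1 / r)" borel borel A] A by simp
  have "emb n (\<lambda>i\<in>{..<n}. f i / r) = (1 / r) *\<^sub>R emb n f" for f
    by (intro fsvec_eqI) (auto simp: crd_emb)
  then have eq: "emb n -` ((*\<^sub>R) r ` A) \<inter> space (PiL n)
      = (\<lambda>f. \<lambda>i\<in>{..<n}. f i / r) -` (emb n -` A \<inter> space (PiL n)) \<inter> space (PiL n)"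
    unfolding im by (auto simp: space_PiM)
  show "emeasure (Leb n) ((*\<^sub>R) r ` A) = ennreal (r ^ n) * emeasure (Leb n) A"
    unfolding emeasure_Leb[OF A'] emeasure_Leb[OF A] eq
  proof (rule emeasure_PiL_map[OF r])
    fix S :: "real set" assume S: "S \<in> sets borel"
    have "emeasure lborel ((\<lambda>x. x / r) -` S) = emeasure (distr lborel borel ((*) (1 / r))) S"
      using S by (subst emeasure_distr) (auto simp: vimage_def)
    also have "\<dots> = emeasure (density lborel (\<lambda>_. ennreal r)) S"
      using r by (subst lborel_distr_mult) auto
    also have "\<dots> = ennreal r * emeasure lborel S" using S by (simp add: emeasure_density_const)
    finally show "emeasure lborel ((\<lambda>x. x / r) -` S) = ennreal r * emeasure lborel S" .
  qed (use A in \<open>auto intro: measurable_sets\<close>)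
next
  interpret product_sigma_finite "\<lambda>_::nat. lborel :: real measure" ..
  \<comment> \<open>A side length for which the cube lies in the unit ball, because the norm is at
    most the sum of the absolute coordinates.\<close>
  define c where "c = 1 / (real n + 1)"
  have c: "c > 0" by (simp add: c_def)
  have "PiE {..<n} (\<lambda>_. {0..c}) \<subseteq> emb n -` cball 0 1 \<inter> space (PiL n)"
  proof
    fix f assume f: "f \<in> PiE {..<n} (\<lambda>_. {0..c})"
    have "norm (emb n f) \<le> (\<Sum>i<n. \<bar>f i\<bar>)" by (rule norm_emb_le)
    also have "\<dots> \<le> (\<Sum>i<n. c)" using f by (intro sum_mono) (auto simp: PiE_iff)
    also have "\<dots> \<le> 1" by (simp add: c_def)
    finally show "f \<in> emb n -` cball 0 1 \<inter> space (PiL n)" using f by (auto simp: space_PiM PiE_iff)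
  qed
  then have "emeasure (PiL n) (PiE {..<n} (\<lambda>_. {0..c})) \<le> emeasure (Leb n) (cball 0 1)"
    by (subst emeasure_Leb) (auto intro!: emeasure_mono measurable_sets[OF measurable_emb])
  moreover have "emeasure (PiL n) (PiE {..<n} (\<lambda>_. {0..c})) = ennreal (c ^ n)"
    using c by (subst emeasure_PiM) (auto simp: ennreal_power)
  ultimately show "0 < emeasure (Leb n) (cball 0 1)"
    using c by (metis ennreal_less_zero_iff less_le_trans zero_less_power)
next
  interpret product_sigma_finite "\<lambda>_::nat. lborel :: real measure" ..
  have "emb n -` cball 0 1 \<inter> space (PiL n) \<subseteq> PiE {..<n} (\<lambda>_. {-1..1})"
  proof
    fix f assume f: "f \<in> emb n -` cball 0 1 \<inter> space (PiL n)"
    have "\<bar>f i\<bar> \<le> 1" if "i < n" for i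
      using abs_crd_le[of "emb n f" i] that f by (simp add: crd_emb)
    then show "f \<in> PiE {..<n} (\<lambda>_. {-1..1})" using f by (auto simp: space_PiM PiE_iff abs_le_iff minus_le_iff)
  qed
  then have "emeasure (Leb n) (cball 0 1) \<le> emeasure (PiL n) (PiE {..<n} (\<lambda>_. {-1..1}))"
    by (subst emeasure_Leb) (auto intro!: emeasure_mono sets_PiM_I_finite)
  also have "\<dots> = 2 ^ n"
    by (subst emeasure_PiM) auto
  also have "\<dots> < \<infinity>" by (simp add: power_less_top_ennreal)
  finally show "emeasure (Leb n) (cball 0 1) < \<infinity>" .
next
  have inj: "inj_on ax {..<n}"
    by (rule inj_onI) (metis crd_ax zero_neq_one)
  have "pairwise orthogonal (ax ` {..<n})"
    by (auto simp: pairwise_def orthogonal_def crd_ax)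
  moreover have "0 \<notin> ax ` {..<n}" using norm_ax by (metis imageE norm_zero zero_neq_one)
  ultimately have "independent (ax ` {..<n})" by (rule pairwise_orthogonal_independent)
  moreover have "span (ax ` {..<n}) = Eu n"
  proof (rule antisym)
    show "span (ax ` {..<n}) \<subseteq> Eu n" by (rule span_minimal[OF _ subspace_Eu]) (auto simp: Eu_def crd_ax)
    have "emb n f \<in> span (ax ` {..<n})" for f
      unfolding emb_def by (intro span_sum span_scale span_base) auto
    then show "Eu n \<subseteq> span (ax ` {..<n})" using emb_crd by (metis subsetI)
  qed
  ultimately show "\<exists>C. finite C \<and> independent C \<and> span C = Eu n \<and> card C = n"
    using inj by (intro exI[of _ "ax ` {..<n}"]) (auto simp: card_image)
qed

section \<open>Deviation bounds\<close>

text \<open>A converse of Bernoulli's inequality up to the factor 1/2, valid while k s is at most 1.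
  It produces the factor j in the lower bounds.\<close>

lemma one_minus_power_ge:
  fixes s :: real
  assumes "0 \<le> s" "real k * s \<le> 1"
  shows "real k * s / 2 \<le> 1 - (1 - s) ^ k"
  using assms
proof (induction k)
  case (Suc k)
  have ks: "real k * s \<le> 1" using Suc.prems mult_right_mono[of "real k" "real (Suc k)" s] by simp
  have s1: "s \<le> 1" using Suc.prems mult_right_mono[of 1 "real (Suc k)" s] by simp
  have "(1 - s) * (1 - s) ^ k \<le> (1 - s) * (1 - real k * s / 2)"
    using Suc.IH[OF Suc.prems(1) ks] s1 by (intro mult_left_mono) auto
  also have "\<dots> = 1 - real (Suc k) * s / 2 - s / 2 * (1 - real k * s)"
    by (simp add: field_simps)
  also have "\<dots> \<le> 1 - real (Suc k) * s / 2"
    using ks Suc.prems(1) by simp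
  finally show ?case by simp
qed simp

text \<open>Pads an enumeration of \<open>V\<close> by a dummy \<open>z\<close>, so that a set of at
  most \<open>N\<close> points is listed by the first \<open>N\<close> entries of an infinite
  sequence; the bound on \<open>range v\<close> places that sequence in
  \<open>D_seqs\<close>.\<close>

lemma finite_enum:
  assumes "finite V" "card V \<le> N"
  shows "\<exists>v :: nat \<Rightarrow> 'b. v ` {..<N} \<subseteq> insert z V \<and> V \<subseteq> v ` {..<N} \<and> range v \<subseteq> insert z V"
proof -
  obtain f where f: "bij_betw f {..<card V} V"
    using ex_bij_betw_nat_finite[OF assms(1)] by (auto simp: atLeast0LessThan)
  define v where "v i = (if i < card V then f i else z)" for i
  have "range v \<subseteq> insert z V" using f by (auto simp: v_def bij_betw_def)
  moreover have "V \<subseteq> v ` {..<N}"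
  proof
    fix x assume "x \<in> V"
    then obtain i where "i < card V" "x = f i" using f by (auto simp: bij_betw_def)
    then show "x \<in> v ` {..<N}" using assms(2) by (intro image_eqI[of _ _ i]) (auto simp: v_def)
  qed
  ultimately show ?thesis by (intro exI[of _ v]) auto
qed

text \<open>A generating set of least cardinality has no redundant point, so each of its points is
  extreme; conversely the extreme points of a hull are among its generators.\<close>

lemma polytope_eq_hull_extreme:
  fixes P :: "'a::real_normed_vector set"
  assumes "polytope P"
  shows "finite {v. v extreme_point_of P}" "P = convex hull {v. v extreme_point_of P}"
proof -
  have "\<exists>k. \<exists>V. finite V \<and> P = convex hull V \<and> card V = k"
    using assms by (auto simp: polytope_def)
  then obtain V where V: "finite V" "P = convex hull V"
    "card V = (LEAST k. \<exists>V. finite V \<and> P = convex hull V \<and> card V = k)"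
    using LeastI_ex[of "\<lambda>k. \<exists>V. finite V \<and> P = convex hull V \<and> card V = k"] by blast
  have "v extreme_point_of P" if v: "v \<in> V" for v
  proof -
    have "v \<notin> convex hull (V - {v})"
    proof
      assume "v \<in> convex hull (V - {v})"
      then have "convex hull V = convex hull (V - {v})"
        using hull_redundant[of v convex "V - {v}"] v by (simp add: insert_absorb)
      then have "card V \<le> card (V - {v})"
        unfolding V(3) using V by (intro Least_le) auto
      then show False using V(1) v by (metis card_Diff1_less not_le)
    qed
    then have "v extreme_point_of (convex hull (insert v (V - {v})))"
      using V(1) by (intro extreme_point_of_convex_hull_insert) auto
    then show ?thesis using v V(2) by (simp add: insert_absorb)
  qed
  then have "{v. v extreme_point_of P} = V"
    using extreme_point_of_convex_hull V(2) by blast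
  then show "finite {v. v extreme_point_of P}" "P = convex hull {v. v extreme_point_of P}"
    using V by auto
qed

section \<open>Inscribed and circumscribed polytopes and their Steiner coefficients\<close>

context euclid_volume_dim
begin

definition innerP :: "nat \<Rightarrow> 'a set set" where
  "innerP N = {P. polytope P \<and> P \<noteq> {} \<and> P \<subseteq> D 1 \<and> card {v. v extreme_point_of P} \<le> N}"

definition outerP :: "nat \<Rightarrow> 'a set set" where
  "outerP N = {P. polytope P \<and> P \<subseteq> E \<and> D 1 \<subseteq> P \<and> card {F. facet F P} \<le> N}"

lemma innerP_hull:
  assumes "P \<in> innerP N" shows "\<exists>v\<in>D_seqs. P = convex hull (v ` {..<N})"
proof -
  define V where "V = {v. v extreme_point_of P}"
  have P: "polytope P" "P \<noteq> {}" "P \<subseteq> D 1" "card V \<le> N" using assms by (auto simp: innerP_def V_def)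
  note V = polytope_eq_hull_extreme[OF P(1), folded V_def]
  have VD: "V \<subseteq> D 1" using P(3) by (auto simp: V_def extreme_point_of_def)
  have "V \<noteq> {}" using V(2) P(2) by auto
  then obtain z where z: "z \<in> V" by blast
  then obtain v :: "nat \<Rightarrow> 'a" where v: "v ` {..<N} \<subseteq> insert z V" "V \<subseteq> v ` {..<N}" "range v \<subseteq> insert z V"
    using finite_enum[OF V(1) P(4), of z] by blast
  then have "v ` {..<N} = V" "range v \<subseteq> D 1" using z VD by auto
  then show ?thesis using V(2) by (intro bexI[of _ v]) (auto simp: D_seqs_def)
qed

lemma hull_innerP:
  assumes "finite V" "V \<noteq> {}" "card V \<le> N" "V \<subseteq> D 1"
  shows "convex hull V \<in> innerP N"
proof -
  have "{v. v extreme_point_of (convex hull V)} \<subseteq> V" using extreme_point_of_convex_hull by blast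
  then have "card {v. v extreme_point_of (convex hull V)} \<le> card V" by (rule card_mono[OF assms(1)])
  moreover have "convex hull V \<subseteq> D 1" by (intro hull_minimal assms convex_D)
  ultimately show ?thesis using assms by (auto simp: innerP_def polytope_def)
qed

lemma hull_seq_innerP:
  assumes "v \<in> D_seqs" "N > 0" shows "convex hull (v ` {..<N}) \<in> innerP N"
  using assms card_image_le[of "{..<N}" v] by (intro hull_innerP) (auto simp: D_seqs_def)

lemma body_innerP: assumes "P \<in> innerP N" shows "body P"
proof -
  obtain V where "finite V" "P = convex hull V" using assms by (auto simp: innerP_def polytope_def)
  moreover have "P \<noteq> {}" "P \<subseteq> E" using assms by (auto simp: innerP_def in_D)
  ultimately show ?thesis by (auto simp: body_def finite_imp_compact_convex_hull)
qed

lemma body_outerP: assumes "P \<in> outerP N" shows "body P"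
proof -
  obtain V where "finite V" "P = convex hull V" using assms by (auto simp: outerP_def polytope_def)
  moreover have "P \<noteq> {}" "P \<subseteq> E" using assms body_D[of 1] by (auto simp: outerP_def body_def)
  ultimately show ?thesis by (auto simp: body_def finite_imp_compact_convex_hull)
qed

text \<open>The polytope is the polar of its basic points, which are at most as many as its facets.
  Padding with 0 is harmless, since the constraint belonging to the zero vector is always
  satisfied.\<close>

lemma outerP_polar:
  assumes "P \<in> outerP N" and n: "n > 0"
  shows "\<exists>w\<in>D_seqs. P = polar (w ` {..<N})"
proof -
  obtain V where V: "finite V" "P = convex hull V" using assms by (auto simp: outerP_def polytope_def)
  have P: "P \<subseteq> E" "D 1 \<subseteq> P" "card {F. facet F P} \<le> N" using assms by (auto simp: outerP_def)
  have VE: "V \<subseteq> E" using V(2) P(1) hull_subset[of V convex] by auto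
  have D: "D 1 \<subseteq> convex hull V" using P(2) V(2) by simp
  have eq: "P = polar (basic V)" using hull_eq_polar_basic[OF V(1) VE D] V(2) by simp
  have card: "card (basic V) \<le> N" using card_basic_le_facets[OF V(1) VE D n] P(3) V(2) by simp
  have BD: "basic V \<subseteq> D 1" using polar_bounded[OF D] by (auto simp: basic_def)
  obtain w :: "nat \<Rightarrow> 'a" where w: "w ` {..<N} \<subseteq> insert 0 (basic V)" "basic V \<subseteq> w ` {..<N}" "range w \<subseteq> insert 0 (basic V)"
    using finite_enum[OF finite_basic[OF V(1)] card, of 0] by blast
  have "polar (w ` {..<N}) = polar (basic V)"
  proof (rule antisym)
    show "polar (w ` {..<N}) \<subseteq> polar (basic V)" using w(2) by (auto simp: polar_def)
    have "polar (basic V) \<subseteq> polar (insert 0 (basic V))" by (auto simp: polar_def)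
    also have "\<dots> \<subseteq> polar (w ` {..<N})" using w(1) unfolding polar_def by blast
    finally show "polar (basic V) \<subseteq> polar (w ` {..<N})" .
  qed
  moreover have "0 \<in> D 1" using subspace_0[OF subspace_E] by (simp add: in_D)
  then have "w \<in> D_seqs" using w(3) BD by (auto simp: D_seqs_def)
  ultimately show ?thesis using eq by auto
qed

lemma polar_outerP:
  assumes W: "finite W" "card W \<le> N" "W \<subseteq> D 1" and bdd: "polar W \<subseteq> D R"
  shows "polar W \<in> outerP N"
proof -
  have WE: "W \<subseteq> E" using W by (auto simp: in_D)
  have "polytope (polar W)"
    unfolding polytope_def using polar_eq_hull_basic[OF W(1) WE bdd] finite_basic[OF W(1)] by blast
  moreover have "card {F. facet F (polar W)} \<le> N"
    using card_facets_polar_le(2)[OF W(1,3)] W(2) by simp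
  ultimately show ?thesis
    using D_subset_polar[OF W(3)] by (auto simp: outerP_def polar_def)
qed

text \<open>Here \<open>r\<close> is N^(-1/(n-1)), the typical distance between N points on the
  sphere. The bound on \<open>n * r\<^sup>2\<close> keeps powers with exponents up to
  \<open>n\<close> in the range where they are linear up to a constant factor, and it also yields
  \<open>18 * r < 1\<close>.\<close>

context
  fixes N :: nat and r :: real
  assumes n2: "n \<ge> 2" and r: "0 < r" "r ^ (n - 1) * N = 1" "n * r\<^sup>2 \<le> 1 / 1000"
begin

lemma r_small: "18 * r < 1"
proof -
  have "2 * r\<^sup>2 \<le> real n * r\<^sup>2" using n2 by (intro mult_right_mono) auto
  then have "(18 * r)\<^sup>2 < 1\<^sup>2" using r(3) by (simp add: power_mult_distrib)
  then show ?thesis by (rule power2_less_imp_less) simp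
qed

lemma N_pos: "N > 0" using r(2) by (cases N) auto

lemma packing_numbers:
  obtains T where "separated (4 * (r / 16)) T" "T \<noteq> {}" "2 * N \<le> card T"
  using ex_packing[OF n2 r(1) _ r(2)] r_small r(1) by auto

text \<open>Caps with \<rho> = r/16 correspond to the smaller radius 1 - r^2/512. The packing
  argument keeps half of the gain and \<open>one_minus_power_ge\<close> half of that, so 2048 = 512
  * 2 * 2.\<close>

lemma gain_lower:
  assumes "i \<le> n"
  shows "real (n - i) * r\<^sup>2 / 2048 \<le> (1 - (1 - (r / 16)\<^sup>2 / 2) ^ (n - i)) / 2"
proof -
  have "real (n - i) * ((r / 16)\<^sup>2 / 2) \<le> real n * r\<^sup>2"
    by (intro mult_mono) (auto simp: power_divide)
  then have "real (n - i) * ((r / 16)\<^sup>2 / 2) \<le> 1" using r(3) by linarith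
  then have "real (n - i) * ((r / 16)\<^sup>2 / 2) / 2 \<le> 1 - (1 - (r / 16)\<^sup>2 / 2) ^ (n - i)"
    by (intro one_minus_power_ge) auto
  then show ?thesis by (simp add: power_divide)
qed

lemma inner_deviation_ge:
  assumes P: "P \<in> innerP N" and i: "i \<le> n"
  shows "real (n - i) * r\<^sup>2 / 2048 * steiner_coeff (D 1) i \<le> steiner_coeff (D 1) i - steiner_coeff P i"
proof -
  obtain T where T: "separated (4 * (r / 16)) T" "T \<noteq> {}" "2 * N \<le> card T" by (rule packing_numbers)
  obtain v where v: "v \<in> D_seqs" "P = convex hull (v ` {..<N})" using innerP_hull[OF P] by blast
  define b where "b = (1 - (r / 16)\<^sup>2 / 2) ^ (n - i)"
  have "steiner_coeff P i \<le> (1 + b) / 2 * steiner_coeff (D 1) i"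
    unfolding v(2) b_def
  proof (rule inner_upper)
    show "v ` {..<N} \<subseteq> D 1" using v(1) by (auto simp: D_seqs_def)
  qed (use T N_pos r(1) r_small i in \<open>auto simp: separated_def\<close>)
  moreover have "real (n - i) * r\<^sup>2 / 2048 * steiner_coeff (D 1) i
      \<le> (1 - b) / 2 * steiner_coeff (D 1) i"
    unfolding b_def using gain_lower[OF i] steiner_coeff_D1_pos[OF i] by (intro mult_right_mono) auto
  moreover have "(1 + b) / 2 * steiner_coeff (D 1) i
      = steiner_coeff (D 1) i - (1 - b) / 2 * steiner_coeff (D 1) i" by (simp add: field_simps)
  ultimately show ?thesis by linarith
qed

lemma outer_deviation_ge:
  assumes P: "P \<in> outerP N" and i: "i \<le> n"
  shows "real (n - i) * r\<^sup>2 / 2048 * steiner_coeff (D 1) i \<le> steiner_coeff P i - steiner_coeff (D 1) i"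
proof -
  obtain T where T: "separated (4 * (r / 16)) T" "T \<noteq> {}" "2 * N \<le> card T" by (rule packing_numbers)
  obtain w where w: "w \<in> D_seqs" "P = polar (w ` {..<N})" using outerP_polar[OF P] n2 by auto
  define b where "b = (1 - (r / 16)\<^sup>2 / 2) ^ (n - i)"
  have r16: "0 < r / 16" "r / 16 < 1" using r(1) r_small by auto
  have b: "0 < b" "b \<le> 1" using rho_bounds[OF r16] by (auto simp: b_def intro!: power_le_one)
  have "(1 + b) / 2 * steiner_coeff (D 1) i \<le> b * steiner_coeff P i"
    unfolding b_def
  proof (rule outer_lower[OF _ _ _ T(1,2) r16 i body_outerP[OF P]])
    show "w ` {..<N} \<subseteq> D 1" using w(1) by (auto simp: D_seqs_def)
    show "x \<in> P" if "x \<in> D (1 / (1 - (r / 16)\<^sup>2 / 2))" "\<And>i. i \<in> {..<N} \<Longrightarrow> w i \<bullet> x \<le> 1" for x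
      using that by (auto simp: w(2) polar_def in_D inner_commute)
  qed (use T(3) in auto)
  moreover have "b * steiner_coeff (D 1) i \<le> b * steiner_coeff P i"
    using b P by (intro mult_left_mono steiner_coeff_mono body_D body_outerP[OF P] i) (auto simp: outerP_def)
  moreover have "steiner_coeff (D 1) i \<le> steiner_coeff P i"
    using P by (intro steiner_coeff_mono body_D body_outerP[OF P] i) (auto simp: outerP_def)
  then have "b * (steiner_coeff P i - steiner_coeff (D 1) i) \<le> 1 * (steiner_coeff P i - steiner_coeff (D 1) i)"
    using b by (intro mult_right_mono) auto
  ultimately have "(1 - b) / 2 * steiner_coeff (D 1) i \<le> steiner_coeff P i - steiner_coeff (D 1) i"
    by (simp add: field_simps)
  moreover have "real (n - i) * r\<^sup>2 / 2048 * steiner_coeff (D 1) i \<le> (1 - b) / 2 * steiner_coeff (D 1) i"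
    unfolding b_def using gain_lower[OF i] steiner_coeff_D1_pos[OF i] by (intro mult_right_mono) auto
  ultimately show ?thesis by linarith
qed

text \<open>A net of spacing 18 r costs \<eta> = 162 r^2 of the radius. The accumulated loss over
  \<open>n - i\<close> factors stays below 1/2, so that inverse powers can be bounded linearly
  too.\<close>

lemma loss_upper:
  assumes "i \<le> n"
  defines "\<eta> \<equiv> (18 * r)\<^sup>2 / 2"
  shows "1 - real (n - i) * (162 * r\<^sup>2) \<le> (1 - \<eta>) ^ (n - i)" "real (n - i) * (162 * r\<^sup>2) \<le> 1 / 2"
    "0 < 1 - \<eta>" "1 / (1 - \<eta>) \<le> 2"
proof -
  have \<eta>: "\<eta> = 162 * r\<^sup>2" by (simp add: \<eta>_def power_mult_distrib)
  have "2 * r\<^sup>2 \<le> real n * r\<^sup>2" using n2 by (intro mult_right_mono) auto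
  then have "\<eta> \<le> 1/2" using r(3) by (simp add: \<eta>)
  then show "0 < 1 - \<eta>" "1 / (1 - \<eta>) \<le> 2" by (auto simp: field_simps)
  show "1 - real (n - i) * (162 * r\<^sup>2) \<le> (1 - \<eta>) ^ (n - i)"
    using Bernoulli_inequality[of "- \<eta>" "n - i"] \<open>\<eta> \<le> 1/2\<close> by (simp add: \<eta>)
  have "real (n - i) * r\<^sup>2 \<le> real n * r\<^sup>2" by (intro mult_right_mono) auto
  then show "real (n - i) * (162 * r\<^sup>2) \<le> 1 / 2" using r(3) by simp
qed

text \<open>The hull of a net contains the ball of radius 1 - \<eta>, so one polytope serves all
  indices \<open>i\<close> simultaneously; part (B) depends on this. The constant 324 = 2 * 162 is
  dictated by the circumscribed case.\<close>

lemma inner_deviation_le: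
  "\<exists>P\<in>innerP N. \<forall>i\<le>n. steiner_coeff (D 1) i - steiner_coeff P i \<le> 324 * real (n - i) * r\<^sup>2 * steiner_coeff (D 1) i"
proof -
  obtain T where T: "finite T" "T \<noteq> {}" "T \<subseteq> sphere1" "card T \<le> N" "\<forall>u\<in>sphere1. \<exists>t\<in>T. norm (u - t) \<le> 18 * r"
    using ex_small_net[OF n2 r(1) r_small r(2)] by blast
  define \<eta> where "\<eta> = (18 * r)\<^sup>2 / 2"
  have TD: "T \<subseteq> D 1" using T(3) by (auto simp: sphere1_def in_D)
  have P: "convex hull T \<in> innerP N" by (rule hull_innerP[OF T(1,2,4) TD])
  have sub: "D (1 - \<eta>) \<subseteq> convex hull T" unfolding \<eta>_def by (rule net_hull[OF _ T(1,2,3)]) (use T(5) in blast)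
  have "steiner_coeff (D 1) i - steiner_coeff (convex hull T) i \<le> 324 * real (n - i) * r\<^sup>2 * steiner_coeff (D 1) i"
    if i: "i \<le> n" for i
  proof -
    note lu = loss_upper[OF i, folded \<eta>_def]
    have F: "steiner_coeff (D 1) i > 0" by (rule steiner_coeff_D1_pos[OF i])
    have "(1 - real (n - i) * (162 * r\<^sup>2)) * steiner_coeff (D 1) i \<le> (1 - \<eta>) ^ (n - i) * steiner_coeff (D 1) i"
      using lu(1) F by (intro mult_right_mono) auto
    also have "\<dots> = steiner_coeff (D (1 - \<eta>)) i" using steiner_coeff_D[OF i lu(3)] by simp
    also have "\<dots> \<le> steiner_coeff (convex hull T) i"
      using lu(3) by (intro steiner_coeff_mono body_D body_innerP[OF P] sub i) auto
    finally have "steiner_coeff (D 1) i - steiner_coeff (convex hull T) i \<le> real (n - i) * (162 * r\<^sup>2) * steiner_coeff (D 1) i"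
      by (simp add: left_diff_distrib)
    also have "\<dots> \<le> (324 * real (n - i) * r\<^sup>2) * steiner_coeff (D 1) i"
      using F by (intro mult_right_mono) auto
    finally show ?thesis .
  qed
  then show ?thesis using P by blast
qed

text \<open>The polar of a net lies in the ball of radius 1/(1 - \<eta>), again for all
  \<open>i\<close> at once. The witness is given as a sequence because it also competes in the
  truncated minimisation.\<close>

lemma outer_deviation_le:
  "\<exists>w\<in>D_seqs. polar (w ` {..<N}) \<subseteq> D 2 \<and>
    (\<forall>i\<le>n. steiner_coeff (polar (w ` {..<N})) i - steiner_coeff (D 1) i \<le> 324 * real (n - i) * r\<^sup>2 * steiner_coeff (D 1) i)"
proof -
  obtain T where T: "finite T" "T \<noteq> {}" "T \<subseteq> sphere1" "card T \<le> N" "\<forall>u\<in>sphere1. \<exists>t\<in>T. norm (u - t) \<le> 18 * r"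
    using ex_small_net[OF n2 r(1) r_small r(2)] by blast
  define \<eta> where "\<eta> = (18 * r)\<^sup>2 / 2"
  have TD: "T \<subseteq> D 1" using T(3) by (auto simp: sphere1_def in_D)
  obtain z where z: "z \<in> T" using T(2) by blast
  obtain w :: "nat \<Rightarrow> 'a" where w: "w ` {..<N} \<subseteq> insert z T" "T \<subseteq> w ` {..<N}" "range w \<subseteq> insert z T"
    using finite_enum[OF T(1,4), of z] by blast
  have wT: "w ` {..<N} = T" and wD: "w \<in> D_seqs" using w z TD by (auto simp: D_seqs_def)
  have sub: "polar T \<subseteq> D (1 / (1 - \<eta>))"
  proof
    fix x assume x: "x \<in> polar T"
    show "x \<in> D (1 / (1 - \<eta>))"
      unfolding \<eta>_def
      by (rule net_polar[OF _ T(2,3)]) (use x T(5) r(1) r_small in \<open>auto simp: polar_def inner_commute\<close>)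
  qed
  have sub2: "polar T \<subseteq> D 2" using sub loss_upper(4)[of 0] D_mono unfolding \<eta>_def by blast
  have P: "polar T \<in> outerP N" by (rule polar_outerP[OF T(1,4) TD sub2])
  have "steiner_coeff (polar T) i - steiner_coeff (D 1) i \<le> 324 * real (n - i) * r\<^sup>2 * steiner_coeff (D 1) i"
    if i: "i \<le> n" for i
  proof -
    note lu = loss_upper[OF i, folded \<eta>_def]
    define s where "s = real (n - i) * (162 * r\<^sup>2)"
    have s: "0 \<le> s" "s \<le> 1/2" using lu(2) by (auto simp: s_def)
    have F: "steiner_coeff (D 1) i > 0" by (rule steiner_coeff_D1_pos[OF i])
    have "steiner_coeff (polar T) i \<le> steiner_coeff (D (1 / (1 - \<eta>))) i"
      using lu(3) by (intro steiner_coeff_mono body_D body_outerP[OF P] sub i) auto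
    also have "\<dots> = (1 / (1 - \<eta>)) ^ (n - i) * steiner_coeff (D 1) i"
      using lu(3) by (intro steiner_coeff_D[OF i]) auto
    also have "\<dots> \<le> (1 + 2 * s) * steiner_coeff (D 1) i"
    proof (rule mult_right_mono)
      \<comment> \<open>The bound 1/(1 - s) <= 1 + 2s, valid for 0 <= s <= 1/2, doubles 162 to
        324.\<close>
      have "1 \<le> (1 + 2 * s) * (1 - s)" using s mult_left_mono[of s "1/2" s] by (simp add: algebra_simps)
      also have "\<dots> \<le> (1 + 2 * s) * (1 - \<eta>) ^ (n - i)"
        using lu(1) s by (intro mult_left_mono) (auto simp: s_def)
      finally show "(1 / (1 - \<eta>)) ^ (n - i) \<le> 1 + 2 * s"
        using lu(3) by (simp add: power_divide divide_le_eq)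
    qed (use F in simp)
    finally show ?thesis by (simp add: s_def algebra_simps)
  qed
  then show ?thesis using wT wD sub2 by (intro bexI[of _ w]) auto
qed

text \<open>The truncated minimiser is no worse than the net polytope, whose coefficient exceeds
  that of \<open>D 1\<close> by a factor smaller than 1 + \<delta>; by \<open>far\<close> it has no
  point of norm 2. The untruncated polyhedron is star-shaped about the origin, so it stays inside
  \<open>D 2\<close> and equals its truncation. Every competitor contains its own truncation, hence
  is no better.\<close>

lemma outer_min_attained:
  assumes i: "i < n"
    and far: "\<And>K x. body K \<Longrightarrow> D 1 \<subseteq> K \<Longrightarrow> x \<in> K \<Longrightarrow> norm x = 2 \<Longrightarrow>
      (1 + \<delta>) * steiner_coeff (D 1) i \<le> steiner_coeff K i"
    and \<delta>: "324 * real n * r\<^sup>2 < \<delta>"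
  shows "\<exists>P\<in>outerP N. \<forall>P'\<in>outerP N. steiner_coeff P i \<le> steiner_coeff P' i"
proof -
  have i': "i \<le> n" using i by simp
  have poly2: "poly2 N w = polar (w ` {..<N}) \<inter> D 2" for w
    by (auto simp: poly2_def polar_def in_D inner_commute)
  obtain w where w: "w \<in> D_seqs" "\<forall>u\<in>D_seqs. steiner_coeff (poly2 N w) i \<le> steiner_coeff (poly2 N u) i"
    using poly2_min_attained[OF i'] by blast
  obtain u where u: "u \<in> D_seqs" "polar (u ` {..<N}) \<subseteq> D 2"
    "\<forall>i\<le>n. steiner_coeff (polar (u ` {..<N})) i - steiner_coeff (D 1) i \<le> 324 * real (n - i) * r\<^sup>2 * steiner_coeff (D 1) i"
    using outer_deviation_le by blast
  have F: "steiner_coeff (D 1) i > 0" by (rule steiner_coeff_D1_pos[OF i'])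
  have "steiner_coeff (poly2 N w) i \<le> steiner_coeff (poly2 N u) i" using w u by blast
  also have "poly2 N u = polar (u ` {..<N})" using u(2) by (auto simp: poly2)
  also have "steiner_coeff (polar (u ` {..<N})) i \<le> (1 + 324 * real (n - i) * r\<^sup>2) * steiner_coeff (D 1) i"
    using u(3) i' by (auto simp: distrib_right)
  also have "\<dots> < (1 + \<delta>) * steiner_coeff (D 1) i"
  proof (rule mult_strict_right_mono[OF _ F])
    have "real (n - i) * r\<^sup>2 \<le> real n * r\<^sup>2" by (intro mult_right_mono) auto
    then show "1 + 324 * real (n - i) * r\<^sup>2 < 1 + \<delta>" using \<delta> by simp
  qed
  finally have small: "steiner_coeff (poly2 N w) i < (1 + \<delta>) * steiner_coeff (D 1) i" .
  have no2: "norm x \<noteq> 2" if "x \<in> poly2 N w" for x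
    using far[OF body_poly2[OF w(1)] D_subset_poly2[OF w(1)] that] small by auto
  have bdd: "polar (w ` {..<N}) \<subseteq> D 2"
  proof
    fix y assume y: "y \<in> polar (w ` {..<N})"
    show "y \<in> D 2"
    proof (rule ccontr)
      assume "y \<notin> D 2"
      then have ny: "norm y > 2" using y by (auto simp: polar_def in_D)
      define x where "x = (2 / norm y) *\<^sub>R y"
      have nx: "norm x = 2" using ny by (cases "y = 0") (simp_all add: x_def)
      have "x \<in> E" using y subspace_scale[OF subspace_E] by (auto simp: x_def polar_def)
      moreover have "w j \<bullet> x \<le> 1" if "j < N" for j
      proof -
        have "w j \<bullet> y \<le> 1" using y that by (auto simp: polar_def inner_commute)
        then have "(2 / norm y) * (w j \<bullet> y) \<le> (2 / norm y) * 1" by (intro mult_left_mono) auto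
        also have "\<dots> \<le> 1" using ny by (auto simp: divide_le_eq_1)
        finally show ?thesis by (simp add: x_def)
      qed
      ultimately have "x \<in> poly2 N w" using nx by (auto simp: poly2_def in_D)
      then show False using no2 nx by blast
    qed
  qed
  have wD: "w ` {..<N} \<subseteq> D 1" using w(1) by (auto simp: D_seqs_def)
  have P: "polar (w ` {..<N}) \<in> outerP N"
    using card_image_le[of "{..<N}" w] by (intro polar_outerP[OF _ _ wD bdd]) auto
  have "steiner_coeff (polar (w ` {..<N})) i \<le> steiner_coeff P' i" if P': "P' \<in> outerP N" for P'
  proof -
    obtain v where v: "v \<in> D_seqs" "P' = polar (v ` {..<N})" using outerP_polar[OF P'] n2 by auto
    have "polar (w ` {..<N}) = poly2 N w" using bdd by (auto simp: poly2)
    then have "steiner_coeff (polar (w ` {..<N})) i \<le> steiner_coeff (poly2 N v) i" using w(2) v(1) by simp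
    also have "\<dots> \<le> steiner_coeff P' i"
      by (intro steiner_coeff_mono body_poly2 body_outerP[OF P'] v(1) i') (auto simp: poly2 v(2))
    finally show ?thesis .
  qed
  then show ?thesis using P by blast
qed

lemma inner_min_attained:
  assumes i: "i \<le> n"
  shows "\<exists>P\<in>innerP N. \<forall>P'\<in>innerP N. steiner_coeff P' i \<le> steiner_coeff P i"
proof -
  obtain v where v: "v \<in> D_seqs" "\<forall>u\<in>D_seqs. steiner_coeff (convex hull (u ` {..<N})) i \<le> steiner_coeff (convex hull (v ` {..<N})) i"
    using hull_max_attained[OF i N_pos] by blast
  have "steiner_coeff P' i \<le> steiner_coeff (convex hull (v ` {..<N})) i" if "P' \<in> innerP N" for P'
    using innerP_hull[OF that] v(2) by blast
  then show ?thesis using hull_seq_innerP[OF v(1) N_pos] by blast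
qed

lemma polar_seq_outerP:
  assumes "w \<in> D_seqs" "polar (w ` {..<N}) \<subseteq> D R" shows "polar (w ` {..<N}) \<in> outerP N"
  using card_image_le[of "{..<N}" w] assms
  by (intro polar_outerP[OF _ _ _ assms(2)]) (auto simp: D_seqs_def)

end

end

section \<open>Transfer to the given points\<close>

lemma linear_pt: "linear pt"
  by (rule linearI) (simp_all add: plus_fsvec_def scaleR_fsvec_def)

lemma inj_pt: "inj pt"
  by (simp add: inj_on_def pt_inject)

lemma surj_pt: "surj pt"
  by (rule surjI[of pt vec]) simp

lemma pt_vec_image: "pt ` vec ` S = S"
  by (simp add: image_image)

lemma vec_vimage: "vec -` S = pt ` S"
proof (intro equalityI subsetI)
  fix x assume "x \<in> vec -` S"
  then have "pt (vec x) \<in> pt ` S" by blast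
  then show "x \<in> pt ` S" by simp
qed auto

lemma lookup_pt: "Poly_Mapping.lookup (pt x) i = crd x i"
  by (simp add: crd_def)

lemma Rn_eq: "Rn n = pt ` Eu n"
proof -
  have "x \<in> Rn n \<longleftrightarrow> vec x \<in> Eu n" for x
  proof -
    have "x \<in> Rn n \<longleftrightarrow> (\<forall>i. i \<ge> n \<longrightarrow> i \<notin> Poly_Mapping.keys x)"
      unfolding Rn_def subset_iff mem_Collect_eq lessThan_iff by (meson not_le)
    then show ?thesis by (simp add: Eu_def crd_def in_keys_iff)
  qed
  then have "Rn n = vec -` Eu n" by auto
  also have "\<dots> = pt ` Eu n" by (rule vec_vimage)
  finally show ?thesis .
qed

lemma norm_Eu: "x \<in> Eu n \<Longrightarrow> norm x = sqrt (\<Sum>i<n. (crd x i)\<^sup>2)"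
  unfolding norm_eq_sqrt_inner
  by (subst inner_fsvec_sum[of "{..<n}"]) (auto simp: Eu_def power2_eq_square)

interpretation Rn: euclid_volume_dim "Eu n" "Leb n" n for n
  by (rule euclid_volume_dim_Leb)

lemma unit_ball_eq: "unit_ball n = pt ` Rn.D n 1"
proof -
  have "unit_ball n = {y \<in> pt ` Eu n. sqrt (\<Sum>i<n. (Poly_Mapping.lookup y i)\<^sup>2) \<le> 1}"
    by (simp add: unit_ball_def Rn_eq)
  also have "\<dots> = pt ` {x \<in> Eu n. sqrt (\<Sum>i<n. (crd x i)\<^sup>2) \<le> 1}"
    unfolding crd_def by blast
  also have "{x \<in> Eu n. sqrt (\<Sum>i<n. (crd x i)\<^sup>2) \<le> 1} = Rn.D n 1"
    by (rule Collect_cong[of _ "\<lambda>x. x \<in> Eu n \<and> norm x \<le> 1", THEN trans])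
       (auto simp: norm_Eu Rn.in_D)
  finally show ?thesis .
qed

lemma parallel_body_eq:
  assumes "r \<ge> 0" "K \<noteq> {}" shows "parallel_body n (pt ` K) r = pt ` (K + Rn.D n r)"
proof -
  have D: "(*\<^sub>R) r ` Rn.D n 1 = Rn.D n r"
  proof (cases "r = 0")
    case True
    have "0 \<in> Rn.D n 1" using subspace_0[OF subspace_Eu] by (simp add: Rn.in_D)
    then show ?thesis using True by (auto simp: Rn.D_0)
  next
    case False
    then show ?thesis using Rn.D_scale[of r n 1] assms(1) by simp
  qed
  have L: "pt (a + r *\<^sub>R b) = pt a + r *\<^sub>R pt b" for a b
    by (simp add: plus_fsvec_def scaleR_fsvec_def)
  show ?thesis
  proof (intro equalityI subsetI)
    fix z assume "z \<in> parallel_body n (pt ` K) r"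
    then obtain a b where ab: "a \<in> K" "b \<in> Rn.D n 1" "z = pt (a + r *\<^sub>R b)"
      unfolding parallel_body_def unit_ball_eq L by blast
    have "r *\<^sub>R b \<in> Rn.D n r" using ab(2) D by blast
    then show "z \<in> pt ` (K + Rn.D n r)" using ab by blast
  next
    fix z assume "z \<in> pt ` (K + Rn.D n r)"
    then obtain a b where ab: "a \<in> K" "b \<in> Rn.D n r" "z = pt (a + b)"
      by (auto elim!: set_plus_elim)
    then obtain c where "c \<in> Rn.D n 1" "b = r *\<^sub>R c" using D by blast
    then show "z \<in> parallel_body n (pt ` K) r"
      unfolding parallel_body_def unit_ball_eq using ab L by blast
  qed
qed

text \<open>On \<open>Eu n\<close> the coordinate map used by \<open>vol\<close> is inverse to
  \<open>emb n\<close>, so the set measured there is the preimage that occurs in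
  \<open>Leb n\<close>.\<close>

lemma vol_pt:
  assumes "Rn.body n K" shows "vol n (pt ` K) = Rn.vol n K"
proof -
  have K: "K \<subseteq> Eu n" "K \<in> sets borel" using assms Rn.body_borel by (auto simp: Rn.body_def)
  have "(\<lambda>x. restrict (Poly_Mapping.lookup x) {..<n}) ` pt ` K = emb n -` K \<inter> space (PiL n)"
  proof (intro equalityI subsetI)
    fix f assume "f \<in> (\<lambda>x. restrict (Poly_Mapping.lookup x) {..<n}) ` pt ` K"
    then obtain x where x: "x \<in> K" "f = restrict (Poly_Mapping.lookup (pt x)) {..<n}" by blast
    have "emb n f = emb n (crd x)" by (rule fsvec_eqI) (simp add: crd_emb x(2) lookup_pt)
    also have "\<dots> = x" using x(1) K(1) by (intro emb_crd) auto
    finally show "f \<in> emb n -` K \<inter> space (PiL n)" using x by (auto simp: space_PiM)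
  next
    fix f assume f: "f \<in> emb n -` K \<inter> space (PiL n)"
    have "f = restrict (Poly_Mapping.lookup (pt (emb n f))) {..<n}"
    proof
      fix i show "f i = restrict (Poly_Mapping.lookup (pt (emb n f))) {..<n} i"
        using f by (auto simp: lookup_pt crd_emb space_PiM PiE_def extensional_def restrict_def)
    qed
    then show "f \<in> (\<lambda>x. restrict (Poly_Mapping.lookup x) {..<n}) ` pt ` K" using f by blast
  qed
  then show ?thesis
    unfolding vol_def Rn.vol_def using emeasure_Leb[OF K(2), of n] by (simp add: measure_def)
qed

section \<open>Intrinsic volumes and deviations in terms of Steiner coefficients\<close>

definition \<kappa> :: "nat \<Rightarrow> real" where "\<kappa> i = vol i (unit_ball i)"

lemma \<kappa>_pos: "\<kappa> i > 0"
  using Rn.vol_D_pos[of i] by (simp add: \<kappa>_def unit_ball_eq vol_pt Rn.body_D)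

text \<open>Steiner's formula attaches V_(n-i) to the power \<open>r ^ i\<close>, hence the index
  \<open>n - j\<close>. Uniqueness of polynomial coefficients, together with the prescribed value 0
  above \<open>n\<close>, makes the definite description refer to exactly one family.\<close>

lemma intrinsic_volume_pt:
  assumes K: "Rn.body n K" and j: "j \<le> n"
  shows "intrinsic_volume n j (pt ` K) = Rn.steiner_coeff n K (n - j) / \<kappa> (n - j)"
proof -
  define V where "V = (\<lambda>j. if j \<le> n then Rn.steiner_coeff n K (n - j) / \<kappa> (n - j) else 0)"
  have K0: "K \<noteq> {}" using K by (simp add: Rn.body_def)
  have vol: "vol n (parallel_body n (pt ` K) r) = (\<Sum>i\<le>n. Rn.steiner_coeff n K i * r ^ i)" if "r \<ge> 0" for r
    using that by (simp add: parallel_body_eq K0 vol_pt Rn.body_add K Rn.body_D Rn.steiner)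
  have "(THE V :: nat \<Rightarrow> real. (\<forall>i>n. V i = 0) \<and>
        (\<forall>r\<ge>0. vol n (parallel_body n (pt ` K) r)
                  = (\<Sum>i\<le>n. r ^ i * vol i (unit_ball i) * V (n - i)))) = V"
  proof (rule the_equality)
    have "(\<Sum>i\<le>n. Rn.steiner_coeff n K i * r ^ i) = (\<Sum>i\<le>n. r ^ i * \<kappa> i * V (n - i))" for r
      using \<kappa>_pos by (intro sum.cong refl) (auto simp: V_def less_imp_neq[symmetric])
    then show "(\<forall>i>n. V i = 0) \<and> (\<forall>r\<ge>0. vol n (parallel_body n (pt ` K) r)
                  = (\<Sum>i\<le>n. r ^ i * vol i (unit_ball i) * V (n - i)))"
      using vol by (simp add: V_def \<kappa>_def[symmetric])
  next
    fix W :: "nat \<Rightarrow> real"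
    assume W: "(\<forall>i>n. W i = 0) \<and> (\<forall>r\<ge>0. vol n (parallel_body n (pt ` K) r)
                  = (\<Sum>i\<le>n. r ^ i * vol i (unit_ball i) * W (n - i)))"
    have coeff: "Rn.steiner_coeff n K i = \<kappa> i * W (n - i)" if "i \<le> n" for i
    proof (rule poly_coeffs_unique[OF _ that])
      fix r :: real assume "r > 0"
      then have "(\<Sum>i\<le>n. Rn.steiner_coeff n K i * r ^ i) = (\<Sum>i\<le>n. r ^ i * \<kappa> i * W (n - i))"
        using W vol[of r] by (simp add: \<kappa>_def)
      then show "(\<Sum>i\<le>n. Rn.steiner_coeff n K i * r ^ i) = (\<Sum>i\<le>n. \<kappa> i * W (n - i) * r ^ i)"
        by (simp add: mult_ac)
    qed
    show "W = V"
    proof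
      fix i show "W i = V i"
      proof (cases "i \<le> n")
        case True
        then show ?thesis using coeff[of "n - i"] \<kappa>_pos[of "n - i"] by (simp add: V_def)
      qed (use W in \<open>simp add: V_def\<close>)
    qed
  qed
  then show ?thesis using j by (simp add: intrinsic_volume_def V_def)
qed

lemma intrinsic_volume_unit_ball_pos: "j \<le> n \<Longrightarrow> intrinsic_volume n j (unit_ball n) > 0"
  by (simp add: unit_ball_eq intrinsic_volume_pt Rn.body_D Rn.steiner_coeff_D1_pos \<kappa>_pos)

lemma dim_pt_image: "dim (pt ` U) = dim U"
proof -
  obtain B where B: "B \<subseteq> U" "independent B" "U \<subseteq> span B" "card B = dim U"
    using basis_exists by blast
  have "independent (pt ` B)"
    using linear_independent_injective_image[OF linear_pt B(2) inj_on_subset[OF inj_pt subset_UNIV]] .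
  moreover have "pt ` U \<subseteq> span (pt ` B)"
    using B(3) linear_span_image[OF linear_pt, of B] by auto
  moreover have "card (pt ` B) = dim U" using B(4) card_image[OF inj_on_subset[OF inj_pt subset_UNIV]] by simp
  ultimately show ?thesis using dim_unique[of "pt ` B" "pt ` U"] B(1) by blast
qed

lemma affine_dim_pt: "affine_dim (pt ` S) = adim S"
proof -
  have "{x - y | x y. x \<in> pt ` S \<and> y \<in> pt ` S} = pt ` {x - y | x y. x \<in> S \<and> y \<in> S}"
    by (auto simp: minus_fsvec_def image_iff) (metis pt_vec)+
  then show ?thesis by (simp add: affine_dim_def adim_def dim_pt_image)
qed

lemma is_facet_pt: "is_facet (pt ` F) (pt ` P) \<longleftrightarrow> facet F P"
  by (simp add: is_facet_def facet_def affine_dim_pt face_of_linear_image[OF linear_pt inj_pt])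

lemma card_facets_pt: "card {F. is_facet F (pt ` P)} = card {F. facet F P}"
proof -
  have "{F. is_facet F (pt ` P)} = image pt ` {F. facet F P}"
  proof (intro equalityI subsetI)
    fix F assume "F \<in> {F. is_facet F (pt ` P)}"
    then have "facet (vec ` F) P" using is_facet_pt[of "vec ` F" P] by (simp add: pt_vec_image)
    then show "F \<in> image pt ` {F. facet F P}" by (intro image_eqI[of _ _ "vec ` F"]) (auto simp: pt_vec_image)
  qed (auto simp: is_facet_pt)
  moreover have "inj_on (image pt) {F. facet F P}"
    using inj_pt by (auto simp: inj_on_def inj_image_eq_iff)
  ultimately show ?thesis by (simp add: card_image)
qed

text \<open>Extreme points are one-point faces, so the invariance of faces under injective linear
  maps applies.\<close>

lemma card_extreme_points_pt: "card {v. v extreme_point_of (pt ` P)} = card {v. v extreme_point_of P}"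
proof -
  have "pt v extreme_point_of (pt ` P) \<longleftrightarrow> v extreme_point_of P" for v
    using face_of_linear_image[OF linear_pt inj_pt, of "{v}" P] by (simp add: face_of_singleton)
  then have "{v. v extreme_point_of (pt ` P)} = pt ` {v. v extreme_point_of P}"
    using surj_pt by (force simp: image_iff)
  then show ?thesis using card_image[OF inj_on_subset[OF inj_pt subset_UNIV]] by simp
qed

lemma polytope_pt: "polytope (pt ` P) \<longleftrightarrow> polytope P"
proof
  assume "polytope (pt ` P)"
  then obtain V where V: "finite V" "pt ` P = convex hull V" by (auto simp: polytope_def)
  have "pt ` (convex hull (vec ` V)) = convex hull V"
    using convex_hull_linear_image[OF linear_pt, of "vec ` V"] by (simp add: pt_vec_image)
  then have "P = convex hull (vec ` V)" using V(2) inj_image_eq_iff[OF inj_pt] by metis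
  then show "polytope P" using V(1) unfolding polytope_def by blast
qed (rule polytope_linear_image[OF linear_pt])

lemma inner_polytopes_eq: "inner_polytopes n N = image pt ` Rn.innerP n N"
proof -
  have *: "pt ` P \<in> inner_polytopes n N \<longleftrightarrow> P \<in> Rn.innerP n N" for P
    by (simp add: inner_polytopes_def Rn.innerP_def polytope_pt unit_ball_eq
        inj_image_subset_iff[OF inj_pt] card_extreme_points_pt)
  then show ?thesis using pt_vec_image by (metis (no_types, lifting) image_iff subset_antisym subsetI)
qed

lemma outer_polytopes_eq: "outer_polytopes n N = image pt ` Rn.outerP n N"
proof -
  have *: "pt ` P \<in> outer_polytopes n N \<longleftrightarrow> P \<in> Rn.outerP n N" for P
    by (simp add: outer_polytopes_def Rn.outerP_def polytope_pt unit_ball_eq Rn_eq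
        inj_image_subset_iff[OF inj_pt] card_facets_pt)
  then show ?thesis using pt_vec_image by (metis (no_types, lifting) image_iff subset_antisym subsetI)
qed

text \<open>For nested bodies the deviation is a plain difference of intrinsic volumes.\<close>

lemma intrinsic_deviation_inner:
  assumes P: "P \<in> Rn.innerP n N" and j: "j \<le> n"
  shows "intrinsic_deviation n j (unit_ball n) (pt ` P) =
    (Rn.steiner_coeff n (Rn.D n 1) (n - j) - Rn.steiner_coeff n P (n - j)) / \<kappa> (n - j)"
proof -
  have "unit_ball n \<inter> pt ` P = pt ` P" using P by (auto simp: unit_ball_eq Rn.innerP_def)
  then show ?thesis
    using Rn.body_innerP[OF P] j Rn.body_D[of 1 n]
    by (simp add: intrinsic_deviation_def unit_ball_eq intrinsic_volume_pt diff_divide_distrib)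
qed

lemma intrinsic_deviation_outer:
  assumes P: "P \<in> Rn.outerP n N" and j: "j \<le> n"
  shows "intrinsic_deviation n j (unit_ball n) (pt ` P) =
    (Rn.steiner_coeff n P (n - j) - Rn.steiner_coeff n (Rn.D n 1) (n - j)) / \<kappa> (n - j)"
proof -
  have "unit_ball n \<inter> pt ` P = unit_ball n" using P by (auto simp: unit_ball_eq Rn.outerP_def)
  then show ?thesis
    using Rn.body_outerP[OF P] j Rn.body_D[of 1 n]
    by (simp add: intrinsic_deviation_def unit_ball_eq intrinsic_volume_pt diff_divide_distrib)
qed

text \<open>Takes the role of \<open>r\<close> in the bounds above; its square is the rate
  N^(-2/(n-1)).\<close>

definition mesh :: "nat \<Rightarrow> nat \<Rightarrow> real" where
  "mesh n N = real N powr (- 1 / (real n - 1))"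

lemma mesh_power:
  assumes "n \<ge> 2" "N > 0" shows "mesh n N ^ (n - 1) * N = 1" "mesh n N > 0"
    "(mesh n N)\<^sup>2 = real N powr (- 2 / (real n - 1))"
    "real N powr (2 / (real n - 1)) * (mesh n N)\<^sup>2 = 1"
proof -
  have m: "real (n - 1) = real n - 1" using assms by simp
  have "mesh n N ^ (n - 1) = mesh n N powr (real n - 1)"
    using assms by (simp add: powr_realpow[symmetric] mesh_def)
  also have "\<dots> = real N powr (- 1)" using assms by (simp add: mesh_def powr_powr)
  finally show "mesh n N ^ (n - 1) * N = 1" using assms by (simp add: powr_minus)
  show "mesh n N > 0" using assms by (simp add: mesh_def)
  have "(mesh n N)\<^sup>2 = mesh n N powr 2" using assms by (simp add: mesh_def)
  also have "\<dots> = real N powr (- 2 / (real n - 1))" by (simp add: mesh_def powr_powr)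
  finally show *: "(mesh n N)\<^sup>2 = real N powr (- 2 / (real n - 1))" .
  show "real N powr (2 / (real n - 1)) * (mesh n N)\<^sup>2 = 1"
    unfolding * using assms by (simp add: powr_add[symmetric])
qed

lemma mesh_sq_tendsto: assumes "n \<ge> 2" shows "(\<lambda>N. (mesh n N)\<^sup>2) \<longlonglongrightarrow> 0"
proof -
  have "(\<lambda>N. mesh n N) \<longlonglongrightarrow> 0"
    unfolding mesh_def using assms by (intro tendsto_neg_powr filterlim_real_sequentially) (simp add: divide_neg_pos)
  then show ?thesis using tendsto_power[of "mesh n" 0 sequentially 2] by simp
qed

lemma eventually_mesh_small:
  assumes "n \<ge> 2" "c > 0" shows "\<forall>\<^sub>F N in sequentially. N > 0 \<and> K * (mesh n N)\<^sup>2 < c"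
proof -
  have "(\<lambda>N. K * (mesh n N)\<^sup>2) \<longlonglongrightarrow> K * 0" by (intro tendsto_intros mesh_sq_tendsto assms)
  then have "\<forall>\<^sub>F N in sequentially. K * (mesh n N)\<^sup>2 < c" using assms(2) order_tendstoD(2) by fastforce
  then show ?thesis using eventually_gt_at_top[of 0] by eventually_elim auto
qed

text \<open>\<open>LEAST\<close> denotes the minimum only if it is attained, which is why a
  minimising polytope has to be exhibited.\<close>

lemma min_deviation_eq:
  assumes "P \<in> C" "\<And>P'. P' \<in> C \<Longrightarrow> intrinsic_deviation n j (unit_ball n) P \<le> intrinsic_deviation n j (unit_ball n) P'"
  shows "min_deviation n j C = intrinsic_deviation n j (unit_ball n) P"
  unfolding min_deviation_def using assms by (intro Least_equality) auto

lemma deviation_ge: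
  assumes n: "n \<ge> 2" and N: "N > 0" "n * (mesh n N)\<^sup>2 \<le> 1 / 1000" and j: "j \<le> n"
    and C: "C \<in> {inner_polytopes n N, outer_polytopes n N}" and P: "P \<in> C"
  shows "1 / 2048 * real j * (mesh n N)\<^sup>2 * intrinsic_volume n j (unit_ball n) \<le> intrinsic_deviation n j (unit_ball n) P"
proof -
  have V: "intrinsic_volume n j (unit_ball n) = Rn.steiner_coeff n (Rn.D n 1) (n - j) / \<kappa> (n - j)"
    using j by (simp add: unit_ball_eq intrinsic_volume_pt Rn.body_D)
  note m = mesh_power[OF n N(1)]
  have i: "n - j \<le> n" "n - (n - j) = j" using j by auto
  consider Q where "Q \<in> Rn.innerP n N" "P = pt ` Q" | Q where "Q \<in> Rn.outerP n N" "P = pt ` Q"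
    using C P by (auto simp: inner_polytopes_eq outer_polytopes_eq)
  then show ?thesis
  proof cases
    case 1
    from divide_right_mono[OF Rn.inner_deviation_ge[OF n m(2,1) N(2) 1(1) i(1)] less_imp_le[OF \<kappa>_pos[of "n - j"]]]
    show ?thesis unfolding 1(2) by (simp add: intrinsic_deviation_inner[OF 1(1) j] V i(2))
  next
    case 2
    from divide_right_mono[OF Rn.outer_deviation_ge[OF n m(2,1) N(2) 2(1) i(1)] less_imp_le[OF \<kappa>_pos[of "n - j"]]]
    show ?thesis unfolding 2(2) by (simp add: intrinsic_deviation_outer[OF 2(1) j] V i(2))
  qed
qed

lemma ex_deviation_le:
  assumes n: "n \<ge> 2" and N: "N > 0" "n * (mesh n N)\<^sup>2 \<le> 1 / 1000"
    and C: "C \<in> {inner_polytopes n N, outer_polytopes n N}"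
  shows "\<exists>P\<in>C. \<forall>j\<le>n. intrinsic_deviation n j (unit_ball n) P \<le> 324 * real j * (mesh n N)\<^sup>2 * intrinsic_volume n j (unit_ball n)"
proof -
  have V: "intrinsic_volume n j (unit_ball n) = Rn.steiner_coeff n (Rn.D n 1) (n - j) / \<kappa> (n - j)" if "j \<le> n" for j
    using that by (simp add: unit_ball_eq intrinsic_volume_pt Rn.body_D)
  note m = mesh_power[OF n N(1)]
  have "C = inner_polytopes n N \<or> C = outer_polytopes n N" using C by auto
  then show ?thesis
  proof
    assume C: "C = inner_polytopes n N"
    obtain Q where Q: "Q \<in> Rn.innerP n N" "\<forall>i\<le>n. Rn.steiner_coeff n (Rn.D n 1) i - Rn.steiner_coeff n Q i
        \<le> 324 * real (n - i) * (mesh n N)\<^sup>2 * Rn.steiner_coeff n (Rn.D n 1) i"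
      using Rn.inner_deviation_le[OF n m(2,1) N(2)] by blast
    have "intrinsic_deviation n j (unit_ball n) (pt ` Q) \<le> 324 * real j * (mesh n N)\<^sup>2 * intrinsic_volume n j (unit_ball n)"
      if j: "j \<le> n" for j
      using Q(2)[rule_format, of "n - j"] \<kappa>_pos[of "n - j"] j
      by (simp add: intrinsic_deviation_inner[OF Q(1) j] V[OF j] divide_right_mono)
    then show ?thesis using Q(1) unfolding C inner_polytopes_eq by blast
  next
    assume C: "C = outer_polytopes n N"
    obtain w where w: "w \<in> Rn.D_seqs n" "Rn.polar n (w ` {..<N}) \<subseteq> Rn.D n 2"
      "\<forall>i\<le>n. Rn.steiner_coeff n (Rn.polar n (w ` {..<N})) i - Rn.steiner_coeff n (Rn.D n 1) i
        \<le> 324 * real (n - i) * (mesh n N)\<^sup>2 * Rn.steiner_coeff n (Rn.D n 1) i"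
      using Rn.outer_deviation_le[OF n m(2,1) N(2)] by blast
    have Q: "Rn.polar n (w ` {..<N}) \<in> Rn.outerP n N"
      by (rule Rn.polar_seq_outerP[OF n m(2,1) N(2) w(1,2)])
    have "intrinsic_deviation n j (unit_ball n) (pt ` Rn.polar n (w ` {..<N}))
        \<le> 324 * real j * (mesh n N)\<^sup>2 * intrinsic_volume n j (unit_ball n)"
      if j: "j \<le> n" for j
      using w(3)[rule_format, of "n - j"] \<kappa>_pos[of "n - j"] j
      by (simp add: intrinsic_deviation_outer[OF Q j] V[OF j] divide_right_mono)
    then show ?thesis using Q unfolding C outer_polytopes_eq by blast
  qed
qed

text \<open>Positive \<open>j\<close> means \<open>n - j < n\<close>, which is where
  \<open>far_point\<close> yields a gap. Through this gap \<open>\<delta>\<close> the threshold for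
  \<open>N\<close> depends on \<open>n\<close> and \<open>j\<close>.\<close>

lemma eventually_min_attained:
  assumes n: "n \<ge> 2" and j: "1 \<le> j" "j \<le> n"
  shows "\<forall>\<^sub>F N in sequentially. \<forall>C\<in>{inner_polytopes n N, outer_polytopes n N}.
    \<exists>P\<in>C. min_deviation n j C = intrinsic_deviation n j (unit_ball n) P \<and>
      (\<forall>P'\<in>C. intrinsic_deviation n j (unit_ball n) P \<le> intrinsic_deviation n j (unit_ball n) P')"
proof -
  have i: "n - j < n" "n - j \<le> n" using n j by auto
  obtain \<delta> where \<delta>: "\<delta> > 0" "\<And>K x. Rn.body n K \<Longrightarrow> Rn.D n 1 \<subseteq> K \<Longrightarrow> x \<in> K \<Longrightarrow> norm x = 2 \<Longrightarrow>
      (1 + \<delta>) * Rn.steiner_coeff n (Rn.D n 1) (n - j) \<le> Rn.steiner_coeff n K (n - j)"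
    using Rn.far_point[OF n i(1)] by blast
  have "\<forall>\<^sub>F N in sequentially. N > 0 \<and> real n * (mesh n N)\<^sup>2 < 1 / 1000"
    by (rule eventually_mesh_small[OF n]) simp
  moreover have "\<forall>\<^sub>F N in sequentially. N > 0 \<and> (324 * real n) * (mesh n N)\<^sup>2 < \<delta>"
    by (rule eventually_mesh_small[OF n \<delta>(1)])
  ultimately show ?thesis
  proof eventually_elim
    case (elim N)
    then have N: "N > 0" "real n * (mesh n N)\<^sup>2 \<le> 1 / 1000" "324 * real n * (mesh n N)\<^sup>2 < \<delta>" by auto
    note m = mesh_power[OF n N(1)]
    obtain P where P: "P \<in> Rn.innerP n N"
      "\<forall>P'\<in>Rn.innerP n N. Rn.steiner_coeff n P' (n - j) \<le> Rn.steiner_coeff n P (n - j)"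
      using Rn.inner_min_attained[OF n m(2,1) N(2) i(2)] by blast
    have in_min: "intrinsic_deviation n j (unit_ball n) (pt ` P) \<le> intrinsic_deviation n j (unit_ball n) P'"
      if "P' \<in> inner_polytopes n N" for P'
    proof -
      obtain Q where Q: "Q \<in> Rn.innerP n N" "P' = pt ` Q" using \<open>P' \<in> inner_polytopes n N\<close> inner_polytopes_eq by auto
      then show ?thesis using P(2) \<kappa>_pos[of "n - j"]
        by (simp add: intrinsic_deviation_inner[OF P(1) j(2)] intrinsic_deviation_inner[OF Q(1) j(2)] divide_right_mono)
    qed
    have inP: "pt ` P \<in> inner_polytopes n N" using P(1) by (simp add: inner_polytopes_eq)
    have "\<exists>R\<in>Rn.outerP n N. \<forall>P'\<in>Rn.outerP n N. Rn.steiner_coeff n R (n - j) \<le> Rn.steiner_coeff n P' (n - j)"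
      by (rule Rn.outer_min_attained[OF n m(2,1) N(2) i(1) _ N(3)]) (rule \<delta>(2); assumption)
    then obtain R where R: "R \<in> Rn.outerP n N"
      "\<forall>P'\<in>Rn.outerP n N. Rn.steiner_coeff n R (n - j) \<le> Rn.steiner_coeff n P' (n - j)" by blast
    have out_min: "intrinsic_deviation n j (unit_ball n) (pt ` R) \<le> intrinsic_deviation n j (unit_ball n) P'"
      if "P' \<in> outer_polytopes n N" for P'
    proof -
      obtain Q where Q: "Q \<in> Rn.outerP n N" "P' = pt ` Q" using \<open>P' \<in> outer_polytopes n N\<close> outer_polytopes_eq by auto
      then show ?thesis using R(2) \<kappa>_pos[of "n - j"]
        by (simp add: intrinsic_deviation_outer[OF R(1) j(2)] intrinsic_deviation_outer[OF Q(1) j(2)] divide_right_mono)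
    qed
    have outP: "pt ` R \<in> outer_polytopes n N" using R(1) by (simp add: outer_polytopes_eq)
    show ?case
      using min_deviation_eq[OF inP in_min] min_deviation_eq[OF outP out_min] inP outP in_min out_min by auto
  qed
qed

theorem corollary4:
  shows "\<exists>c1 c2 :: real. c1 > 0 \<and> c2 > 0 \<and>
    (\<forall>n::nat. n \<ge> 2 \<longrightarrow>
      (\<forall>j\<in>{1..n}. \<forall>\<^sub>F N in sequentially. \<forall>C\<in>{inner_polytopes n N, outer_polytopes n N}.
         c1 * real j * intrinsic_volume n j (unit_ball n)
           \<le> real N powr (2 / (real n - 1)) * min_deviation n j C \<and>
         real N powr (2 / (real n - 1)) * min_deviation n j C
           \<le> c2 * real j * intrinsic_volume n j (unit_ball n)) \<and>
      (\<forall>\<^sub>F N in sequentially. \<forall>C\<in>{inner_polytopes n N, outer_polytopes n N}. \<exists>P\<in>C.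
         c1 * real n * real N powr (- 2 / (real n - 1))
           \<le> Max ((\<lambda>j. intrinsic_deviation n j (unit_ball n) P
                      / intrinsic_volume n j (unit_ball n)) ` {1..n}) \<and>
         Max ((\<lambda>j. intrinsic_deviation n j (unit_ball n) P
                 / intrinsic_volume n j (unit_ball n)) ` {1..n})
           \<le> c2 * real n * real N powr (- 2 / (real n - 1))))"
\<comment> \<open>The first constant is that of \<open>gain_lower\<close>, the second that of the
  circumscribed net polytopes; neither depends on \<open>n\<close>, \<open>j\<close> or
  \<open>N\<close>.\<close>
proof (rule exI[of _ "1 / 2048 :: real"], rule exI[of _ "324 :: real"], intro conjI allI impI ballI)
  fix n :: nat assume n: "n \<ge> 2"
  have ev: "\<forall>\<^sub>F N in sequentially. N > 0 \<and> real n * (mesh n N)\<^sup>2 < 1 / 1000"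
    by (rule eventually_mesh_small[OF n]) simp
  {
    fix j assume j: "j \<in> {1..n}"
    then have j': "1 \<le> j" "j \<le> n" by auto
    from ev eventually_min_attained[OF n j']
    show "\<forall>\<^sub>F N in sequentially. \<forall>C\<in>{inner_polytopes n N, outer_polytopes n N}.
         1 / 2048 * real j * intrinsic_volume n j (unit_ball n)
           \<le> real N powr (2 / (real n - 1)) * min_deviation n j C \<and>
         real N powr (2 / (real n - 1)) * min_deviation n j C
           \<le> 324 * real j * intrinsic_volume n j (unit_ball n)"
    proof eventually_elim
      case (elim N)
      then have N: "N > 0" "real n * (mesh n N)\<^sup>2 \<le> 1 / 1000" by auto
      note m = mesh_power[OF n N(1)]
      define p where "p = real N powr (2 / (real n - 1))"
      have p: "p \<ge> 0" "p * (mesh n N)\<^sup>2 = 1" using m(4) by (auto simp: p_def)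
      have scale: "p * (c * real j * (mesh n N)\<^sup>2 * v) = c * real j * v" for c v
      proof -
        have "p * (c * real j * (mesh n N)\<^sup>2 * v) = (p * (mesh n N)\<^sup>2) * (c * real j * v)" by (simp add: mult_ac)
        then show ?thesis using p(2) by simp
      qed
      show ?case
      proof
        fix C assume C: "C \<in> {inner_polytopes n N, outer_polytopes n N}"
        then obtain P where P: "P \<in> C" "min_deviation n j C = intrinsic_deviation n j (unit_ball n) P"
          "\<forall>P'\<in>C. intrinsic_deviation n j (unit_ball n) P \<le> intrinsic_deviation n j (unit_ball n) P'"
          using elim by blast
        obtain P' where P': "P' \<in> C" "\<forall>j\<le>n. intrinsic_deviation n j (unit_ball n) P'
            \<le> 324 * real j * (mesh n N)\<^sup>2 * intrinsic_volume n j (unit_ball n)"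
          using ex_deviation_le[OF n N C] by blast
        have "intrinsic_deviation n j (unit_ball n) P \<le> 324 * real j * (mesh n N)\<^sup>2 * intrinsic_volume n j (unit_ball n)"
          using P(3) P' j'(2) by (meson order_trans)
        then have "p * min_deviation n j C \<le> p * (324 * real j * (mesh n N)\<^sup>2 * intrinsic_volume n j (unit_ball n))"
          unfolding P(2) using p(1) by (rule mult_left_mono)
        moreover have "p * (1 / 2048 * real j * (mesh n N)\<^sup>2 * intrinsic_volume n j (unit_ball n)) \<le> p * min_deviation n j C"
          unfolding P(2) by (rule mult_left_mono[OF deviation_ge[OF n N j'(2) C P(1)] p(1)])
        ultimately show "1 / 2048 * real j * intrinsic_volume n j (unit_ball n)
           \<le> real N powr (2 / (real n - 1)) * min_deviation n j C \<and>
         real N powr (2 / (real n - 1)) * min_deviation n j C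
           \<le> 324 * real j * intrinsic_volume n j (unit_ball n)"
          unfolding scale p_def[symmetric] by blast
      qed
    qed
  }
  from ev
  show "\<forall>\<^sub>F N in sequentially. \<forall>C\<in>{inner_polytopes n N, outer_polytopes n N}. \<exists>P\<in>C.
         1 / 2048 * real n * real N powr (- 2 / (real n - 1))
           \<le> Max ((\<lambda>j. intrinsic_deviation n j (unit_ball n) P
                      / intrinsic_volume n j (unit_ball n)) ` {1..n}) \<and>
         Max ((\<lambda>j. intrinsic_deviation n j (unit_ball n) P
                 / intrinsic_volume n j (unit_ball n)) ` {1..n})
           \<le> 324 * real n * real N powr (- 2 / (real n - 1))"
  proof eventually_elim
    case (elim N)
    then have N: "N > 0" "real n * (mesh n N)\<^sup>2 \<le> 1 / 1000" by auto
    show ?case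
    proof
      fix C assume C: "C \<in> {inner_polytopes n N, outer_polytopes n N}"
      obtain P where P: "P \<in> C" "\<forall>j\<le>n. intrinsic_deviation n j (unit_ball n) P
          \<le> 324 * real j * (mesh n N)\<^sup>2 * intrinsic_volume n j (unit_ball n)"
        using ex_deviation_le[OF n N C] by blast
      define q where "q j = intrinsic_deviation n j (unit_ball n) P / intrinsic_volume n j (unit_ball n)" for j
      have le: "q j \<le> 324 * real n * (mesh n N)\<^sup>2" if j: "j \<in> {1..n}" for j
      proof -
        have "q j \<le> 324 * real j * (mesh n N)\<^sup>2"
          using P(2) j intrinsic_volume_unit_ball_pos[of j n] by (simp add: q_def divide_le_eq)
        also have "\<dots> \<le> 324 * real n * (mesh n N)\<^sup>2" using j by (intro mult_right_mono) auto
        finally show ?thesis .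
      qed
      \<comment> \<open>For the lower bound the single index \<open>n\<close> suffices, since there
        the factor j equals n; it holds for every polytope of the class, so \<open>P\<close> can be
        chosen for the upper bound alone.\<close>
      have "1 / 2048 * real n * (mesh n N)\<^sup>2 \<le> q n"
        using deviation_ge[OF n N order_refl C P(1)] intrinsic_volume_unit_ball_pos[of n n]
        by (simp add: q_def le_divide_eq)
      also have "q n \<le> Max (q ` {1..n})" using n by (intro Max_ge) auto
      finally have ge: "1 / 2048 * real n * (mesh n N)\<^sup>2 \<le> Max (q ` {1..n})" .
      have "Max (q ` {1..n}) \<le> 324 * real n * (mesh n N)\<^sup>2"
        using le n by (subst Max_le_iff) auto
      with ge show "\<exists>P\<in>C. 1 / 2048 * real n * real N powr (- 2 / (real n - 1))
           \<le> Max ((\<lambda>j. intrinsic_deviation n j (unit_ball n) P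
                      / intrinsic_volume n j (unit_ball n)) ` {1..n}) \<and>
         Max ((\<lambda>j. intrinsic_deviation n j (unit_ball n) P
                 / intrinsic_volume n j (unit_ball n)) ` {1..n})
           \<le> 324 * real n * real N powr (- 2 / (real n - 1))"
        using P(1) unfolding mesh_power(3)[OF n N(1)] q_def by blast
    qed
  qed
qed simp_all

end
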